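(* Let $\Omega\subset\mathbb{R}^d$ be compact with $d\ge2$, let $X_1,X_2,\ldots$ be i.i.d. in $\Omega$ with density $\varphi_P$ and $Y_1,Y_2,\ldots$ i.i.d. in $\Omega$ with density $\varphi_D$, all independent, and let $L^*(n)$ be the length of the optimal stacker crane tour through the pairs $(X_i,Y_i)$, $i=1,\ldots,n$. Let $X,Y$ be independent with densities $\varphi_P,\varphi_D$. If $d\ge3$, $$\limsup_{n\to\infty}\frac{L^*(n)-n\bigl[\mathbb{E}\|Y-X\|+W(\varphi_D,\varphi_P)\bigr]}{n^{1-1/d}}\le\kappa(\varphi_P,\varphi_D)\quad\text{almost surely},$$ where $\kappa(\varphi_P,\varphi_D)=\min_{\phi\in\{\varphi_P,\varphi_D\}}\beta_{M,d}\int_\Omega\phi(x)^{1-1/d}\,dx$. If $d=2$, there is a positive constant $\gamma$ such that, with probability tending to $1$ as $n\to\infty$, $$\frac{L^*(n)-n\bigl[\mathbb{E}\|Y-X\|+W(\varphi_D,\varphi_P)\bigr]}{\sqrt{n\log n}}\le\gamma.$$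
   Context: A stacker crane tour through pairs $(x_i,y_i)$ is a closed tour through all $x_i,y_i$ in which each pickup $x_i$ is immediately followed by its delivery $y_i$; its length is the sum of Euclidean distances along the tour. $W(\varphi_1,\varphi_2)=\inf_{\gamma\in\Gamma(\varphi_1,\varphi_2)}\int_{\Omega\times\Omega}\|y-x\|\,d\gamma(x,y)$ is the Euclidean Wasserstein distance, with $\Gamma(\varphi_1,\varphi_2)$ the set of measures on $\Omega\times\Omega$ with marginal densities $\varphi_1,\varphi_2$. For $d\ge3$, $\beta_{M,d}$ denotes the constant (known to exist from prior work) such that, whenever two independent $n$-point samples are i.i.d. from the same distribution on a compact $\Omega\subset\mathbb{R}^d$ with density $\varphi$, their optimal bipartite matching cost $L$ satisfies $\lim_n L/n^{1-1/d}=\beta_{M,d}\int_\Omega\overline{\varphi}(x)^{1-1/d}dx$ almost surely ($\overline\varphi$ the density of the absolutely continuous part). The densities are densities of absolutely continuous distributions. *)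

theory Defs
  imports "HOL-Probability.Probability"
begin

definition sc_tour_length ::
  "(nat \<Rightarrow> 'a::metric_space) \<Rightarrow> (nat \<Rightarrow> 'a) \<Rightarrow> nat \<Rightarrow> (nat \<Rightarrow> nat) \<Rightarrow> real" where
  "sc_tour_length x y n \<sigma> =
     (\<Sum>k<n. dist (x (\<sigma> k)) (y (\<sigma> k)) + dist (y (\<sigma> k)) (x (\<sigma> (Suc k mod n))))"

definition stacker_crane_opt ::
  "(nat \<Rightarrow> 'a::metric_space) \<Rightarrow> (nat \<Rightarrow> 'a) \<Rightarrow> nat \<Rightarrow> real" where
  "stacker_crane_opt x y n = Min {sc_tour_length x y n \<sigma> | \<sigma>. \<sigma> permutes {..<n}}"

definition matching_cost ::
  "(nat \<Rightarrow> 'a::metric_space) \<Rightarrow> (nat \<Rightarrow> 'a) \<Rightarrow> nat \<Rightarrow> real" where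
  "matching_cost u v n = Min {(\<Sum>i<n. dist (u i) (v (\<sigma> i))) | \<sigma>. \<sigma> permutes {..<n}}"

definition couplings ::
  "'a::euclidean_space set \<Rightarrow> ('a \<Rightarrow> real) \<Rightarrow> ('a \<Rightarrow> real) \<Rightarrow> ('a \<times> 'a) measure set" where
  "couplings \<Omega> \<phi>1 \<phi>2 = {\<gamma>. sets \<gamma> = sets borel \<and>
      emeasure \<gamma> (space \<gamma> - \<Omega> \<times> \<Omega>) = 0 \<and>
      distr \<gamma> borel fst = density lborel (\<lambda>x. ennreal (\<phi>1 x)) \<and>
      distr \<gamma> borel snd = density lborel (\<lambda>x. ennreal (\<phi>2 x))}"

definition wasserstein ::
  "'a::euclidean_space set \<Rightarrow> ('a \<Rightarrow> real) \<Rightarrow> ('a \<Rightarrow> real) \<Rightarrow> real" where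
  "wasserstein \<Omega> \<phi>1 \<phi>2 =
     enn2real (INF \<gamma>\<in>couplings \<Omega> \<phi>1 \<phi>2. \<integral>\<^sup>+ z. ennreal (norm (snd z - fst z)) \<partial>\<gamma>)"

text \<open>The defining property of the constant beta_{M,d} (d = DIM('a)): for every compact
  Omega and every pair of independent i.i.d. samples with common density phi on Omega,
  the optimal matching cost L_n satisfies L_n / n^(1-1/d) -> beta * int_Omega phi^(1-1/d)
  almost surely.  The sample space type is made explicit by the first argument.\<close>
definition beta_M_property :: "'m itself \<Rightarrow> 'a::euclidean_space itself \<Rightarrow> real \<Rightarrow> bool" where
  "beta_M_property _ _ \<beta> \<longleftrightarrow>
    (\<forall>(M::'m measure) (\<Omega>::'a set) (\<phi>::'a \<Rightarrow> real) (U::nat \<Rightarrow> 'm \<Rightarrow> 'a) (V::nat \<Rightarrow> 'm \<Rightarrow> 'a).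
       prob_space M \<and> compact \<Omega> \<and> (\<forall>x. 0 \<le> \<phi> x) \<and>
       (\<forall>i. distributed M lborel (U i) (\<lambda>x. ennreal (\<phi> x))) \<and>
       (\<forall>i. distributed M lborel (V i) (\<lambda>x. ennreal (\<phi> x))) \<and>
       (\<forall>i. AE \<omega> in M. U i \<omega> \<in> \<Omega> \<and> V i \<omega> \<in> \<Omega>) \<and>
       prob_space.indep_vars M (\<lambda>_. borel) (case_sum U V) UNIV
       \<longrightarrow> (AE \<omega> in M.
             (\<lambda>n. matching_cost (\<lambda>i. U i \<omega>) (\<lambda>i. V i \<omega>) n
                    / real n powr (1 - 1 / real DIM('a)))
             \<longlonglongrightarrow> \<beta> * (\<integral>x\<in>\<Omega>. \<phi> x powr (1 - 1 / real DIM('a)) \<partial>lborel)))"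

end

theory Submission
  imports Defs "HOL-Combinatorics.Cycles" "HOL-Probability.Hoeffding" "HOL-Real_Asymp.Real_Asymp"
begin

text \<open>An optimal matching of deliveries to pickups yields a union of closed subtours, one for each
  cycle of the matching permutation. Since the labels of the deliveries are exchangeable, this
  permutation may be taken uniformly random, so merging the subtours costs only \<open>O(log n)\<close> in
  expectation. Drawing the samples from a coupling of the two densities and optimising over the
  coupling bounds the expected matching cost by \<open>n W\<close> plus the expected matching cost of two samples
  from one and the same density, whichever of the two is chosen. The latter is governed by \<open>\<beta>\<^sub>M\<close> if
  \<open>d \<ge> 3\<close>. If \<open>d = 2\<close>, it is \<open>O(sqrt (n log n))\<close> for every law on a compact set: by duality the cost is
  the supremum of the discrepancies of Lipschitz functions; on a grid of mesh \<open>n\<^sup>-\<^sup>1\<^sup>/\<^sup>2\<close> their Dirichlet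
  energy is bounded, and the dual energy of the empirical difference has expectation \<open>O(log n)\<close> after
  normalisation. All costs are Lipschitz in the points with respect to the sum of the distances, so
  McDiarmid's inequality turns bounds in expectation into almost sure bounds (\<open>d \<ge> 3\<close>) and bounds in
  probability (\<open>d = 2\<close>).\<close>

section \<open>Minima over permutations\<close>

abbreviation Min_permutes :: "'i set \<Rightarrow> (('i \<Rightarrow> 'i) \<Rightarrow> 'b::linorder) \<Rightarrow> 'b" where
  "Min_permutes S F \<equiv> Min {F \<sigma> | \<sigma>. \<sigma> permutes S}"

lemma finite_permutes_image: "finite S \<Longrightarrow> finite {F \<sigma> | \<sigma>. \<sigma> permutes S}"
  using finite_permutations[of S] by (simp add: setcompr_eq_image)

lemma Min_permutes_le:
  assumes "finite S" "\<sigma> permutes S"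
  shows "Min_permutes S F \<le> F \<sigma>"
  by (rule Min_le[OF finite_permutes_image]) (use assms in auto)

lemma Min_permutes_attained:
  assumes "finite S"
  obtains \<sigma> where "\<sigma> permutes S" "Min_permutes S F = F \<sigma>"
proof -
  have "{F \<sigma> | \<sigma>. \<sigma> permutes S} \<noteq> {}" using permutes_id by blast
  then have "Min_permutes S F \<in> {F \<sigma> | \<sigma>. \<sigma> permutes S}"
    by (rule Min_in[OF finite_permutes_image[OF assms]])
  then show ?thesis using that by auto
qed

lemma Min_permutes_le_add:
  fixes F G :: "('i \<Rightarrow> 'i) \<Rightarrow> real"
  assumes S: "finite S" and FG: "\<And>\<sigma>. \<sigma> permutes S \<Longrightarrow> F \<sigma> \<le> G \<sigma> + c"
  shows "Min_permutes S F \<le> Min_permutes S G + c"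
proof -
  obtain \<sigma> where "\<sigma> permutes S" "Min_permutes S G = G \<sigma>" by (rule Min_permutes_attained[OF S])
  then show ?thesis using Min_permutes_le[OF S, of \<sigma> F] FG[of \<sigma>] by linarith
qed

lemma borel_measurable_Min_permutes:
  fixes F :: "'m \<Rightarrow> ('i \<Rightarrow> 'i) \<Rightarrow> real"
  assumes S: "finite S" and F: "\<And>\<sigma>. \<sigma> permutes S \<Longrightarrow> (\<lambda>\<omega>. F \<omega> \<sigma>) \<in> borel_measurable M"
  shows "(\<lambda>\<omega>. Min_permutes S (F \<omega>)) \<in> borel_measurable M"
  unfolding setcompr_eq_image
  using F by (intro borel_measurable_Min finite_permutations[OF S]) auto

lemma sum_permutes:
  assumes "\<sigma> permutes S"
  shows "(\<Sum>i\<in>S. g (\<sigma> i)) = (\<Sum>i\<in>S. g i)"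
  using sum.permute[OF assms, of g] by (simp add: comp_def)

section \<open>Cyclic permutations\<close>

definition full_cycle :: "'a set \<Rightarrow> ('a \<Rightarrow> 'a) \<Rightarrow> bool" where
  "full_cycle S \<rho> \<longleftrightarrow> (\<exists>cs. distinct cs \<and> set cs = S \<and> \<rho> = cycle_of_list cs)"

lemma full_cycle_permutes: "full_cycle S \<rho> \<Longrightarrow> \<rho> permutes S"
  using cycle_permutes by (auto simp: full_cycle_def)

lemma ex_full_cycle: "finite S \<Longrightarrow> \<exists>\<rho>. full_cycle S \<rho>"
  using finite_distinct_list by (auto simp: full_cycle_def)

lemma full_cycle_insert:
  assumes "full_cycle S \<rho>" "a \<notin> S" "b \<in> S"
  shows "full_cycle (insert a S) (Transposition.transpose a b \<circ> \<rho>)"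
proof -
  obtain cs where cs: "distinct cs" "set cs = S" "\<rho> = cycle_of_list cs"
    using assms(1) by (auto simp: full_cycle_def)
  obtain as bs where "cs = as @ b # bs" using assms(3) cs(2) split_list by metis
  then have rotated: "rotate (length as) cs = b # bs @ as" by (simp add: rotate_append)
  then have "\<rho> = cycle_of_list (b # bs @ as)"
    using cycle_of_list_rotate_independent[OF cs(1)] cs(3) by metis
  then have "Transposition.transpose a b \<circ> \<rho> = cycle_of_list (a # b # bs @ as)" by simp
  moreover have "distinct (b # bs @ as)" "set (b # bs @ as) = S"
    using cs(1,2) by (metis rotated distinct_rotate, metis rotated set_rotate)
  ultimately show ?thesis
    using assms(2) unfolding full_cycle_def by (metis distinct.simps(2) list.simps(15))
qed

lemma map_cycle_of_list: "distinct cs \<Longrightarrow> map (cycle_of_list cs) cs = rotate1 cs"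
  using cyclic_rotation[of cs 1] by simp

lemma cycle_of_list_nth:
  assumes "distinct cs" "k < length cs"
  shows "cycle_of_list cs (cs ! k) = cs ! (Suc k mod length cs)"
  using arg_cong[OF map_cycle_of_list[OF assms(1)], of "\<lambda>l. l ! k"] assms(2) by (simp add: nth_rotate1)

definition cycle_distance :: "'a set \<Rightarrow> ('a \<Rightarrow> 'a) \<Rightarrow> nat" where
  "cycle_distance S \<tau> = (INF \<rho>\<in>{\<rho>. full_cycle S \<rho>}. card {i \<in> S. \<rho> i \<noteq> \<tau> i})"

lemma cycle_distance_le: "full_cycle S \<rho> \<Longrightarrow> cycle_distance S \<tau> \<le> card {i \<in> S. \<rho> i \<noteq> \<tau> i}"
  unfolding cycle_distance_def by (rule cINF_lower) auto

lemma cycle_distance_attained: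
  assumes "finite S"
  obtains \<rho> where "full_cycle S \<rho>" "card {i \<in> S. \<rho> i \<noteq> \<tau> i} = cycle_distance S \<tau>"
proof -
  have "cycle_distance S \<tau> \<in> (\<lambda>\<rho>. card {i \<in> S. \<rho> i \<noteq> \<tau> i}) ` {\<rho>. full_cycle S \<rho>}"
    unfolding cycle_distance_def using ex_full_cycle[OF assms] by (intro Inf_nat_def1) auto
  then show ?thesis using that by auto
qed

lemma cycle_distance_transpose_le:
  assumes S: "finite S" and a: "a \<notin> S" and b: "b \<in> S" and q: "q permutes S"
  shows "cycle_distance (insert a S) (Transposition.transpose a b \<circ> q) \<le> cycle_distance S q"
proof -
  obtain \<rho> where \<rho>: "full_cycle S \<rho>" "card {i \<in> S. \<rho> i \<noteq> q i} = cycle_distance S q"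
    by (rule cycle_distance_attained[OF S])
  have fixed: "\<rho> a = a" "q a = a"
    using a full_cycle_permutes[OF \<rho>(1)] q by (auto simp: permutes_def)
  have "(Transposition.transpose a b \<circ> \<rho>) i = (Transposition.transpose a b \<circ> q) i \<longleftrightarrow> \<rho> i = q i" for i
    unfolding comp_apply inj_eq[OF inj_transpose] ..
  moreover have "i \<noteq> a" if "\<rho> i \<noteq> q i" for i using fixed that by metis
  ultimately have "{i \<in> insert a S. (Transposition.transpose a b \<circ> \<rho>) i
      \<noteq> (Transposition.transpose a b \<circ> q) i} = {i \<in> S. \<rho> i \<noteq> q i}" by blast
  then show ?thesis
    using cycle_distance_le[OF full_cycle_insert[OF \<rho>(1) a b], of "Transposition.transpose a b \<circ> q"] \<rho>(2)
    by (simp only:)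
qed

lemma cycle_distance_insert_le:
  assumes S: "finite S" "S \<noteq> {}" and a: "a \<notin> S"
  shows "cycle_distance (insert a S) q \<le> cycle_distance S q + 2"
proof -
  obtain \<rho> where \<rho>: "full_cycle S \<rho>" "card {i \<in> S. \<rho> i \<noteq> q i} = cycle_distance S q"
    by (rule cycle_distance_attained[OF S(1)])
  note permutes = full_cycle_permutes[OF \<rho>(1)]
  obtain s where s: "s \<in> S" using S(2) by blast
  have "\<rho> a = a" using a permutes by (auto simp: permutes_def)
  then have "\<rho> i \<noteq> a" "\<rho> i \<noteq> s" if "i \<noteq> a" "i \<noteq> inv \<rho> s" for i
    using that permutes_inverses(2)[OF permutes] by metis+
  then have "(Transposition.transpose a s \<circ> \<rho>) i = \<rho> i" if "i \<noteq> a" "i \<noteq> inv \<rho> s" for i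
    using that by simp
  then have "{i \<in> insert a S. (Transposition.transpose a s \<circ> \<rho>) i \<noteq> q i}
      \<subseteq> {i \<in> S. \<rho> i \<noteq> q i} \<union> {a, inv \<rho> s}"
    by (auto simp del: comp_apply)
  then have "card {i \<in> insert a S. (Transposition.transpose a s \<circ> \<rho>) i \<noteq> q i}
      \<le> card ({i \<in> S. \<rho> i \<noteq> q i} \<union> {a, inv \<rho> s})"
    using S(1) by (intro card_mono) auto
  also have "\<dots> \<le> card {i \<in> S. \<rho> i \<noteq> q i} + card {a, inv \<rho> s}" by (rule card_Un_le)
  also have "\<dots> \<le> cycle_distance S q + 2" by (simp add: \<rho>(2) card_insert_if)
  finally show ?thesis
    by (rule order_trans[OF cycle_distance_le[OF full_cycle_insert[OF \<rho>(1) a s]]])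
qed

text \<open>A uniformly random permutation of \<open>insert a S\<close> arises by inserting \<open>a\<close> into one of \<open>S\<close>. The
  element \<open>a\<close> is a fixed point with probability \<open>1 / (card S + 1)\<close>, and only then does the insertion
  cost two further changes.\<close>
lemma sum_cycle_distance_le:
  assumes "finite S" "S \<noteq> {}"
  shows "(\<Sum>\<tau> | \<tau> permutes S. real (cycle_distance S \<tau>)) \<le> 2 * fact (card S) * harm (card S)"
  using assms
proof (induction S rule: finite_ne_induct)
  case (singleton a)
  have "full_cycle {a} id" unfolding full_cycle_def by (rule exI[of _ "[a]"]) simp
  then have "cycle_distance {a} id \<le> card {i \<in> {a}. id i \<noteq> id i}" by (rule cycle_distance_le)
  then show ?case by (simp add: permutes_sing harm_nonneg flip: id_def)
next
  case (insert a S)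
  let ?d = "cycle_distance S" and ?N = "card S"
  have insertion_le: "cycle_distance (insert a S) (Transposition.transpose a b \<circ> q)
      \<le> ?d q + (if b = a then 2 else 0)"
    if "b \<in> insert a S" "q permutes S" for b q
    using cycle_distance_transpose_le[OF insert.hyps(1,3) _ that(2), of b]
      cycle_distance_insert_le[OF insert.hyps(1,2,3), of q] that(1) by (cases "b = a") simp_all
  have "(\<Sum>\<tau> | \<tau> permutes insert a S. real (cycle_distance (insert a S) \<tau>)) =
      (\<Sum>b\<in>insert a S. \<Sum>q | q permutes S.
        real (cycle_distance (insert a S) (Transposition.transpose a b \<circ> q)))"
    using insert.hyps by (intro sum_over_permutations_insert) auto
  also have "\<dots> \<le> (\<Sum>b\<in>insert a S. \<Sum>q | q permutes S. real (?d q + (if b = a then 2 else 0)))"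
    by (intro sum_mono of_nat_mono insertion_le) auto
  also have "\<dots> = (\<Sum>b\<in>insert a S. (\<Sum>q | q permutes S. real (?d q)) + (if b = a then 2 * fact ?N else 0))"
    using insert.hyps by (intro sum.cong refl) (simp add: sum.distrib card_permutations)
  also have "\<dots> = Suc ?N * (\<Sum>q | q permutes S. real (?d q)) + 2 * fact ?N"
    using insert.hyps by (simp add: sum.distrib algebra_simps)
  also have "\<dots> \<le> Suc ?N * (2 * fact ?N * harm ?N) + 2 * fact ?N"
    using insert.IH by (intro add_mono mult_left_mono) auto
  also have "\<dots> = 2 * fact (Suc ?N) * harm (Suc ?N)"
    by (simp add: harm_Suc field_simps)
  finally show ?case using insert.hyps by simp
qed

section \<open>Matchings and tours\<close>

lemma matching_cost_le:
  "\<sigma> permutes {..<n} \<Longrightarrow> matching_cost u v n \<le> (\<Sum>i<n. dist (u i) (v (\<sigma> i)))"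
  unfolding matching_cost_def by (rule Min_permutes_le) auto

lemma matching_cost_attained:
  obtains \<sigma> where "\<sigma> permutes {..<n}" "matching_cost u v n = (\<Sum>i<n. dist (u i) (v (\<sigma> i)))"
  unfolding matching_cost_def by (rule Min_permutes_attained[OF finite_lessThan])

lemma stacker_crane_opt_le:
  "\<sigma> permutes {..<n} \<Longrightarrow> stacker_crane_opt x y n \<le> sc_tour_length x y n \<sigma>"
  unfolding stacker_crane_opt_def by (rule Min_permutes_le) auto

lemma sc_tour_length_eq_cycle:
  assumes \<sigma>: "\<sigma> permutes {..<n}"
  shows "sc_tour_length x y n \<sigma> =
    (\<Sum>i<n. dist (x i) (y i)) + (\<Sum>i<n. dist (y i) (x (cycle_of_list (map \<sigma> [0..<n]) i)))"
proof -
  define \<rho> where "\<rho> = cycle_of_list (map \<sigma> [0..<n])"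
  have "\<rho> (\<sigma> k) = \<sigma> (Suc k mod n)" if "k < n" for k
  proof -
    have "distinct (map \<sigma> [0..<n])"
      using permutes_inj_on[OF \<sigma>] by (auto simp: distinct_map)
    from cycle_of_list_nth[OF this, of k] show ?thesis using that by (simp add: \<rho>_def)
  qed
  then have "sc_tour_length x y n \<sigma> =
      (\<Sum>k<n. dist (x (\<sigma> k)) (y (\<sigma> k))) + (\<Sum>k<n. dist (y (\<sigma> k)) (x (\<rho> (\<sigma> k))))"
    unfolding sc_tour_length_def by (simp add: sum.distrib)
  then show ?thesis
    by (simp add: sum_permutes[OF \<sigma>, of "\<lambda>i. dist (x i) (y i)"]
        sum_permutes[OF \<sigma>, of "\<lambda>i. dist (y i) (x (\<rho> i))"] flip: \<rho>_def)
qed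

lemma stacker_crane_opt_le_full_cycle:
  assumes "full_cycle {..<n} \<rho>"
  shows "stacker_crane_opt x y n \<le> (\<Sum>i<n. dist (x i) (y i)) + (\<Sum>i<n. dist (y i) (x (\<rho> i)))"
proof -
  obtain cs where cs: "distinct cs" "set cs = {..<n}" "\<rho> = cycle_of_list cs"
    using assms by (auto simp: full_cycle_def)
  have len: "length cs = n" using cs(1,2) distinct_card by fastforce
  define \<sigma> where "\<sigma> k = (if k < n then cs ! k else k)" for k
  have "bij_betw ((!) cs) {..<n} {..<n}"
    using bij_betw_nth[OF cs(1)] len cs(2) by simp
  then have "bij_betw \<sigma> {..<n} {..<n}"
    by (rule bij_betw_cong[THEN iffD1, rotated]) (simp add: \<sigma>_def)
  then have \<sigma>: "\<sigma> permutes {..<n}"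
    by (rule bij_imp_permutes) (simp add: \<sigma>_def)
  have "map \<sigma> [0..<n] = cs"
    using len by (intro nth_equalityI) (auto simp: \<sigma>_def)
  then show ?thesis
    using stacker_crane_opt_le[OF \<sigma>, of x y] cs(3) by (simp add: sc_tour_length_eq_cycle[OF \<sigma>])
qed

lemma stacker_crane_opt_le_cycle_distance:
  fixes x y :: "nat \<Rightarrow> 'a::metric_space"
  assumes D: "\<And>i j. dist (y i) (x j) \<le> D"
  shows "stacker_crane_opt x y n \<le>
    (\<Sum>i<n. dist (x i) (y i)) + (\<Sum>i<n. dist (y i) (x (\<tau> i))) + D * cycle_distance {..<n} \<tau>"
proof -
  obtain \<rho> where \<rho>: "full_cycle {..<n} \<rho>" "card {i \<in> {..<n}. \<rho> i \<noteq> \<tau> i} = cycle_distance {..<n} \<tau>"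
    by (rule cycle_distance_attained[OF finite_lessThan])
  have "(\<Sum>i<n. dist (y i) (x (\<rho> i))) \<le> (\<Sum>i<n. dist (y i) (x (\<tau> i)) + (if \<rho> i \<noteq> \<tau> i then D else 0))"
    using D by (intro sum_mono) (auto intro: add_increasing)
  also have "\<dots> = (\<Sum>i<n. dist (y i) (x (\<tau> i))) + D * card {i \<in> {..<n}. \<rho> i \<noteq> \<tau> i}"
    by (simp add: sum.distrib sum.If_cases Int_def)
  finally show ?thesis
    using stacker_crane_opt_le_full_cycle[OF \<rho>(1), of x y] \<rho>(2) by simp
qed

definition empty_travel :: "(nat \<Rightarrow> 'a::metric_space) \<Rightarrow> (nat \<Rightarrow> 'a) \<Rightarrow> nat \<Rightarrow> real" where
  "empty_travel x y n = stacker_crane_opt x y n - (\<Sum>i<n. dist (x i) (y i))"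

lemma sum_empty_travel_permuted_le:
  fixes x y :: "nat \<Rightarrow> 'a::metric_space"
  assumes D: "\<And>i j. dist (y i) (x j) \<le> D" and n: "n \<ge> 1"
  shows "(\<Sum>\<tau> | \<tau> permutes {..<n}. empty_travel x (\<lambda>i. y (\<tau> i)) n)
    \<le> fact n * (matching_cost y x n + 2 * D * harm n)"
proof -
  have "0 \<le> D" using D[of 0 0] zero_le_dist order_trans by blast
  obtain \<sigma> where \<sigma>: "\<sigma> permutes {..<n}" "matching_cost y x n = (\<Sum>i<n. dist (y i) (x (\<sigma> i)))"
    by (rule matching_cost_attained)
  let ?d = "\<lambda>\<tau>. real (cycle_distance {..<n} \<tau>)"
  have "empty_travel x (\<lambda>i. y (\<tau> i)) n \<le> matching_cost y x n + D * ?d (\<sigma> \<circ> \<tau>)"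
    if "\<tau> permutes {..<n}" for \<tau>
    using stacker_crane_opt_le_cycle_distance[of "\<lambda>i. y (\<tau> i)" x D n "\<sigma> \<circ> \<tau>"] D
      sum_permutes[OF that, of "\<lambda>i. dist (y i) (x (\<sigma> i))"] by (simp add: empty_travel_def \<sigma>(2))
  then have "(\<Sum>\<tau> | \<tau> permutes {..<n}. empty_travel x (\<lambda>i. y (\<tau> i)) n)
      \<le> (\<Sum>\<tau> | \<tau> permutes {..<n}. matching_cost y x n + D * ?d (\<sigma> \<circ> \<tau>))"
    by (intro sum_mono) simp
  also have "\<dots> = fact n * matching_cost y x n + D * (\<Sum>\<tau> | \<tau> permutes {..<n}. ?d (\<sigma> \<circ> \<tau>))"
    by (simp add: sum.distrib card_permutations sum_distrib_left)
  also have "(\<Sum>\<tau> | \<tau> permutes {..<n}. ?d (\<sigma> \<circ> \<tau>)) = (\<Sum>\<tau> | \<tau> permutes {..<n}. ?d \<tau>)"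
    using setum_permutations_compose_left[OF \<sigma>(1), of ?d] by simp
  also have "fact n * matching_cost y x n + D * \<dots> \<le> fact n * matching_cost y x n + D * (2 * fact n * harm n)"
    using sum_cycle_distance_le[of "{..<n}"] n \<open>0 \<le> D\<close>
    by (intro add_left_mono mult_left_mono) (auto simp: lessThan_empty_iff)
  finally show ?thesis by (simp add: algebra_simps)
qed

section \<open>Kantorovich duality for matchings\<close>

fun path_weight :: "('i \<Rightarrow> 'i \<Rightarrow> real) \<Rightarrow> 'i list \<Rightarrow> real" where
  "path_weight w (a # b # r) = w a b + path_weight w (b # r)"
| "path_weight w _ = 0"

lemma path_weight_append:
  "path_weight w (as @ k # bs) = path_weight w (as @ [k]) + path_weight w (k # bs)"
proof (induction as)
  case (Cons a as) then show ?case by (cases as) auto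
qed simp

lemma path_weight_snoc: "ls \<noteq> [] \<Longrightarrow> path_weight w (ls @ [k]) = path_weight w ls + w (last ls) k"
  by (induction w ls rule: path_weight.induct) auto

lemma sum_cycle_of_list:
  assumes "distinct ls" "ls \<noteq> []"
  shows "(\<Sum>i\<in>set ls. w i (cycle_of_list ls i)) = path_weight w ls + w (last ls) (hd ls)"
proof -
  have map2_shift: "sum_list (map2 w (k # bs) (bs @ [l])) = path_weight w (k # bs @ [l])" for k l bs
    by (induction bs arbitrary: k) auto
  have "(\<Sum>i\<in>set ls. w i (cycle_of_list ls i)) = sum_list (map2 w ls (map (cycle_of_list ls) ls))"
    using assms(1) by (simp add: sum.distinct_set_conv_list zip_map2 zip_same_conv_map comp_def)
  also have "\<dots> = path_weight w (ls @ [hd ls])"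
    unfolding map_cycle_of_list[OF assms(1)] using assms(2) map2_shift by (cases ls) simp_all
  finally show ?thesis using path_weight_snoc[OF assms(2)] by simp
qed

definition simple_paths :: "'i set \<Rightarrow> 'i \<Rightarrow> 'i list set" where
  "simple_paths S j = {ls. distinct ls \<and> set ls \<subseteq> S \<and> ls \<noteq> [] \<and> last ls = j}"

lemma finite_simple_paths: "finite S \<Longrightarrow> finite (simple_paths S j)"
  by (rule finite_subset[OF _ finite_subset_distinct[of S]]) (auto simp: simple_paths_def)

text \<open>If \<open>k\<close> already lies on the path, then the segment from \<open>k\<close> on is cut off; closed up, it is a cycle.\<close>
lemma simple_path_extend:
  assumes cyc: "\<And>\<sigma>. \<sigma> permutes S \<Longrightarrow> 0 \<le> (\<Sum>i\<in>S. w i (\<sigma> i))" and diag: "\<And>i. w i i = 0"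
    and S: "finite S" and ls: "ls \<in> simple_paths S j" and k: "k \<in> S"
  obtains ls' where "ls' \<in> simple_paths S k" "path_weight w ls' \<le> path_weight w ls + w j k"
proof (cases "k \<in> set ls")
  case False
  then have "ls @ [k] \<in> simple_paths S k" using ls k by (auto simp: simple_paths_def)
  moreover have "path_weight w (ls @ [k]) = path_weight w ls + w j k"
    using ls path_weight_snoc by (auto simp: simple_paths_def)
  ultimately show ?thesis using that by simp
next
  case True
  then obtain as bs where ab: "ls = as @ k # bs" by (auto simp: in_set_conv_decomp)
  define \<sigma> where "\<sigma> = cycle_of_list (k # bs)"
  have segment: "distinct (k # bs)" "set (k # bs) \<subseteq> S" "last (k # bs) = j"
    using ls by (auto simp: simple_paths_def ab)
  have \<sigma>: "\<sigma> permutes set (k # bs)" unfolding \<sigma>_def by (rule cycle_permutes)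
  have "0 \<le> (\<Sum>i\<in>S. w i (\<sigma> i))" by (rule cyc[OF permutes_subset[OF \<sigma> segment(2)]])
  also have "\<dots> = (\<Sum>i\<in>set (k # bs). w i (\<sigma> i))"
    using S segment(2) \<sigma> diag by (intro sum.mono_neutral_right) (auto simp: permutes_def)
  also have "\<dots> = path_weight w (k # bs) + w j k"
    using sum_cycle_of_list[OF segment(1), of w] segment(3) by (simp add: \<sigma>_def)
  finally have "path_weight w (as @ [k]) \<le> path_weight w ls + w j k"
    using path_weight_append[of w as k bs] ab by simp
  moreover have "as @ [k] \<in> simple_paths S k" using ls by (auto simp: simple_paths_def ab)
  ultimately show ?thesis using that by blast
qed

lemma ex_potential:
  fixes w :: "'i \<Rightarrow> 'i \<Rightarrow> real"
  assumes S: "finite S"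
    and cyc: "\<And>\<sigma>. \<sigma> permutes S \<Longrightarrow> 0 \<le> (\<Sum>i\<in>S. w i (\<sigma> i))" and diag: "\<And>i. w i i = 0"
  obtains p where "\<And>j k. j \<in> S \<Longrightarrow> k \<in> S \<Longrightarrow> p k \<le> p j + w j k"
proof
  define p where "p j = Min (path_weight w ` simple_paths S j)" for j
  fix j k assume j: "j \<in> S" and k: "k \<in> S"
  have "[j] \<in> simple_paths S j" using j by (simp add: simple_paths_def)
  then have "p j \<in> path_weight w ` simple_paths S j"
    unfolding p_def using finite_simple_paths[OF S] by (intro Min_in) auto
  then obtain ls where ls: "ls \<in> simple_paths S j" "p j = path_weight w ls" by auto
  obtain ls' where ls': "ls' \<in> simple_paths S k" "path_weight w ls' \<le> path_weight w ls + w j k"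
    using simple_path_extend[where w = w, OF cyc diag S ls(1) k] by blast
  have "p k \<le> path_weight w ls'"
    unfolding p_def using finite_simple_paths[OF S] ls'(1) by (intro Min_le) auto
  then show "p k \<le> p j + w j k" using ls' ls by simp
qed

lemma lipschitz_on_Min:
  fixes f :: "'j \<Rightarrow> 'a::metric_space \<Rightarrow> real"
  assumes J: "finite J" "J \<noteq> {}" and f: "\<And>j. j \<in> J \<Longrightarrow> C-lipschitz_on U (f j)"
  shows "C-lipschitz_on U (\<lambda>a. Min ((\<lambda>j. f j a) ` J))"
proof (rule lipschitz_onI)
  have fin: "finite ((\<lambda>j. f j a) ` J)" "(\<lambda>j. f j a) ` J \<noteq> {}" for a using J by auto
  have Min_le_add: "Min ((\<lambda>j. f j a) ` J) \<le> Min ((\<lambda>j. f j b) ` J) + C * dist a b" if "a \<in> U" "b \<in> U" for a b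
  proof -
    obtain j where j: "j \<in> J" "Min ((\<lambda>j. f j b) ` J) = f j b"
      using Min_in[OF fin[of b]] by auto
    have "Min ((\<lambda>j. f j a) ` J) \<le> f j a" using j(1) by (intro Min_le fin) auto
    then show ?thesis using j lipschitz_onD[OF f[OF j(1)] that] by (simp add: dist_real_def)
  qed
  show "dist (Min ((\<lambda>j. f j a) ` J)) (Min ((\<lambda>j. f j b) ` J)) \<le> C * dist a b"
    if "a \<in> U" "b \<in> U" for a b
    using Min_le_add[OF that] Min_le_add[OF that(2,1)] by (simp add: dist_real_def abs_le_iff dist_commute)
  show "0 \<le> C" using J f lipschitz_on_nonneg by blast
qed

lemma matching_cost_dual:
  fixes u v :: "nat \<Rightarrow> 'a::metric_space"
  obtains f where "1-lipschitz_on UNIV f" "matching_cost u v n \<le> (\<Sum>i<n. f (u i) - f (v i))"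
proof (cases "n = 0")
  case True
  moreover have "1-lipschitz_on UNIV (\<lambda>_::'a. 0::real)" by (rule lipschitz_onI) auto
  ultimately show ?thesis using that matching_cost_le[OF permutes_id, of u v n] by simp
next
  case False
  obtain \<sigma> where \<sigma>: "\<sigma> permutes {..<n}" "matching_cost u v n = (\<Sum>i<n. dist (u i) (v (\<sigma> i)))"
    by (rule matching_cost_attained)
  define v' where "v' i = v (\<sigma> i)" for i
  define w where "w i j = dist (u i) (v' j) - dist (u i) (v' i)" for i j
  have "0 \<le> (\<Sum>i<n. w i (\<tau> i))" if "\<tau> permutes {..<n}" for \<tau>
    using matching_cost_le[OF permutes_compose[OF that \<sigma>(1)], of u v]
    by (simp add: w_def v'_def \<sigma>(2) sum_subtractf)
  then obtain p where p: "\<And>j k. j < n \<Longrightarrow> k < n \<Longrightarrow> p k \<le> p j + w j k"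
    using ex_potential[of "{..<n}" w] by (auto simp: w_def)
  define f where "f a = Min ((\<lambda>j. dist a (v' j) - p j) ` {..<n})" for a
  have "\<bar>dist a x - dist b x\<bar> \<le> dist a b" for a b x :: 'a
    by (metis abs_dist_diff_le dist_commute)
  then have "1-lipschitz_on UNIV (\<lambda>a. dist a (v' j) - p j)" for j
    by (intro lipschitz_onI) (auto simp: dist_real_def)
  then have "1-lipschitz_on UNIV f"
    unfolding f_def using False by (intro lipschitz_on_Min) (auto simp: lessThan_empty_iff)
  moreover have "dist (u i) (v' i) \<le> f (u i) - f (v' i)" if i: "i < n" for i
  proof -
    have "f (v' i) \<le> dist (v' i) (v' i) - p i" unfolding f_def
      using i by (intro Min_le) (auto intro!: image_eqI[of _ _ i])
    moreover have "dist (u i) (v' i) - p i \<le> dist (u i) (v' j) - p j" if "j < n" for j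
      using p[OF i that] by (simp add: w_def)
    then have "dist (u i) (v' i) - p i \<le> f (u i)"
      unfolding f_def using i by (intro Min.boundedI) auto
    ultimately show ?thesis by simp
  qed
  then have "matching_cost u v n \<le> (\<Sum>i<n. f (u i) - f (v' i))"
    unfolding \<sigma>(2) v'_def by (intro sum_mono) auto
  then have "matching_cost u v n \<le> (\<Sum>i<n. f (u i) - f (v i))"
    using sum_permutes[OF \<sigma>(1), of "\<lambda>i. f (v i)"] by (simp add: sum_subtractf v'_def)
  ultimately show ?thesis using that by blast
qed

section \<open>Dependence of the optimal costs on the points\<close>

lemma sum_dist_permutes_le:
  fixes u v u' v' :: "nat \<Rightarrow> 'a::metric_space"
  assumes "\<rho> permutes {..<n}"
  shows "(\<Sum>i<n. dist (u i) (v (\<rho> i))) \<le>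
    (\<Sum>i<n. dist (u' i) (v' (\<rho> i))) + ((\<Sum>i<n. dist (u i) (u' i)) + (\<Sum>i<n. dist (v i) (v' i)))"
proof -
  have "dist a b \<le> dist a' b' + dist a a' + dist b b'" for a b a' b' :: 'a
    using dist_triangle[of a b a'] dist_triangle[of a' b b'] by (simp add: dist_commute)
  then have "(\<Sum>i<n. dist (u i) (v (\<rho> i))) \<le>
      (\<Sum>i<n. dist (u' i) (v' (\<rho> i)) + dist (u i) (u' i) + dist (v (\<rho> i)) (v' (\<rho> i)))"
    by (intro sum_mono)
  then show ?thesis
    using sum_permutes[OF assms, of "\<lambda>i. dist (v i) (v' i)"] by (simp add: sum.distrib)
qed

lemma matching_cost_le_add:
  "matching_cost u v n \<le>
    matching_cost u' v' n + ((\<Sum>i<n. dist (u i) (u' i)) + (\<Sum>i<n. dist (v i) (v' i)))"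
  unfolding matching_cost_def by (intro Min_permutes_le_add sum_dist_permutes_le finite_lessThan)

lemma stacker_crane_opt_le_add:
  "stacker_crane_opt x y n \<le>
    stacker_crane_opt x' y' n + 2 * ((\<Sum>i<n. dist (x i) (x' i)) + (\<Sum>i<n. dist (y i) (y' i)))"
  unfolding stacker_crane_opt_def
proof (rule Min_permutes_le_add[OF finite_lessThan])
  fix \<sigma> assume \<sigma>: "\<sigma> permutes {..<n}"
  define \<rho> where "\<rho> = cycle_of_list (map \<sigma> [0..<n])"
  have "set (map \<sigma> [0..<n]) = {..<n}" using permutes_image[OF \<sigma>] by (simp add: atLeast0LessThan)
  then have "\<rho> permutes {..<n}" unfolding \<rho>_def by (metis cycle_permutes)
  from sum_dist_permutes_le[OF this, where u = y and v = x and u' = y' and v' = x']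
    sum_dist_permutes_le[OF permutes_id, where n = n and u = x and v = y and u' = x' and v' = y']
  show "sc_tour_length x y n \<sigma> \<le>
      sc_tour_length x' y' n \<sigma> + 2 * ((\<Sum>i<n. dist (x i) (x' i)) + (\<Sum>i<n. dist (y i) (y' i)))"
    by (simp add: sc_tour_length_eq_cycle[OF \<sigma>] flip: \<rho>_def)
qed

lemma borel_measurable_matching_cost [measurable (raw)]:
  fixes u v :: "'m \<Rightarrow> nat \<Rightarrow> 'a::{metric_space, second_countable_topology}"
  assumes "\<And>i. i < n \<Longrightarrow> (\<lambda>\<omega>. u \<omega> i) \<in> borel_measurable M" "\<And>i. i < n \<Longrightarrow> (\<lambda>\<omega>. v \<omega> i) \<in> borel_measurable M"
  shows "(\<lambda>\<omega>. matching_cost (u \<omega>) (v \<omega>) n) \<in> borel_measurable M"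
  unfolding matching_cost_def
proof (rule borel_measurable_Min_permutes)
  fix \<sigma> assume \<sigma>: "\<sigma> permutes {..<n}"
  have "\<sigma> i < n" if "i < n" for i using that permutes_in_image[OF \<sigma>] by auto
  then show "(\<lambda>\<omega>. \<Sum>i<n. dist (u \<omega> i) (v \<omega> (\<sigma> i))) \<in> borel_measurable M"
    using assms by (intro borel_measurable_sum borel_measurable_dist) auto
qed simp

lemma borel_measurable_stacker_crane_opt [measurable (raw)]:
  fixes x y :: "'m \<Rightarrow> nat \<Rightarrow> 'a::{metric_space, second_countable_topology}"
  assumes "\<And>i. i < n \<Longrightarrow> (\<lambda>\<omega>. x \<omega> i) \<in> borel_measurable M" "\<And>i. i < n \<Longrightarrow> (\<lambda>\<omega>. y \<omega> i) \<in> borel_measurable M"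
  shows "(\<lambda>\<omega>. stacker_crane_opt (x \<omega>) (y \<omega>) n) \<in> borel_measurable M"
  unfolding stacker_crane_opt_def
proof (rule borel_measurable_Min_permutes)
  fix \<sigma> assume \<sigma>: "\<sigma> permutes {..<n}"
  have "\<sigma> i < n" if "i < n" for i using that permutes_in_image[OF \<sigma>] by auto
  then show "(\<lambda>\<omega>. sc_tour_length (x \<omega>) (y \<omega>) n \<sigma>) \<in> borel_measurable M"
    unfolding sc_tour_length_def
    using assms by (intro borel_measurable_sum borel_measurable_add borel_measurable_dist) auto
qed simp

section \<open>McDiarmid's inequality\<close>

lemma (in prob_space) Hoeffdings_lemma_oscillation:
  fixes f :: "'a \<Rightarrow> real"
  assumes f: "f \<in> borel_measurable M" and l: "l > 0"
    and osc: "\<And>x y. x \<in> space M \<Longrightarrow> y \<in> space M \<Longrightarrow> \<bar>f x - f y\<bar> \<le> c"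
  shows "(\<integral>\<^sup>+x. ennreal (exp (l * (f x - expectation f))) \<partial>M) \<le> ennreal (exp (l\<^sup>2 * c\<^sup>2 / 8))"
proof -
  define a where "a = (INF x\<in>space M. f x)"
  obtain y where y: "y \<in> space M" using not_empty by blast
  have "f y - c \<le> f x" if "x \<in> space M" for x using osc[OF that y] by linarith
  then have "bdd_below (f ` space M)" by (intro bdd_belowI2[of _ "f y - c"])
  then have lower: "a \<le> f x" if "x \<in> space M" for x
    unfolding a_def using that by (rule cINF_lower)
  have "f x - c \<le> a" if "x \<in> space M" for x
    unfolding a_def using osc[OF that]
    by (intro cINF_greatest not_empty) (simp add: abs_le_iff diff_le_eq add.commute)
  then have "f x \<in> {a..a + c}" if "x \<in> space M" for x
    using lower[OF that] that by (auto simp: diff_le_eq)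
  then interpret interval_bounded_random_variable M f a "a + c"
    by unfold_locales (auto intro: f)
  show ?thesis using Hoeffdings_lemma_nn_integral[OF l] by simp
qed

definition bounded_differences ::
  "'i set \<Rightarrow> ('i \<Rightarrow> 'a set) \<Rightarrow> ('i \<Rightarrow> real) \<Rightarrow> (('i \<Rightarrow> 'a) \<Rightarrow> real) \<Rightarrow> bool" where
  "bounded_differences J S c f \<longleftrightarrow> (\<forall>z\<in>PiE J S. \<forall>j\<in>J. \<forall>a\<in>S j. \<bar>f (z(j := a)) - f z\<bar> \<le> c j)"

lemma bounded_differencesD:
  "bounded_differences J S c f \<Longrightarrow> z \<in> PiE J S \<Longrightarrow> j \<in> J \<Longrightarrow> a \<in> S j \<Longrightarrow> \<bar>f (z(j := a)) - f z\<bar> \<le> c j"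
  by (simp add: bounded_differences_def)

lemma bounded_differences_oscillation_le:
  assumes bd: "bounded_differences J S c f" and J: "finite J" and z: "z \<in> PiE J S" "z' \<in> PiE J S"
  shows "\<bar>f z' - f z\<bar> \<le> (\<Sum>j\<in>J. c j)"
proof -
  define y where "y I = (\<lambda>i. if i \<in> I then z' i else z i)" for I
  have "\<bar>f (y I) - f z\<bar> \<le> (\<Sum>j\<in>I. c j)" if "finite I" "I \<subseteq> J" for I
    using that
  proof (induction I rule: finite_induct)
    case empty
    then show ?case by (simp add: y_def)
  next
    case (insert i I)
    have "y I \<in> PiE J S" using z insert.prems by (auto simp: y_def PiE_iff extensional_def)
    then have "\<bar>f ((y I)(i := z' i)) - f (y I)\<bar> \<le> c i"
      using z(2) insert.prems by (intro bounded_differencesD[OF bd]) (auto simp: PiE_iff)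
    moreover have "(y I)(i := z' i) = y (insert i I)" by (auto simp: y_def)
    ultimately show ?case using insert by simp
  qed
  moreover have "y J = z'" using z by (auto simp: y_def PiE_iff extensional_def)
  ultimately show ?thesis using J by blast
qed

lemma (in prob_space) integrable_bounded:
  fixes f :: "'a \<Rightarrow> 'b::{banach, second_countable_topology}"
  assumes "f \<in> borel_measurable M" "\<And>x. x \<in> space M \<Longrightarrow> norm (f x) \<le> B"
  shows "integrable M f"
  using assms by (intro integrable_const_bound[of f B]) auto

lemma (in prob_space) norm_expectation_le:
  fixes f :: "'a \<Rightarrow> 'b::{banach, second_countable_topology}"
  assumes "f \<in> borel_measurable M" "\<And>x. x \<in> space M \<Longrightarrow> norm (f x) \<le> B"
  shows "norm (expectation f) \<le> B"
proof -
  have "norm (expectation f) \<le> expectation (\<lambda>x. norm (f x))" by (rule integral_norm_bound)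
  also have "\<dots> \<le> expectation (\<lambda>_. B)"
    using assms by (intro integral_mono integrable_norm integrable_bounded) auto
  finally show ?thesis by (simp add: prob_space)
qed

lemma integrable_bounded_differences:
  assumes K: "\<And>j. prob_space (K j)" and J: "finite J"
    and f: "f \<in> borel_measurable (PiM J K)" and bd: "bounded_differences J (\<lambda>j. space (K j)) c f"
  shows "integrable (PiM J K) f"
proof -
  interpret prob_space "PiM J K" by (rule prob_space_PiM[OF K])
  obtain z where z: "z \<in> space (PiM J K)" using not_empty by blast
  have "norm (f x) \<le> \<bar>f z\<bar> + (\<Sum>j\<in>J. c j)" if "x \<in> space (PiM J K)" for x
  proof -
    have "\<bar>f x - f z\<bar> \<le> (\<Sum>j\<in>J. c j)"
      using z that by (intro bounded_differences_oscillation_le[OF bd J]) (simp_all add: space_PiM)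
    then show ?thesis by simp
  qed
  then show ?thesis by (rule integrable_bounded[OF f])
qed

lemma bounded_differences_section_integral:
  assumes "prob_space (K i)" and i: "i \<notin> J"
    and f: "f \<in> borel_measurable (PiM (insert i J) K)"
    and bd: "bounded_differences (insert i J) (\<lambda>j. space (K j)) c f"
  shows "bounded_differences J (\<lambda>j. space (K j)) c (\<lambda>x. \<integral>y. f (x(i := y)) \<partial>K i)"
  unfolding bounded_differences_def
proof (intro ballI)
  interpret prob_space "K i" by fact
  have section_measurable: "(\<lambda>y. f (x(i := y))) \<in> borel_measurable (K i)"
    if "x \<in> PiE J (\<lambda>j. space (K j))" for x
    using that by (intro measurable_compose[OF measurable_component_update[OF _ i] f]) (simp add: space_PiM)
  have integrable_section: "integrable (K i) (\<lambda>y. f (x(i := y)))" if x: "x \<in> PiE J (\<lambda>j. space (K j))" for x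
  proof -
    obtain y0 where y0: "y0 \<in> space (K i)" using not_empty by blast
    have "norm (f (x(i := y))) \<le> \<bar>f (x(i := y0))\<bar> + c i" if "y \<in> space (K i)" for y
      using bounded_differencesD[OF bd PiE_fun_upd[where S = J, OF y0 x] insertI1 that] by simp
    then show ?thesis by (rule integrable_bounded[OF section_measurable[OF x]])
  qed
  fix z j a assume z: "z \<in> PiE J (\<lambda>j. space (K j))" and j: "j \<in> J" and a: "a \<in> space (K j)"
  have ij: "i \<noteq> j" using j i by auto
  have z': "z(j := a) \<in> PiE J (\<lambda>j. space (K j))"
    using z j a by (auto simp: PiE_iff extensional_def)
  have "(\<integral>y. f (z(j := a, i := y)) \<partial>K i) - (\<integral>y. f (z(i := y)) \<partial>K i) =
      (\<integral>y. f (z(j := a, i := y)) - f (z(i := y)) \<partial>K i)"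
    using integrable_section[OF z'] integrable_section[OF z]
    by (rule Bochner_Integration.integral_diff[symmetric])
  also have "\<bar>\<dots>\<bar> \<le> c j"
    using bounded_differencesD[OF bd PiE_fun_upd[where S = J, OF _ z], of _ j a] a j
      section_measurable[OF z] section_measurable[OF z']
    by (intro norm_expectation_le[where 'b = real, simplified]) (auto simp: fun_upd_twist[OF ij])
  finally show "\<bar>(\<integral>y. f (z(j := a, i := y)) \<partial>K i) - (\<integral>y. f (z(i := y)) \<partial>K i)\<bar> \<le> c j" .
qed

lemma nn_integral_exp_section_le:
  assumes "prob_space (K i)" and i: "i \<notin> J" and f: "f \<in> borel_measurable (PiM (insert i J) K)"
    and bd: "bounded_differences (insert i J) (\<lambda>j. space (K j)) c f" and l: "l > 0"
    and x: "x \<in> space (PiM J K)"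
  defines "g \<equiv> \<integral>y. f (x(i := y)) \<partial>K i"
  shows "(\<integral>\<^sup>+y. ennreal (exp (l * (f (x(i := y)) - m))) \<partial>K i)
    \<le> ennreal (exp (l * (g - m))) * ennreal (exp (l\<^sup>2 * (c i)\<^sup>2 / 8))"
proof -
  interpret prob_space "K i" by fact
  have f_section: "(\<lambda>y. f (x(i := y))) \<in> borel_measurable (K i)"
    by (rule measurable_compose[OF measurable_component_update[OF x i] f])
  have "x(i := b) \<in> PiE (insert i J) (\<lambda>j. space (K j))" if "b \<in> space (K i)" for b
    using x that by (intro PiE_fun_upd) (simp_all add: space_PiM)
  then have "\<bar>f (x(i := a)) - f (x(i := b))\<bar> \<le> c i" if "a \<in> space (K i)" "b \<in> space (K i)" for a b
    using bounded_differencesD[OF bd _ insertI1 that(1), of "x(i := b)"] that(2) by (simp only: fun_upd_upd)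
  then have "(\<integral>\<^sup>+y. ennreal (exp (l * (f (x(i := y)) - g))) \<partial>K i) \<le> ennreal (exp (l\<^sup>2 * (c i)\<^sup>2 / 8))"
    unfolding g_def by (rule Hoeffdings_lemma_oscillation[OF f_section l])
  moreover have "(\<integral>\<^sup>+y. ennreal (exp (l * (f (x(i := y)) - m))) \<partial>K i) =
      (\<integral>\<^sup>+y. ennreal (exp (l * (g - m))) * ennreal (exp (l * (f (x(i := y)) - g))) \<partial>K i)"
    by (simp add: algebra_simps flip: exp_add ennreal_mult)
  then have "(\<integral>\<^sup>+y. ennreal (exp (l * (f (x(i := y)) - m))) \<partial>K i) =
      ennreal (exp (l * (g - m))) * (\<integral>\<^sup>+y. ennreal (exp (l * (f (x(i := y)) - g))) \<partial>K i)"
    using f_section by (simp add: nn_integral_cmult)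
  ultimately show ?thesis by (simp add: mult_left_mono)
qed

lemma nn_integral_exp_bounded_differences_le:
  fixes f :: "('i \<Rightarrow> 'a) \<Rightarrow> real"
  assumes K: "\<And>j. prob_space (K j)" and "finite J"
    and "f \<in> borel_measurable (PiM J K)" and "bounded_differences J (\<lambda>j. space (K j)) c f"
    and l: "l > 0"
  shows "(\<integral>\<^sup>+z. ennreal (exp (l * (f z - integral\<^sup>L (PiM J K) f))) \<partial>PiM J K)
    \<le> ennreal (exp (l\<^sup>2 / 8 * (\<Sum>j\<in>J. (c j)\<^sup>2)))"
  using assms(2-4)
proof (induction J arbitrary: f rule: finite_induct)
  case empty
  then show ?case
    by (simp add: PiM_empty nn_integral_count_space_finite lebesgue_integral_count_space_finite)
next
  case (insert i J)
  interpret product_sigma_finite K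
    by (intro product_sigma_finite.intro prob_space_imp_sigma_finite K)
  interpret Ki: prob_space "K i" by (rule K)
  note f [measurable] = insert.prems(1)
  define g where "g x = (\<integral>y. f (x(i := y)) \<partial>K i)" for x
  have "(\<lambda>(x, y). f (x(i := y))) \<in> borel_measurable (PiM J K \<Otimes>\<^sub>M K i)"
    using measurable_comp[OF measurable_add_dim f] by (simp add: comp_def case_prod_beta)
  then have g: "g \<in> borel_measurable (PiM J K)" unfolding g_def by measurable
  have bd_g: "bounded_differences J (\<lambda>j. space (K j)) c g"
    unfolding g_def by (rule bounded_differences_section_integral[OF K insert.hyps(2) insert.prems])
  define m where "m = integral\<^sup>L (PiM J K) g"
  have integral_f: "integral\<^sup>L (PiM (insert i J) K) f = m"
    unfolding m_def g_def
    using integrable_bounded_differences[OF K _ insert.prems] insert.hyps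
    by (intro product_integral_insert) auto
  have "(\<integral>\<^sup>+z. ennreal (exp (l * (f z - m))) \<partial>PiM (insert i J) K) =
      (\<integral>\<^sup>+x. (\<integral>\<^sup>+y. ennreal (exp (l * (f (x(i := y)) - m))) \<partial>K i) \<partial>PiM J K)"
    using insert.hyps by (intro product_nn_integral_insert) measurable
  also have "\<dots> \<le> (\<integral>\<^sup>+x. ennreal (exp (l * (g x - m))) * ennreal (exp (l\<^sup>2 * (c i)\<^sup>2 / 8)) \<partial>PiM J K)"
    unfolding g_def by (intro nn_integral_mono nn_integral_exp_section_le[OF K insert.hyps(2) insert.prems l])
  also have "\<dots> = (\<integral>\<^sup>+x. ennreal (exp (l * (g x - m))) \<partial>PiM J K) * ennreal (exp (l\<^sup>2 * (c i)\<^sup>2 / 8))"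
    using g by (intro nn_integral_multc) simp
  also have "\<dots> \<le> ennreal (exp (l\<^sup>2 / 8 * (\<Sum>j\<in>J. (c j)\<^sup>2))) * ennreal (exp (l\<^sup>2 * (c i)\<^sup>2 / 8))"
    unfolding m_def by (intro mult_right_mono insert.IH g bd_g) simp
  also have "\<dots> = ennreal (exp (l\<^sup>2 / 8 * (\<Sum>j\<in>insert i J. (c j)\<^sup>2)))"
    using insert.hyps by (simp add: algebra_simps flip: exp_add ennreal_mult)
  finally show ?case by (simp add: integral_f)
qed

lemma (in prob_space) indep_vars_product_law:
  assumes indep: "indep_vars N Z J" and J: "J \<noteq> {}"
  obtains K where "\<And>j. prob_space (K j)" "\<And>j. j \<in> J \<Longrightarrow> space (K j) = space (N j)"
    "distr M (PiM J N) (\<lambda>\<omega>. \<lambda>j\<in>J. Z j \<omega>) = PiM J K"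
proof
  have rv: "random_variable (N j) (Z j)" if "j \<in> J" for j
    using indep that by (auto simp: indep_vars_def)
  define K where "K j = (if j \<in> J then distr M (N j) (Z j) else return (count_space UNIV) undefined)" for j
  show "prob_space (K j)" for j
    unfolding K_def using rv by (auto intro!: prob_space_distr prob_space_return)
  show "space (K j) = space (N j)" if "j \<in> J" for j using that by (simp add: K_def)
  show "distr M (PiM J N) (\<lambda>\<omega>. \<lambda>j\<in>J. Z j \<omega>) = PiM J K"
    using indep_vars_iff_distr_eq_PiM'[OF J rv] indep by (auto simp: K_def intro: PiM_cong)
qed

lemma (in prob_space) McDiarmid_ineq_ge:
  fixes f :: "('i \<Rightarrow> 'b) \<Rightarrow> real"
  assumes indep: "indep_vars N Z J" and J: "finite J"
    and f [measurable]: "f \<in> borel_measurable (PiM J N)"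
    and bd: "bounded_differences J (\<lambda>j. space (N j)) c f" and t: "t > 0"
  shows "prob {\<omega> \<in> space M. f (\<lambda>j\<in>J. Z j \<omega>) - expectation (\<lambda>\<omega>. f (\<lambda>j\<in>J. Z j \<omega>)) \<ge> t}
    \<le> exp (- 2 * t\<^sup>2 / (\<Sum>j\<in>J. (c j)\<^sup>2))"
proof (cases "(\<Sum>j\<in>J. (c j)\<^sup>2) = 0")
  case False
  define s where "s = (\<Sum>j\<in>J. (c j)\<^sup>2)"
  have s: "s > 0" using False sum_nonneg[of J "\<lambda>j. (c j)\<^sup>2"] by (simp add: s_def)
  have "J \<noteq> {}" using False by auto
  define z where "z \<omega> = (\<lambda>j\<in>J. Z j \<omega>)" for \<omega>
  have z [measurable]: "z \<in> measurable M (PiM J N)"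
    unfolding z_def using indep by (intro measurable_restrict) (auto simp: indep_vars_def)
  obtain K where K: "\<And>j. prob_space (K j)" "\<And>j. j \<in> J \<Longrightarrow> space (K j) = space (N j)"
    and law: "distr M (PiM J N) z = PiM J K"
    using indep_vars_product_law[OF indep \<open>J \<noteq> {}\<close>] unfolding z_def by blast
  have sets_K: "sets (PiM J K) = sets (PiM J N)"
    unfolding law[symmetric] by simp
  define m where "m = integral\<^sup>L (PiM J K) f"
  have expectation_f: "expectation (\<lambda>\<omega>. f (z \<omega>)) = m"
    unfolding m_def law[symmetric] by (rule integral_distr[symmetric]) simp_all
  define l where "l = 4 * t / s"
  have l: "l > 0" using t s by (simp add: l_def)
  have "emeasure M {\<omega> \<in> space M. f (z \<omega>) - m \<ge> t}
      \<le> ennreal (exp (- l * t)) * (\<integral>\<^sup>+\<omega>. ennreal (exp (l * (f (z \<omega>) - m))) * indicator (space M) \<omega> \<partial>M)"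
    by (rule Chernoff_ineq_nn_integral_ge[OF l]) simp_all
  also have "(\<integral>\<^sup>+\<omega>. ennreal (exp (l * (f (z \<omega>) - m))) * indicator (space M) \<omega> \<partial>M)
      = (\<integral>\<^sup>+\<omega>. ennreal (exp (l * (f (z \<omega>) - m))) \<partial>M)"
    by (rule nn_integral_cong) simp
  also have "\<dots> = (\<integral>\<^sup>+z. ennreal (exp (l * (f z - m))) \<partial>PiM J K)"
    unfolding law[symmetric] by (rule nn_integral_distr[symmetric]) simp_all
  also have "\<dots> \<le> ennreal (exp (l\<^sup>2 / 8 * s))"
    unfolding m_def s_def using bd
    by (intro nn_integral_exp_bounded_differences_le K(1) J l)
      (auto simp: measurable_cong_sets[OF sets_K refl] K(2) bounded_differences_def cong: PiE_cong)
  also have "ennreal (exp (- l * t)) * \<dots> = ennreal (exp (- 2 * t\<^sup>2 / s))"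
    using s by (simp add: l_def power2_eq_square field_simps flip: exp_add ennreal_mult)
  finally have "prob {\<omega> \<in> space M. f (z \<omega>) - expectation (\<lambda>\<omega>. f (z \<omega>)) \<ge> t} \<le> exp (- 2 * t\<^sup>2 / s)"
    by (simp add: emeasure_eq_measure expectation_f mult_left_mono)
  then show ?thesis unfolding z_def s_def .
qed simp

lemma (in prob_space) McDiarmid_ineq_abs_ge:
  fixes f :: "('i \<Rightarrow> 'b) \<Rightarrow> real"
  assumes indep: "indep_vars N Z J" and J: "finite J"
    and f: "f \<in> borel_measurable (PiM J N)"
    and bd: "bounded_differences J (\<lambda>j. space (N j)) c f" and t: "t > 0"
  shows "prob {\<omega> \<in> space M. \<bar>f (\<lambda>j\<in>J. Z j \<omega>) - expectation (\<lambda>\<omega>. f (\<lambda>j\<in>J. Z j \<omega>))\<bar> \<ge> t}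
    \<le> 2 * exp (- 2 * t\<^sup>2 / (\<Sum>j\<in>J. (c j)\<^sup>2))"
proof -
  define F where "F = (\<lambda>\<omega>. f (\<lambda>j\<in>J. Z j \<omega>))"
  have [measurable]: "F \<in> borel_measurable M"
    unfolding F_def using indep
    by (intro measurable_compose[OF measurable_restrict f]) (auto simp: indep_vars_def)
  have "{\<omega> \<in> space M. \<bar>F \<omega> - expectation F\<bar> \<ge> t} =
      {\<omega> \<in> space M. F \<omega> - expectation F \<ge> t} \<union> {\<omega> \<in> space M. - F \<omega> - expectation (\<lambda>\<omega>. - F \<omega>) \<ge> t}"
    by auto
  then have "prob {\<omega> \<in> space M. \<bar>F \<omega> - expectation F\<bar> \<ge> t} \<le>
      prob {\<omega> \<in> space M. F \<omega> - expectation F \<ge> t}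
      + prob {\<omega> \<in> space M. - F \<omega> - expectation (\<lambda>\<omega>. - F \<omega>) \<ge> t}"
    by (simp only:) (rule measure_Un_le; measurable)
  also have "\<dots> \<le> exp (- 2 * t\<^sup>2 / (\<Sum>j\<in>J. (c j)\<^sup>2)) + exp (- 2 * t\<^sup>2 / (\<Sum>j\<in>J. (c j)\<^sup>2))"
    unfolding F_def using f bd
    by (intro add_mono McDiarmid_ineq_ge[OF indep J _ _ t, where c = c])
      (auto simp: bounded_differences_def abs_minus_commute)
  finally show ?thesis by (simp add: F_def)
qed

definition l1_lipschitz :: "real \<Rightarrow> 'i set \<Rightarrow> (('i \<Rightarrow> 'a::metric_space) \<Rightarrow> real) \<Rightarrow> bool" where
  "l1_lipschitz C J f \<longleftrightarrow> (\<forall>z z'. f z \<le> f z' + C * (\<Sum>j\<in>J. dist (z j) (z' j)))"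

lemma l1_lipschitzD:
  assumes "l1_lipschitz C J f"
  shows "\<bar>f z - f z'\<bar> \<le> C * (\<Sum>j\<in>J. dist (z j) (z' j))"
proof -
  have "f z \<le> f z' + C * (\<Sum>j\<in>J. dist (z j) (z' j))" "f z' \<le> f z + C * (\<Sum>j\<in>J. dist (z' j) (z j))"
    using assms unfolding l1_lipschitz_def by blast+
  then show ?thesis by (simp add: dist_commute abs_le_iff)
qed

lemma l1_lipschitz_cong:
  assumes "l1_lipschitz C J f" "\<And>j. j \<in> J \<Longrightarrow> z j = z' j"
  shows "f z = f z'"
  using l1_lipschitzD[OF assms(1), of z z'] assms(2) by simp

lemma borel_measurable_l1_lipschitz:
  assumes f: "l1_lipschitz C J f" "f \<in> borel_measurable (PiM J (\<lambda>_. borel))"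
    and Z: "\<And>j. j \<in> J \<Longrightarrow> Z j \<in> borel_measurable M"
  shows "(\<lambda>\<omega>. f (\<lambda>j. Z j \<omega>)) \<in> borel_measurable M"
proof -
  have "(\<lambda>\<omega>. f (\<lambda>j. Z j \<omega>)) = (\<lambda>\<omega>. f (\<lambda>j\<in>J. Z j \<omega>))"
    by (intro ext l1_lipschitz_cong[OF f(1)]) simp
  then show ?thesis using Z by (auto intro!: measurable_compose[OF measurable_restrict f(2)])
qed

lemma l1_lipschitz_bounded_differences:
  assumes f: "l1_lipschitz C J f" "C \<ge> 0" "finite J" and p: "\<And>a b. dist (p a) (p b) \<le> D"
  shows "bounded_differences J S (\<lambda>_. C * D) (\<lambda>z. f (\<lambda>j. p (z j)))"
  unfolding bounded_differences_def
proof (intro ballI)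
  fix z j a assume "j \<in> J"
  have "(\<Sum>k\<in>J. dist (p ((z(j := a)) k)) (p (z k))) = (\<Sum>k\<in>J. if k = j then dist (p a) (p (z j)) else 0)"
    by (intro sum.cong) auto
  also have "\<dots> \<le> D" using f(3) \<open>j \<in> J\<close> p by simp
  finally have "C * (\<Sum>k\<in>J. dist (p ((z(j := a)) k)) (p (z k))) \<le> C * D"
    using f(2) by (rule mult_left_mono)
  then show "\<bar>f (\<lambda>k. p ((z(j := a)) k)) - f (\<lambda>k. p (z k))\<bar> \<le> C * D"
    by (rule order_trans[OF l1_lipschitzD[OF f(1)]])
qed

text \<open>Mapping everything outside \<open>\<Omega>\<close> to one point of \<open>\<Omega>\<close> changes the variables on a null set only and
  makes the differences bounded everywhere.\<close>
lemma (in prob_space) McDiarmid_l1_lipschitz: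
  fixes Z :: "'i \<Rightarrow> 'a \<Rightarrow> 'b::metric_space"
  assumes indep: "indep_vars (\<lambda>_. borel) Z J" and J: "finite J"
    and \<Omega>: "\<Omega> \<in> sets borel" "\<And>a b. a \<in> \<Omega> \<Longrightarrow> b \<in> \<Omega> \<Longrightarrow> dist a b \<le> D"
    and Z: "\<And>j. j \<in> J \<Longrightarrow> AE \<omega> in M. Z j \<omega> \<in> \<Omega>"
    and f: "f \<in> borel_measurable (PiM J (\<lambda>_. borel))" "l1_lipschitz C J f" "C \<ge> 0" and t: "t > 0"
  shows "prob {\<omega> \<in> space M. \<bar>f (\<lambda>j. Z j \<omega>) - expectation (\<lambda>\<omega>. f (\<lambda>j. Z j \<omega>))\<bar> \<ge> t}
    \<le> 2 * exp (- 2 * t\<^sup>2 / (real (card J) * (C * D)\<^sup>2))"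
proof (cases "J = {}")
  case False
  then obtain j0 where "j0 \<in> J" by blast
  then have "\<Omega> \<noteq> {}" using Z by fastforce
  then obtain x0 where x0: "x0 \<in> \<Omega>" by blast
  define p where "p x = (if x \<in> \<Omega> then x else x0)" for x
  have p [measurable]: "p \<in> borel_measurable borel" unfolding p_def using \<Omega>(1) by measurable
  have rv: "random_variable borel (Z j)" if "j \<in> J" for j
    using indep that by (auto simp: indep_vars_def)
  define g where "g z = f (\<lambda>j. p (z j))" for z
  have g: "g \<in> borel_measurable (PiM J (\<lambda>_. borel))"
    unfolding g_def by (rule borel_measurable_l1_lipschitz[OF f(2,1)]) measurable
  have "bounded_differences J (\<lambda>_. UNIV) (\<lambda>_. C * D) g"
    unfolding g_def using x0 \<Omega>(2) by (intro l1_lipschitz_bounded_differences f J) (auto simp: p_def)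
  then have tail: "prob {\<omega> \<in> space M. \<bar>g (\<lambda>j\<in>J. Z j \<omega>) - expectation (\<lambda>\<omega>. g (\<lambda>j\<in>J. Z j \<omega>))\<bar> \<ge> t}
      \<le> 2 * exp (- 2 * t\<^sup>2 / (real (card J) * (C * D)\<^sup>2))"
    using McDiarmid_ineq_abs_ge[OF indep J g _ t, of "\<lambda>_. C * D"] by simp
  have [measurable]: "(\<lambda>\<omega>. f (\<lambda>j. Z j \<omega>)) \<in> borel_measurable M" "(\<lambda>\<omega>. g (\<lambda>j\<in>J. Z j \<omega>)) \<in> borel_measurable M"
    using borel_measurable_l1_lipschitz[OF f(2,1) rv] measurable_compose[OF measurable_restrict[OF rv] g]
    by auto
  have "AE \<omega> in M. \<forall>j\<in>J. Z j \<omega> \<in> \<Omega>" using Z by (intro AE_finite_allI J)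
  then have AE_eq: "AE \<omega> in M. g (\<lambda>j\<in>J. Z j \<omega>) = f (\<lambda>j. Z j \<omega>)"
    by eventually_elim (auto simp: g_def p_def intro!: l1_lipschitz_cong[OF f(2)])
  then have "expectation (\<lambda>\<omega>. g (\<lambda>j\<in>J. Z j \<omega>)) = expectation (\<lambda>\<omega>. f (\<lambda>j. Z j \<omega>))"
    by (intro integral_cong_AE) auto
  moreover have "prob {\<omega> \<in> space M. \<bar>f (\<lambda>j. Z j \<omega>) - m\<bar> \<ge> t} =
      prob {\<omega> \<in> space M. \<bar>g (\<lambda>j\<in>J. Z j \<omega>) - m\<bar> \<ge> t}" for m
    using AE_eq by (intro measure_eq_AE) auto
  ultimately show ?thesis using tail by simp
qed (simp add: prob_le_1 order_trans[OF prob_le_1])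

section \<open>Almost sure convergence\<close>

lemma (in prob_space) AE_tendsto_0_if_summable_prob:
  fixes X :: "nat \<Rightarrow> 'a \<Rightarrow> real"
  assumes X [measurable]: "\<And>n. random_variable borel (X n)"
    and summable: "\<And>\<epsilon>. \<epsilon> > 0 \<Longrightarrow> summable (\<lambda>n. prob {\<omega> \<in> space M. \<bar>X n \<omega>\<bar> \<ge> \<epsilon>})"
  shows "AE \<omega> in M. (\<lambda>n. X n \<omega>) \<longlonglongrightarrow> 0"
proof -
  have "AE \<omega> in M. \<forall>\<^sub>F n in sequentially. \<bar>X n \<omega>\<bar> < \<epsilon>" if "\<epsilon> > 0" for \<epsilon>
  proof -
    have "AE \<omega> in M. \<forall>\<^sub>F n in sequentially. \<omega> \<in> space M - {\<omega> \<in> space M. \<bar>X n \<omega>\<bar> \<ge> \<epsilon>}"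
      using summable[OF that] by (intro borel_cantelli_AE1) (auto simp: emeasure_eq_measure)
    then show ?thesis by eventually_elim (auto elim!: eventually_mono)
  qed
  then have "AE \<omega> in M. \<forall>k. \<forall>\<^sub>F n in sequentially. \<bar>X n \<omega>\<bar> < inverse (real (Suc k))"
    unfolding AE_all_countable by simp
  then show ?thesis
  proof eventually_elim
    case (elim \<omega>)
    show ?case
    proof (rule tendstoI)
      fix \<epsilon> :: real assume "\<epsilon> > 0"
      then obtain k where "inverse (real (Suc k)) < \<epsilon>" using reals_Archimedean by blast
      then show "\<forall>\<^sub>F n in sequentially. dist (X n \<omega>) 0 < \<epsilon>"
        using elim[rule_format, of k] by (auto elim!: eventually_mono)
    qed
  qed
qed

lemma summable_exp_minus_powr:
  fixes a s :: real
  assumes "a > 0" "s > 0"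
  shows "summable (\<lambda>n. exp (- a * real n powr s))"
proof (rule summable_comparison_test_bigo)
  show "summable (\<lambda>n. norm (inverse (real n ^ 2)))"
    using inverse_power_summable[of 2, where 'a = real] by simp
  show "(\<lambda>n. exp (- a * real n powr s)) \<in> O(\<lambda>n. inverse (real n ^ 2))"
    using assms by real_asymp
qed

lemma (in prob_space) AE_subgaussian_div_powr_tendsto_0:
  fixes F :: "nat \<Rightarrow> 'a \<Rightarrow> real"
  assumes F [measurable]: "\<And>n. random_variable borel (F n)" and \<kappa>: "\<kappa> > 0" and q: "q > 1 / 2"
    and tail: "\<And>n t. n \<ge> 1 \<Longrightarrow> t > 0 \<Longrightarrow>
      prob {\<omega> \<in> space M. \<bar>F n \<omega>\<bar> \<ge> t} \<le> 2 * exp (- t\<^sup>2 / (\<kappa> * real n))"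
  shows "AE \<omega> in M. (\<lambda>n. F n \<omega> / real n powr q) \<longlonglongrightarrow> 0"
proof (rule AE_tendsto_0_if_summable_prob)
  fix \<epsilon> :: real assume \<epsilon>: "\<epsilon> > 0"
  have bound: "prob {\<omega> \<in> space M. \<bar>F n \<omega> / real n powr q\<bar> \<ge> \<epsilon>}
      \<le> 2 * exp (- (\<epsilon>\<^sup>2 / \<kappa>) * real n powr (2 * q - 1))"
    if n: "n \<ge> 1" for n
  proof -
    have "prob {\<omega> \<in> space M. \<bar>F n \<omega> / real n powr q\<bar> \<ge> \<epsilon>} =
        prob {\<omega> \<in> space M. \<bar>F n \<omega>\<bar> \<ge> \<epsilon> * real n powr q}"
      using n by (simp add: pos_le_divide_eq)
    also have "\<dots> \<le> 2 * exp (- (\<epsilon> * real n powr q)\<^sup>2 / (\<kappa> * real n))"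
      using n \<epsilon> by (intro tail) auto
    also have "- (\<epsilon> * real n powr q)\<^sup>2 / (\<kappa> * real n) = - (\<epsilon>\<^sup>2 / \<kappa>) * (real n powr (2 * q) / real n powr 1)"
      using n by (simp add: power_mult_distrib powr_power mult.commute)
    finally show ?thesis by (simp add: powr_diff)
  qed
  show "summable (\<lambda>n. prob {\<omega> \<in> space M. \<bar>F n \<omega> / real n powr q\<bar> \<ge> \<epsilon>})"
  proof (rule summable_comparison_test'[where N = 1])
    show "summable (\<lambda>n. 2 * exp (- (\<epsilon>\<^sup>2 / \<kappa>) * real n powr (2 * q - 1)))"
      using \<epsilon> \<kappa> q by (intro summable_mult summable_exp_minus_powr) auto
    show "norm (prob {\<omega> \<in> space M. \<bar>F n \<omega> / real n powr q\<bar> \<ge> \<epsilon>})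
        \<le> 2 * exp (- (\<epsilon>\<^sup>2 / \<kappa>) * real n powr (2 * q - 1))" if "n \<ge> 1" for n
      using bound[OF that] by simp
  qed
qed measurable

section \<open>Moments and laws of independent variables\<close>

lemma (in prob_space) expectation_sqrt_le:
  fixes f :: "'a \<Rightarrow> real"
  assumes f: "integrable M f" and nonneg: "\<And>x. 0 \<le> f x"
  shows "integrable M (\<lambda>x. sqrt (f x))" and "expectation (\<lambda>x. sqrt (f x)) \<le> sqrt (expectation f)"
proof -
  have [measurable]: "f \<in> borel_measurable M" using f by simp
  show integrable_sqrt: "integrable M (\<lambda>x. sqrt (f x))"
  proof (rule square_integrable_imp_integrable)
    show "integrable M (\<lambda>x. (sqrt (f x))\<^sup>2)" using f by (simp add: nonneg)
  qed measurable
  have "(expectation (\<lambda>x. sqrt (f x)))\<^sup>2 \<le> expectation (\<lambda>x. (sqrt (f x))\<^sup>2)"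
    using variance_eq[OF integrable_sqrt] variance_positive[of "\<lambda>x. sqrt (f x)"] f nonneg by simp
  then show "expectation (\<lambda>x. sqrt (f x)) \<le> sqrt (expectation f)"
    using nonneg by (simp add: real_le_rsqrt)
qed

lemma (in prob_space) indep_vars_expectation_mult_cnj:
  fixes X :: "'i \<Rightarrow> 'a \<Rightarrow> complex"
  assumes indep: "indep_vars (\<lambda>_. borel) X J" and ij: "i \<in> J" "j \<in> J" "i \<noteq> j"
    and X: "integrable M (X i)" "integrable M (X j)"
  shows "expectation (\<lambda>\<omega>. X i \<omega> * cnj (X j \<omega>)) = expectation (X i) * cnj (expectation (X j))"
proof -
  have cnj: "cnj \<in> borel_measurable borel"
    by (intro borel_measurable_continuous_onI continuous_intros)
  define h where "h k = (if k = i then (\<lambda>x::complex. x) else cnj)" for k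
  have "indep_vars (\<lambda>_. borel) (\<lambda>k \<omega>. h k (X k \<omega>)) {i, j}"
    using ij cnj by (intro indep_vars_compose2[OF indep_vars_subset[OF indep]]) (auto simp: h_def)
  then have "expectation (\<lambda>\<omega>. \<Prod>k\<in>{i, j}. h k (X k \<omega>)) = (\<Prod>k\<in>{i, j}. expectation (\<lambda>\<omega>. h k (X k \<omega>)))"
    using ij X by (intro indep_vars_lebesgue_integral) (auto simp: h_def)
  then show ?thesis using ij by (simp add: h_def)
qed

lemma (in prob_space) expectation_norm_sum_square_le:
  fixes X :: "'i \<Rightarrow> 'a \<Rightarrow> complex"
  assumes indep: "indep_vars (\<lambda>_. borel) X J" and J: "finite J"
    and bound: "\<And>j \<omega>. j \<in> J \<Longrightarrow> \<omega> \<in> space M \<Longrightarrow> cmod (X j \<omega>) \<le> b"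
    and mean: "\<And>j. j \<in> J \<Longrightarrow> expectation (X j) = 0"
  shows "expectation (\<lambda>\<omega>. (cmod (\<Sum>j\<in>J. X j \<omega>))\<^sup>2) \<le> real (card J) * b\<^sup>2"
proof -
  have rv: "random_variable borel (X j)" if "j \<in> J" for j
    using indep that by (auto simp: indep_vars_def)
  have prod_bound: "cmod (X i \<omega> * cnj (X j \<omega>)) \<le> b\<^sup>2" if "i \<in> J" "j \<in> J" "\<omega> \<in> space M" for i j \<omega>
    unfolding power2_eq_square norm_mult complex_mod_cnj
    using bound[OF that(1,3)] bound[OF that(2,3)]
    by (intro mult_mono) (auto intro: order_trans[OF norm_ge_zero])
  have cnj [measurable]: "cnj \<in> borel_measurable borel"
    by (intro borel_measurable_continuous_onI continuous_intros)
  have rv_prod: "random_variable borel (\<lambda>\<omega>. X i \<omega> * cnj (X j \<omega>))" if "i \<in> J" "j \<in> J" for i j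
    using rv[OF that(1)] rv[OF that(2)] by measurable
  have integrable_prod: "integrable M (\<lambda>\<omega>. X i \<omega> * cnj (X j \<omega>))" if "i \<in> J" "j \<in> J" for i j
    using prod_bound[OF that] by (rule integrable_bounded[OF rv_prod[OF that]])
  have uncorrelated: "expectation (\<lambda>\<omega>. X i \<omega> * cnj (X j \<omega>)) = 0" if "i \<in> J" "j \<in> J" "i \<noteq> j" for i j
    using indep_vars_expectation_mult_cnj[OF indep that] integrable_bounded[OF rv bound] mean that by simp
  have "complex_of_real (expectation (\<lambda>\<omega>. (cmod (\<Sum>j\<in>J. X j \<omega>))\<^sup>2)) =
      expectation (\<lambda>\<omega>. \<Sum>i\<in>J. \<Sum>j\<in>J. X i \<omega> * cnj (X j \<omega>))"
    unfolding integral_complex_of_real[symmetric] complex_norm_square cnj_sum sum_product ..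
  also have "\<dots> = (\<Sum>i\<in>J. \<Sum>j\<in>J. expectation (\<lambda>\<omega>. X i \<omega> * cnj (X j \<omega>)))"
    using integrable_prod by simp
  also have "\<dots> = (\<Sum>i\<in>J. \<Sum>j\<in>J. if i = j then expectation (\<lambda>\<omega>. X i \<omega> * cnj (X i \<omega>)) else 0)"
    using uncorrelated by (intro sum.cong refl) auto
  also have "\<dots> = (\<Sum>i\<in>J. expectation (\<lambda>\<omega>. X i \<omega> * cnj (X i \<omega>)))"
    using J by simp
  finally have second_moment: "complex_of_real (expectation (\<lambda>\<omega>. (cmod (\<Sum>j\<in>J. X j \<omega>))\<^sup>2)) =
      (\<Sum>i\<in>J. expectation (\<lambda>\<omega>. X i \<omega> * cnj (X i \<omega>)))" .
  have "expectation (\<lambda>\<omega>. (cmod (\<Sum>j\<in>J. X j \<omega>))\<^sup>2) \<le>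
      cmod (complex_of_real (expectation (\<lambda>\<omega>. (cmod (\<Sum>j\<in>J. X j \<omega>))\<^sup>2)))"
    unfolding norm_of_real by (rule abs_ge_self)
  also have "\<dots> = cmod (\<Sum>i\<in>J. expectation (\<lambda>\<omega>. X i \<omega> * cnj (X i \<omega>)))"
    by (rule arg_cong[OF second_moment])
  also have "\<dots> \<le> (\<Sum>i\<in>J. b\<^sup>2)"
    using prod_bound by (intro sum_norm_le norm_expectation_le rv_prod)
  finally show ?thesis by simp
qed

lemma (in finite_measure) integrable_dist_compact:
  fixes X Y :: "'a \<Rightarrow> 'b::{metric_space, second_countable_topology}"
  assumes [measurable]: "X \<in> borel_measurable M" "Y \<in> borel_measurable M"
    and in_\<Omega>: "AE \<omega> in M. X \<omega> \<in> \<Omega>" "AE \<omega> in M. Y \<omega> \<in> \<Omega>" and \<Omega>: "compact \<Omega>"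
  shows "integrable M (\<lambda>\<omega>. dist (X \<omega>) (Y \<omega>))"
proof (rule integrable_const_bound)
  show "AE \<omega> in M. norm (dist (X \<omega>) (Y \<omega>)) \<le> diameter \<Omega>"
    using in_\<Omega> by eventually_elim (simp add: diameter_bounded_bound[OF compact_imp_bounded[OF \<Omega>]])
qed measurable

lemma integral_PiM_component:
  fixes f :: "'a \<Rightarrow> 'b::{banach, second_countable_topology}"
  assumes K: "\<And>j. j \<in> J \<Longrightarrow> prob_space (K j)" and j: "j \<in> J" and f: "integrable (K j) f"
  shows "integrable (PiM J K) (\<lambda>z. f (z j))" and "(\<integral>z. f (z j) \<partial>PiM J K) = (\<integral>x. f x \<partial>K j)"
proof -
  have component: "(\<lambda>z. z j) \<in> measurable (PiM J K) (K j)" using j by (rule measurable_component_singleton)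
  have law: "distr (PiM J K) (K j) (\<lambda>z. z j) = K j" by (rule distr_PiM_component[OF K j])
  show "integrable (PiM J K) (\<lambda>z. f (z j))"
    by (rule integrable_distr[OF component]) (simp add: law f)
  show "(\<integral>z. f (z j) \<partial>PiM J K) = (\<integral>x. f x \<partial>K j)"
    using integral_distr[OF component, of f] f by (simp add: law)
qed

lemma (in prob_space) indep_vars_reindex:
  assumes indep: "indep_vars N X I" and h: "inj_on h J" "h ` J \<subseteq> I" and J: "J \<noteq> {}"
  shows "indep_vars (\<lambda>j. N (h j)) (\<lambda>j. X (h j)) J"
proof -
  have rv: "random_variable (N i) (X i)" if "i \<in> I" for i
    using indep that by (auto simp: indep_vars_def)
  have I: "I \<noteq> {}" using h J by auto
  have law: "distr M (PiM I N) (\<lambda>\<omega>. \<lambda>i\<in>I. X i \<omega>) = PiM I (\<lambda>i. distr M (N i) (X i))"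
    using indep indep_vars_iff_distr_eq_PiM'[OF I rv] by simp
  have "PiM J (\<lambda>j. distr M (N (h j)) (X (h j))) =
      distr (PiM I (\<lambda>i. distr M (N i) (X i))) (PiM J (\<lambda>j. distr M (N (h j)) (X (h j)))) (\<lambda>z. \<lambda>j\<in>J. z (h j))"
    using h rv by (intro distr_PiM_reindex[symmetric] prob_space_distr) auto
  also have "\<dots> = distr (distr M (PiM I N) (\<lambda>\<omega>. \<lambda>i\<in>I. X i \<omega>)) (PiM J (\<lambda>j. N (h j))) (\<lambda>z. \<lambda>j\<in>J. z (h j))"
    unfolding law by (rule distr_cong) (auto intro!: sets_PiM_cong)
  also have "\<dots> = distr M (PiM J (\<lambda>j. N (h j))) (\<lambda>\<omega>. \<lambda>j\<in>J. X (h j) \<omega>)"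
    using h rv by (subst distr_distr)
      (auto intro!: measurable_restrict measurable_component_singleton distr_cong
        simp: fun_eq_iff image_subset_iff)
  finally show ?thesis
    using indep_vars_iff_distr_eq_PiM'[OF J, where M' = "\<lambda>j. N (h j)" and X = "\<lambda>j. X (h j)"] rv h by auto
qed

lemma indep_vars_PiM_compose:
  fixes g :: "'i \<Rightarrow> 'b \<Rightarrow> 'a::topological_space"
  assumes \<gamma>: "prob_space \<gamma>" and g: "\<And>j. g j \<in> borel_measurable \<gamma>"
  shows "prob_space.indep_vars (PiM UNIV (\<lambda>_::'i. \<gamma>)) (\<lambda>_. borel) (\<lambda>j z. g j (z j)) UNIV"
    and "distr (PiM UNIV (\<lambda>_::'i. \<gamma>)) borel (\<lambda>z. g j (z j)) = distr \<gamma> borel (g j)"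
proof -
  let ?P = "PiM UNIV (\<lambda>_::'i. \<gamma>)"
  interpret P: prob_space ?P by (rule prob_space_PiM[OF \<gamma>])
  have component: "distr ?P \<gamma> (\<lambda>z. z i) = \<gamma>" for i by (rule distr_PiM_component[OF \<gamma>]) simp
  have measurable_component: "(\<lambda>z. z i) \<in> measurable ?P \<gamma>" for i by (rule measurable_component_singleton) simp
  have "P.indep_vars (\<lambda>_. \<gamma>) (\<lambda>j z. z j) UNIV"
    by (subst P.indep_vars_iff_distr_eq_PiM) (auto simp: component measurable_component restrict_UNIV distr_id2)
  then show "P.indep_vars (\<lambda>_. borel) (\<lambda>j z. g j (z j)) UNIV"
    by (rule P.indep_vars_compose2) (rule g)
  have "distr \<gamma> borel (g j) = distr (distr ?P \<gamma> (\<lambda>z. z j)) borel (g j)" by (simp add: component)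
  also have "\<dots> = distr ?P borel (\<lambda>z. g j (z j))" by (subst distr_distr[OF g measurable_component]) (simp add: comp_def)
  finally show "distr ?P borel (\<lambda>z. g j (z j)) = distr \<gamma> borel (g j)" by simp
qed

section \<open>Fourier analysis on the discrete torus\<close>

lemma Cauchy_Schwarz_ineq_sum_weighted:
  fixes a b l :: "'i \<Rightarrow> real"
  assumes "\<And>i. i \<in> A \<Longrightarrow> l i > 0"
  shows "(\<Sum>i\<in>A. a i * b i)\<^sup>2 \<le> (\<Sum>i\<in>A. l i * (a i)\<^sup>2) * (\<Sum>i\<in>A. (b i)\<^sup>2 / l i)"
proof -
  have "(\<Sum>i\<in>A. a i * b i)\<^sup>2 = (\<Sum>i\<in>A. (sqrt (l i) * a i) * (b i / sqrt (l i)))\<^sup>2"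
    using assms by (intro arg_cong[where f = "\<lambda>x. x\<^sup>2"] sum.cong refl) force
  also have "\<dots> \<le> (\<Sum>i\<in>A. (sqrt (l i) * a i)\<^sup>2) * (\<Sum>i\<in>A. (b i / sqrt (l i))\<^sup>2)"
    by (rule Cauchy_Schwarz_ineq_sum)
  also have "\<dots> = (\<Sum>i\<in>A. l i * (a i)\<^sup>2) * (\<Sum>i\<in>A. (b i)\<^sup>2 / l i)"
    using assms by (intro arg_cong2[where f = "(*)"] sum.cong refl)
      (simp_all add: power_mult_distrib power_divide less_imp_le)
  finally show ?thesis .
qed

locale character_table =
  fixes R :: "'r set" and S :: "'x set" and E :: "'r \<Rightarrow> 'x \<Rightarrow> complex" and K :: real
  assumes finite_R: "finite R" and finite_S: "finite S" and K_pos: "K > 0"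
    and orthogonal: "\<And>x y. x \<in> S \<Longrightarrow> y \<in> S \<Longrightarrow>
      (\<Sum>r\<in>R. E r x * cnj (E r y)) = (if x = y then complex_of_real K else 0)"
begin

definition ft :: "('x \<Rightarrow> real) \<Rightarrow> 'r \<Rightarrow> complex" where
  "ft g r = (\<Sum>x\<in>S. complex_of_real (g x) * cnj (E r x))"

lemma ft_inversion:
  assumes y: "y \<in> S"
  shows "(\<Sum>r\<in>R. ft g r * E r y) = complex_of_real (K * g y)"
proof -
  have "(\<Sum>r\<in>R. ft g r * E r y) = (\<Sum>r\<in>R. \<Sum>x\<in>S. complex_of_real (g x) * (E r y * cnj (E r x)))"
    by (simp add: ft_def sum_distrib_right sum_distrib_left mult_ac)
  also have "\<dots> = (\<Sum>x\<in>S. complex_of_real (g x) * (\<Sum>r\<in>R. E r y * cnj (E r x)))"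
    by (subst sum.swap) (simp add: sum_distrib_left)
  also have "\<dots> = (\<Sum>x\<in>S. if y = x then complex_of_real (g y) * complex_of_real K else 0)"
    using y by (intro sum.cong refl) (auto simp: orthogonal)
  also have "\<dots> = complex_of_real (K * g y)" using y finite_S by (simp add: mult.commute)
  finally show ?thesis .
qed

lemma ft_parseval: "(\<Sum>r\<in>R. (cmod (ft g r))\<^sup>2) = K * (\<Sum>x\<in>S. (g x)\<^sup>2)"
proof -
  have "complex_of_real (\<Sum>r\<in>R. (cmod (ft g r))\<^sup>2) = (\<Sum>r\<in>R. ft g r * cnj (ft g r))"
    by (simp only: of_real_sum complex_norm_square)
  also have "\<dots> = (\<Sum>r\<in>R. \<Sum>x\<in>S. complex_of_real (g x) * (ft g r * E r x))"
  proof (intro sum.cong refl)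
    fix r
    have "cnj (ft g r) = (\<Sum>x\<in>S. complex_of_real (g x) * E r x)" by (simp add: ft_def)
    then show "ft g r * cnj (ft g r) = (\<Sum>x\<in>S. complex_of_real (g x) * (ft g r * E r x))"
      by (simp add: sum_distrib_left mult_ac)
  qed
  also have "\<dots> = (\<Sum>x\<in>S. complex_of_real (g x) * (\<Sum>r\<in>R. ft g r * E r x))"
    by (subst sum.swap) (simp add: sum_distrib_left)
  also have "\<dots> = (\<Sum>x\<in>S. complex_of_real (g x) * complex_of_real (K * g x))"
    by (intro sum.cong refl) (simp add: ft_inversion)
  also have "\<dots> = complex_of_real (K * (\<Sum>x\<in>S. (g x)\<^sup>2))"
    by (simp add: sum_distrib_left power2_eq_square mult_ac)
  finally show ?thesis using of_real_eq_iff by blast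
qed

lemma ft_shift_difference:
  assumes s: "bij_betw s S S" and ch: "\<And>x. x \<in> S \<Longrightarrow> E r (s x) = ch * E r x" "cmod ch = 1"
  shows "ft (\<lambda>x. g (s x) - g x) r = (ch - 1) * ft g r"
proof -
  have "ch * cnj (E r (s x)) = cnj (E r x)" if "x \<in> S" for x
    using ch(1)[OF that] ch(2) complex_norm_square[of ch] by (simp add: mult_ac)
  then have "(\<Sum>x\<in>S. complex_of_real (g (s x)) * cnj (E r x)) =
      (\<Sum>x\<in>S. ch * (complex_of_real (g (s x)) * cnj (E r (s x))))"
    by (intro sum.cong refl) (metis mult.left_commute)
  also have "\<dots> = ch * ft g r"
    unfolding ft_def sum_distrib_left[symmetric]
    using sum.reindex_bij_betw[OF s, of "\<lambda>x. complex_of_real (g x) * cnj (E r x)"] by simp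
  finally have "(\<Sum>x\<in>S. complex_of_real (g (s x)) * cnj (E r x)) = ch * ft g r" .
  then show ?thesis by (simp add: ft_def algebra_simps sum_subtractf)
qed

lemma ft_shift_energy:
  assumes s: "bij_betw s S S"
    and ch: "\<And>r x. r \<in> R \<Longrightarrow> x \<in> S \<Longrightarrow> E r (s x) = ch r * E r x" "\<And>r. r \<in> R \<Longrightarrow> cmod (ch r) = 1"
  shows "(\<Sum>r\<in>R. (cmod (ch r - 1))\<^sup>2 * (cmod (ft g r))\<^sup>2) = K * (\<Sum>x\<in>S. (g (s x) - g x)\<^sup>2)"
proof -
  have "(cmod (ch r - 1))\<^sup>2 * (cmod (ft g r))\<^sup>2 = (cmod (ft (\<lambda>x. g (s x) - g x) r))\<^sup>2" if r: "r \<in> R" for r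
    using ft_shift_difference[OF s ch(1)[OF r] ch(2)[OF r], of g]
    by (simp add: norm_mult power_mult_distrib)
  then show ?thesis using ft_parseval[of "\<lambda>x. g (s x) - g x"] by simp
qed

lemma discrepancy_eq_ft:
  assumes zw: "\<And>i. i < n \<Longrightarrow> z i \<in> S" "\<And>i. i < n \<Longrightarrow> w i \<in> S"
  shows "complex_of_real (K * (\<Sum>i<n. g (z i) - g (w i))) =
    (\<Sum>r\<in>R. ft g r * (\<Sum>i<n. E r (z i) - E r (w i)))"
proof -
  have "complex_of_real (K * (\<Sum>i<n. g (z i) - g (w i))) =
      (\<Sum>i<n. complex_of_real (K * g (z i)) - complex_of_real (K * g (w i)))"
    by (simp add: sum_distrib_left right_diff_distrib)
  also have "\<dots> = (\<Sum>i<n. (\<Sum>r\<in>R. ft g r * E r (z i)) - (\<Sum>r\<in>R. ft g r * E r (w i)))"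
    using zw by (intro sum.cong refl) (simp add: ft_inversion del: of_real_mult)
  also have "\<dots> = (\<Sum>i<n. \<Sum>r\<in>R. ft g r * (E r (z i) - E r (w i)))"
    by (simp add: sum_subtractf right_diff_distrib)
  also have "\<dots> = (\<Sum>r\<in>R. ft g r * (\<Sum>i<n. E r (z i) - E r (w i)))"
    unfolding sum_distrib_left by (rule sum.swap)
  finally show ?thesis .
qed

lemma discrepancy_le_dual_norm:
  assumes l: "\<And>r. r \<in> R - {r0} \<Longrightarrow> l r > 0" and r0: "\<And>x. x \<in> S \<Longrightarrow> E r0 x = 1"
    and zw: "\<And>i. i < n \<Longrightarrow> z i \<in> S" "\<And>i. i < n \<Longrightarrow> w i \<in> S"
  shows "(K * (\<Sum>i<n. g (z i) - g (w i)))\<^sup>2 \<le> (\<Sum>r\<in>R - {r0}. l r * (cmod (ft g r))\<^sup>2) *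
    (\<Sum>r\<in>R - {r0}. (cmod (\<Sum>i<n. E r (z i) - E r (w i)))\<^sup>2 / l r)"
proof -
  define T where "T r = (\<Sum>i<n. E r (z i) - E r (w i))" for r
  have "T r0 = 0" unfolding T_def using zw r0 by simp
  then have "(\<Sum>r\<in>R. ft g r * T r) = (\<Sum>r\<in>R - {r0}. ft g r * T r)"
    using finite_R by (intro sum.mono_neutral_right) auto
  moreover have "complex_of_real (K * (\<Sum>i<n. g (z i) - g (w i))) = (\<Sum>r\<in>R. ft g r * T r)"
    unfolding T_def by (intro discrepancy_eq_ft zw)
  ultimately have "\<bar>K * (\<Sum>i<n. g (z i) - g (w i))\<bar> \<le> (\<Sum>r\<in>R - {r0}. cmod (ft g r) * cmod (T r))"
    by (metis (no_types, lifting) norm_of_real norm_mult sum.cong sum_norm_le order_refl)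
  then have "(K * (\<Sum>i<n. g (z i) - g (w i)))\<^sup>2 \<le> (\<Sum>r\<in>R - {r0}. cmod (ft g r) * cmod (T r))\<^sup>2"
    by (rule abs_le_square_iff[THEN iffD1, OF order_trans[OF _ abs_ge_self]])
  also have "\<dots> \<le> (\<Sum>r\<in>R - {r0}. l r * (cmod (ft g r))\<^sup>2) * (\<Sum>r\<in>R - {r0}. (cmod (T r))\<^sup>2 / l r)"
    by (rule Cauchy_Schwarz_ineq_sum_weighted[OF l])
  finally show ?thesis unfolding T_def .
qed

end

definition torus :: "nat \<Rightarrow> (nat \<times> nat) set" where
  "torus N = {..<N} \<times> {..<N}"

definition unity :: "nat \<Rightarrow> nat \<Rightarrow> complex" where
  "unity N a = cis (2 * pi * real a / real N)"

definition torus_char :: "nat \<Rightarrow> nat \<times> nat \<Rightarrow> nat \<times> nat \<Rightarrow> complex" where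
  "torus_char N r x = unity N (fst r * fst x) * unity N (snd r * snd x)"

lemma finite_torus: "finite (torus N)"
  by (simp add: torus_def)

lemma norm_unity [simp]: "cmod (unity N a) = 1"
  by (simp add: unity_def)

lemma unity_0 [simp]: "unity N 0 = 1"
  by (simp add: unity_def)

lemma unity_add: "unity N (a + b) = unity N a * unity N b"
  by (simp add: unity_def cis_mult distrib_left add_divide_distrib)

lemma unity_mult: "unity N (p * a) = unity N a ^ p"
  by (induction p) (simp_all add: unity_add)

lemma unity_power_self [simp]: "unity N a ^ N = 1"
proof (cases "N = 0")
  case False
  then show ?thesis unfolding unity_def Complex.DeMoivre using cis_multiple_2pi[of "real a"] by simp
qed simp

lemma unity_mod: "unity N (a mod N) = unity N a"
proof -
  have "unity N a = unity N (a mod N) * unity N (N * (a div N))"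
    unfolding unity_add[symmetric] by simp
  then show ?thesis by (simp only: unity_mult unity_power_self mult_1_right)
qed

lemma norm_torus_char [simp]: "cmod (torus_char N r x) = 1"
  by (simp add: torus_char_def norm_mult)

lemma unity_orthogonal:
  assumes "a < N" "b < N"
  shows "(\<Sum>p<N. unity N (p * a) * cnj (unity N (p * b))) = (if a = b then of_nat N else 0)"
proof -
  have N: "N > 0" using assms by simp
  define \<omega> where "\<omega> = unity N a * cnj (unity N b)"
  have geometric: "(\<Sum>p<N. unity N (p * a) * cnj (unity N (p * b))) = (\<Sum>p<N. \<omega> ^ p)"
    by (simp add: \<omega>_def unity_mult power_mult_distrib)
  have unit: "unity N b * cnj (unity N b) = 1"
    using complex_norm_square[of "unity N b"] by simp
  show ?thesis
  proof (cases "a = b")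
    case True
    then show ?thesis unfolding geometric using unit by (simp add: \<omega>_def)
  next
    case False
    have "unity N a \<noteq> unity N b"
      using Complex.bij_betw_roots_unity[OF N] assms False unfolding unity_def bij_betw_def inj_on_def by auto
    then have "\<omega> \<noteq> 1" using unit unfolding \<omega>_def
      by (metis mult.commute mult_cancel_right mult_zero_left zero_neq_one)
    moreover have "\<omega> ^ N = 1"
      unfolding \<omega>_def power_mult_distrib complex_cnj_power[symmetric] by simp
    ultimately show ?thesis unfolding geometric using False by (simp add: geometric_sum)
  qed
qed

lemma character_table_torus:
  assumes "N > 0"
  shows "character_table (torus N) (torus N) (torus_char N) ((real N)\<^sup>2)"
proof
  show "0 < (real N)\<^sup>2" using assms by simp
  fix x y assume "x \<in> torus N" "y \<in> torus N"
  then obtain a b a' b' where xy: "x = (a, b)" "y = (a', b')" "a < N" "b < N" "a' < N" "b' < N"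
    by (auto simp: torus_def)
  have "(\<Sum>r\<in>torus N. torus_char N r x * cnj (torus_char N r y)) =
      (\<Sum>p<N. \<Sum>q<N. (unity N (p * a) * cnj (unity N (p * a'))) * (unity N (q * b) * cnj (unity N (q * b'))))"
    unfolding torus_def sum.cartesian_product
    by (intro sum.cong refl) (auto simp: torus_char_def xy mult_ac)
  also have "\<dots> = (\<Sum>p<N. unity N (p * a) * cnj (unity N (p * a'))) *
      (\<Sum>q<N. unity N (q * b) * cnj (unity N (q * b')))"
    by (rule sum_product[symmetric])
  also have "\<dots> = (if x = y then complex_of_real ((real N)\<^sup>2) else 0)"
    using xy by (simp only: unity_orthogonal) (auto simp: power2_eq_square)
  finally show "(\<Sum>r\<in>torus N. torus_char N r x * cnj (torus_char N r y)) =
    (if x = y then complex_of_real ((real N)\<^sup>2) else 0)" .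
qed (rule finite_torus)+

subsection \<open>The eigenvalues of the Laplacian\<close>

definition torus_eigenvalue :: "nat \<Rightarrow> nat \<times> nat \<Rightarrow> real" where
  "torus_eigenvalue N r = (cmod (unity N (fst r) - 1))\<^sup>2 + (cmod (unity N (snd r) - 1))\<^sup>2"

definition fold_index :: "nat \<Rightarrow> nat \<Rightarrow> nat" where
  "fold_index N p = min p (N - p)"

definition torus_norm :: "nat \<Rightarrow> nat \<times> nat \<Rightarrow> nat" where
  "torus_norm N r = max (fold_index N (fst r)) (fold_index N (snd r))"

lemma sin_ge_half:
  assumes "0 \<le> x" "x \<le> pi / 2"
  shows "x / 2 \<le> sin x"
proof -
  have x: "x \<le> 8 / 5" using assms pi_approx by simp
  have "\<bar>sin x - (\<Sum>m<3. sin_coeff m * x ^ m)\<bar> \<le> inverse (fact 3) * \<bar>x\<bar> ^ 3"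
    by (rule Maclaurin_sin_bound)
  then have "\<bar>sin x - x\<bar> \<le> x ^ 3 / 6"
    using assms by (simp add: sin_coeff_def numeral_eq_Suc field_simps)
  moreover have "x * x * x \<le> (8 / 5) * (8 / 5) * x"
    using x assms by (intro mult_mono mult_right_mono) auto
  ultimately show ?thesis using assms unfolding power3_eq_cube by linarith
qed

lemma norm_cis_double_minus_1: "(cmod (cis (2 * t) - 1))\<^sup>2 = 4 * (sin t)\<^sup>2"
proof -
  have "(cmod (cis (2 * t) - 1))\<^sup>2 = (2 * (sin t)\<^sup>2)\<^sup>2 + (2 * sin t * cos t)\<^sup>2"
    by (simp add: cmod_power2 cos_double_sin sin_double)
  also have "\<dots> = 4 * (sin t)\<^sup>2 * ((sin t)\<^sup>2 + (cos t)\<^sup>2)" by algebra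
  finally show ?thesis by simp
qed

lemma norm_unity_minus_1_ge:
  assumes "p < N"
  shows "(cmod (unity N p - 1))\<^sup>2 \<ge> 4 * (real (fold_index N p) / real N)\<^sup>2"
proof -
  define k where "k = fold_index N p"
  define x where "x = pi * real k / real N"
  have N: "N > 0" using assms by simp
  have "(cmod (unity N p - 1))\<^sup>2 = 4 * (sin (pi * real p / real N))\<^sup>2"
    using norm_cis_double_minus_1[of "pi * real p / real N"] by (simp add: unity_def mult.assoc)
  also have "(sin (pi * real p / real N))\<^sup>2 = (sin x)\<^sup>2"
  proof (cases "p \<le> N - p")
    case False
    then have "x = pi - pi * real p / real N"
      using assms N by (simp add: x_def k_def fold_index_def min_def of_nat_diff field_simps)
    then show ?thesis by simp
  qed (simp add: x_def k_def fold_index_def min_def)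
  finally have norm_eq_sin: "(cmod (unity N p - 1))\<^sup>2 = 4 * (sin x)\<^sup>2" .
  have "2 * k \<le> N" by (auto simp: k_def fold_index_def min_def)
  then have "2 * real k \<le> real N" by linarith
  then have "x \<le> pi / 2" unfolding x_def using N by (simp add: field_simps)
  then have "x / 2 \<le> sin x" by (intro sin_ge_half) (simp_all add: x_def)
  moreover have "2 * (real k / real N) \<le> pi * (real k / real N)"
    using pi_ge_two by (intro mult_right_mono) auto
  ultimately have "(real k / real N)\<^sup>2 \<le> (sin x)\<^sup>2"
    by (intro power_mono) (simp_all add: x_def)
  then show ?thesis unfolding norm_eq_sin k_def by linarith
qed

lemma torus_eigenvalue_ge:
  assumes "r \<in> torus N"
  shows "torus_eigenvalue N r \<ge> 4 * (real (torus_norm N r) / real N)\<^sup>2"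
proof -
  define a where "a = real (fold_index N (fst r)) / real N"
  define b where "b = real (fold_index N (snd r)) / real N"
  have "4 * a\<^sup>2 + 4 * b\<^sup>2 \<le> torus_eigenvalue N r"
    unfolding torus_eigenvalue_def a_def b_def
    using assms by (intro add_mono norm_unity_minus_1_ge) (auto simp: torus_def)
  moreover have "(real (torus_norm N r) / real N)\<^sup>2 \<le> a\<^sup>2 + b\<^sup>2"
    by (simp add: torus_norm_def max_def a_def b_def)
  ultimately show ?thesis by linarith
qed

lemma torus_norm_pos: "r \<in> torus N - {(0, 0)} \<Longrightarrow> 0 < torus_norm N r"
  by (cases r) (auto simp: torus_def torus_norm_def fold_index_def less_max_iff_disj)

lemma torus_eigenvalue_pos:
  assumes "r \<in> torus N - {(0, 0)}"
  shows "0 < torus_eigenvalue N r"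
proof -
  have "N > 0" using assms by (auto simp: torus_def)
  then have "0 < 4 * (real (torus_norm N r) / real N)\<^sup>2" using torus_norm_pos[OF assms] by simp
  also have "\<dots> \<le> torus_eigenvalue N r" using assms by (intro torus_eigenvalue_ge) simp
  finally show ?thesis .
qed

lemma card_torus_norm_eq_le:
  assumes "k \<ge> 1"
  shows "card {r \<in> torus N. torus_norm N r = k} \<le> 12 * k"
proof -
  define A where "A = {k, N - k}"
  define B where "B = {0..k} \<union> {N - k..<N}"
  have fin: "finite A" "finite B" by (auto simp: A_def B_def)
  have "card A \<le> 2" by (simp add: A_def card_insert_if)
  moreover have "card B \<le> card {0..k} + card {N - k..<N}" unfolding B_def by (rule card_Un_le)
  then have "card B \<le> 3 * k" using assms by simp
  ultimately have "card (A \<times> B) + card (B \<times> A) \<le> 2 * (3 * k) + (3 * k) * 2"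
    unfolding card_cartesian_product by (intro add_mono mult_mono) auto
  have A: "p \<in> A" if "fold_index N p = k" "p < N" for p
    using that by (auto simp: A_def fold_index_def min_def split: if_splits)
  have B: "p \<in> B" if "fold_index N p \<le> k" "p < N" for p
    using that by (auto simp: B_def fold_index_def min_def split: if_splits)
  have "{r \<in> torus N. torus_norm N r = k} \<subseteq> A \<times> B \<union> B \<times> A"
    using A B by (auto simp: torus_def torus_norm_def max_def split: if_splits)
  then have "card {r \<in> torus N. torus_norm N r = k} \<le> card (A \<times> B \<union> B \<times> A)"
    using fin by (intro card_mono) auto
  also have "\<dots> \<le> card (A \<times> B) + card (B \<times> A)" by (rule card_Un_le)
  also have "\<dots> \<le> 2 * (3 * k) + (3 * k) * 2" by fact
  finally show ?thesis by simp
qed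

lemma sum_inverse_torus_eigenvalue_le:
  "(\<Sum>r\<in>torus N - {(0, 0)}. 1 / torus_eigenvalue N r) \<le> 3 * (real N)\<^sup>2 * harm N"
proof -
  let ?T = "torus N - {(0, 0)}" and ?k = "torus_norm N"
  have fin: "finite ?T" by (simp add: finite_torus)
  have "(\<Sum>r\<in>?T. 1 / torus_eigenvalue N r) \<le> (\<Sum>r\<in>?T. (real N)\<^sup>2 / (4 * (real (?k r))\<^sup>2))"
  proof (rule sum_mono)
    fix r assume r: "r \<in> ?T"
    then have N: "N > 0" by (auto simp: torus_def)
    have "1 / torus_eigenvalue N r \<le> 1 / (4 * (real (?k r) / real N)\<^sup>2)"
      using torus_eigenvalue_ge[of r N] r torus_norm_pos[OF r] N
      by (intro divide_left_mono mult_pos_pos) (auto intro!: torus_eigenvalue_pos)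
    then show "1 / torus_eigenvalue N r \<le> (real N)\<^sup>2 / (4 * (real (?k r))\<^sup>2)"
      by (simp add: power_divide)
  qed
  also have "\<dots> = (\<Sum>l\<in>{1..N}. \<Sum>r\<in>{r \<in> ?T. ?k r = l}. (real N)\<^sup>2 / (4 * (real (?k r))\<^sup>2))"
  proof (intro sum.group[symmetric] fin)
    show "?k ` ?T \<subseteq> {1..N}"
      using torus_norm_pos[of _ N] by (fastforce simp: torus_def torus_norm_def fold_index_def Suc_le_eq)
  qed simp
  also have "\<dots> = (\<Sum>l\<in>{1..N}. real (card {r \<in> ?T. ?k r = l}) * ((real N)\<^sup>2 / (4 * (real l)\<^sup>2)))"
    by (intro sum.cong refl) simp
  also have "\<dots> \<le> (\<Sum>l\<in>{1..N}. real (12 * l) * ((real N)\<^sup>2 / (4 * (real l)\<^sup>2)))"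
  proof (intro sum_mono mult_right_mono)
    fix l assume "l \<in> {1..N}"
    then have "card {r \<in> torus N. ?k r = l} \<le> 12 * l" by (intro card_torus_norm_eq_le) simp
    moreover have "card {r \<in> ?T. ?k r = l} \<le> card {r \<in> torus N. ?k r = l}"
      by (rule card_mono) (auto simp: finite_torus)
    ultimately show "real (card {r \<in> ?T. ?k r = l}) \<le> real (12 * l)" by linarith
  qed simp
  also have "\<dots> = (\<Sum>l\<in>{1..N}. 3 * (real N)\<^sup>2 * inverse (real l))"
    by (intro sum.cong refl) (simp add: power2_eq_square field_simps)
  also have "\<dots> = 3 * (real N)\<^sup>2 * harm N"
    by (simp add: harm_def sum_distrib_left)
  finally show ?thesis .
qed

subsection \<open>Discrepancy of Lipschitz functions on the torus\<close>

definition torus_shift_fst :: "nat \<Rightarrow> nat \<times> nat \<Rightarrow> nat \<times> nat" where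
  "torus_shift_fst N = map_prod (\<lambda>a. Suc a mod N) (\<lambda>b. b)"

definition torus_shift_snd :: "nat \<Rightarrow> nat \<times> nat \<Rightarrow> nat \<times> nat" where
  "torus_shift_snd N = map_prod (\<lambda>a. a) (\<lambda>b. Suc b mod N)"

definition torus_discrepancy ::
  "nat \<Rightarrow> nat \<Rightarrow> (nat \<Rightarrow> nat \<times> nat) \<Rightarrow> (nat \<Rightarrow> nat \<times> nat) \<Rightarrow> nat \<times> nat \<Rightarrow> complex" where
  "torus_discrepancy N n z w r = (\<Sum>i<n. torus_char N r (z i) - torus_char N r (w i))"

definition torus_dual_energy ::
  "nat \<Rightarrow> nat \<Rightarrow> (nat \<Rightarrow> nat \<times> nat) \<Rightarrow> (nat \<Rightarrow> nat \<times> nat) \<Rightarrow> real" where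
  "torus_dual_energy N n z w =
    (\<Sum>r\<in>torus N - {(0, 0)}. (cmod (torus_discrepancy N n z w r))\<^sup>2 / torus_eigenvalue N r)"

lemma torus_dual_energy_nonneg: "0 \<le> torus_dual_energy N n z w"
  unfolding torus_dual_energy_def using torus_eigenvalue_pos
  by (intro sum_nonneg divide_nonneg_pos) auto

lemma bij_betw_Suc_mod: "bij_betw (\<lambda>a. Suc a mod N) {..<N} {..<N}"
proof -
  have "inj_on (\<lambda>a. Suc a mod N) {..<N}"
  proof (rule inj_onI)
    fix a b assume ab: "a \<in> {..<N}" "b \<in> {..<N}" "Suc a mod N = Suc b mod N"
    then show "a = b" by (cases "Suc a = N"; cases "Suc b = N") auto
  qed
  moreover have "(\<lambda>a. Suc a mod N) ` {..<N} \<subseteq> {..<N}" by auto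
  ultimately show ?thesis by (simp add: bij_betw_def endo_inj_surj)
qed

lemma bij_betw_torus_shift:
  "bij_betw (torus_shift_fst N) (torus N) (torus N)" "bij_betw (torus_shift_snd N) (torus N) (torus N)"
  unfolding torus_shift_fst_def torus_shift_snd_def torus_def
  by (intro bij_betw_map_prod bij_betw_Suc_mod, simp add: bij_betw_def)+

lemma torus_char_shift:
  "torus_char N r (torus_shift_fst N x) = unity N (fst r) * torus_char N r x"
  "torus_char N r (torus_shift_snd N x) = unity N (snd r) * torus_char N r x"
proof -
  have "unity N (p * (Suc a mod N)) = unity N p * unity N (p * a)" for p a
    using unity_mod[of N "p * (Suc a mod N)"] unity_mod[of N "p * Suc a"]
    by (simp add: mod_mult_right_eq unity_add)
  then show "torus_char N r (torus_shift_fst N x) = unity N (fst r) * torus_char N r x"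
    "torus_char N r (torus_shift_snd N x) = unity N (snd r) * torus_char N r x"
    by (simp_all add: torus_char_def torus_shift_fst_def torus_shift_snd_def)
qed

lemma torus_dirichlet_energy:
  assumes N: "N > 0"
  shows "(\<Sum>r\<in>torus N. torus_eigenvalue N r * (cmod (character_table.ft (torus N) (torus_char N) g r))\<^sup>2) =
    (real N)\<^sup>2 * ((\<Sum>x\<in>torus N. (g (torus_shift_fst N x) - g x)\<^sup>2)
      + (\<Sum>x\<in>torus N. (g (torus_shift_snd N x) - g x)\<^sup>2))"
proof -
  interpret character_table "torus N" "torus N" "torus_char N" "(real N)\<^sup>2"
    by (rule character_table_torus[OF N])
  have "(\<Sum>r\<in>torus N. torus_eigenvalue N r * (cmod (ft g r))\<^sup>2) =
      (\<Sum>r\<in>torus N. (cmod (unity N (fst r) - 1))\<^sup>2 * (cmod (ft g r))\<^sup>2)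
      + (\<Sum>r\<in>torus N. (cmod (unity N (snd r) - 1))\<^sup>2 * (cmod (ft g r))\<^sup>2)"
    by (simp add: torus_eigenvalue_def distrib_right sum.distrib)
  also have "\<dots> = (real N)\<^sup>2 * (\<Sum>x\<in>torus N. (g (torus_shift_fst N x) - g x)\<^sup>2)
      + (real N)\<^sup>2 * (\<Sum>x\<in>torus N. (g (torus_shift_snd N x) - g x)\<^sup>2)"
    by (intro arg_cong2[where f = "(+)"] ft_shift_energy bij_betw_torus_shift torus_char_shift norm_unity)
  finally show ?thesis by (simp only: distrib_left)
qed

lemma torus_discrepancy_le:
  assumes N: "N > 0"
    and g: "\<And>x. x \<in> torus N \<Longrightarrow> \<bar>g (torus_shift_fst N x) - g x\<bar> \<le> h"
      "\<And>x. x \<in> torus N \<Longrightarrow> \<bar>g (torus_shift_snd N x) - g x\<bar> \<le> h"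
    and zw: "\<And>i. i < n \<Longrightarrow> z i \<in> torus N" "\<And>i. i < n \<Longrightarrow> w i \<in> torus N"
  shows "(\<Sum>i<n. g (z i) - g (w i))\<^sup>2 \<le> 2 * h\<^sup>2 * torus_dual_energy N n z w"
proof -
  interpret character_table "torus N" "torus N" "torus_char N" "(real N)\<^sup>2"
    by (rule character_table_torus[OF N])
  define G where "G = (\<Sum>i<n. g (z i) - g (w i))"
  have energy: "(\<Sum>x\<in>torus N. (g (s x) - g x)\<^sup>2) \<le> (real N)\<^sup>2 * h\<^sup>2"
    if s: "\<And>x. x \<in> torus N \<Longrightarrow> \<bar>g (s x) - g x\<bar> \<le> h" for s
  proof -
    have "(g (s x) - g x)\<^sup>2 \<le> h\<^sup>2" if "x \<in> torus N" for x
      using power_mono[OF s[OF that] abs_ge_zero, of 2] by simp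
    then have "(\<Sum>x\<in>torus N. (g (s x) - g x)\<^sup>2) \<le> (\<Sum>x\<in>torus N. h\<^sup>2)" by (rule sum_mono)
    then show ?thesis by (simp add: torus_def power2_eq_square)
  qed
  have "(\<Sum>r\<in>torus N - {(0, 0)}. torus_eigenvalue N r * (cmod (ft g r))\<^sup>2)
      \<le> (\<Sum>r\<in>torus N. torus_eigenvalue N r * (cmod (ft g r))\<^sup>2)"
    by (intro sum_mono2 finite_torus) (auto simp: torus_eigenvalue_def)
  also have "\<dots> \<le> (real N)\<^sup>2 * ((real N)\<^sup>2 * h\<^sup>2 + (real N)\<^sup>2 * h\<^sup>2)"
    unfolding torus_dirichlet_energy[OF N] by (intro add_mono mult_left_mono energy g) auto
  also have "\<dots> = ((real N)\<^sup>2)\<^sup>2 * (2 * h\<^sup>2)" by (simp add: power2_eq_square)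
  finally have "(\<Sum>r\<in>torus N - {(0, 0)}. torus_eigenvalue N r * (cmod (ft g r))\<^sup>2)
      * torus_dual_energy N n z w \<le> ((real N)\<^sup>2)\<^sup>2 * (2 * h\<^sup>2) * torus_dual_energy N n z w"
    by (rule mult_right_mono[OF _ torus_dual_energy_nonneg])
  moreover have "((real N)\<^sup>2 * G)\<^sup>2 \<le> (\<Sum>r\<in>torus N - {(0, 0)}. torus_eigenvalue N r * (cmod (ft g r))\<^sup>2)
      * torus_dual_energy N n z w"
    unfolding G_def torus_dual_energy_def torus_discrepancy_def using torus_eigenvalue_pos
    by (intro discrepancy_le_dual_norm zw) (auto simp: torus_char_def)
  ultimately have "((real N)\<^sup>2)\<^sup>2 * G\<^sup>2 \<le> ((real N)\<^sup>2)\<^sup>2 * (2 * h\<^sup>2 * torus_dual_energy N n z w)"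
    by (simp add: power_mult_distrib mult.assoc)
  then show ?thesis
    using N unfolding G_def by (simp only: mult_le_cancel_left_pos zero_less_power of_nat_0_less_iff)
qed

section \<open>Matchings on a planar grid\<close>

text \<open>The square \<open>[-R, R]\<^sup>2\<close> carries a grid of \<open>m + 1\<close> points per direction. It is indexed by a torus of
  period \<open>2 m\<close> that runs through the grid and back again (see \<^const>\<open>fold_index\<close>), so that every
  Lipschitz function on the plane restricts to a periodic Lipschitz function.\<close>
locale planar_grid =
  fixes e1 e2 :: "'a::euclidean_space" and R :: real and m :: nat
  assumes basis: "Basis = {e1, e2}" "e1 \<noteq> e2" and R_pos: "R > 0" and m_pos: "m > 0"
begin

definition mesh :: real where
  "mesh = 2 * R / real m"

definition grid_point :: "nat \<times> nat \<Rightarrow> 'a" where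
  "grid_point x = (mesh * real (fold_index (2 * m) (fst x)) - R) *\<^sub>R e1
    + (mesh * real (fold_index (2 * m) (snd x)) - R) *\<^sub>R e2"

definition grid_index :: "real \<Rightarrow> nat" where
  "grid_index t = nat \<lfloor>(t + R) / mesh\<rfloor>"

definition grid_cell :: "'a \<Rightarrow> nat \<times> nat" where
  "grid_cell u = (grid_index (u \<bullet> e1), grid_index (u \<bullet> e2))"

lemma mesh_pos: "mesh > 0"
  using R_pos m_pos by (simp add: mesh_def)

lemma orthonormal: "e1 \<bullet> e1 = 1" "e2 \<bullet> e2 = 1" "e1 \<bullet> e2 = 0" "e2 \<bullet> e1 = 0" "norm e1 = 1" "norm e2 = 1"
proof -
  have "e1 \<in> Basis" "e2 \<in> Basis" using basis(1) by auto
  then show "e1 \<bullet> e1 = 1" "e2 \<bullet> e2 = 1" "e1 \<bullet> e2 = 0" "e2 \<bullet> e1 = 0" "norm e1 = 1" "norm e2 = 1"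
    using basis(2) by (simp_all only: inner_Basis norm_Basis) auto
qed

lemma abs_inner_le:
  assumes "norm x \<le> R"
  shows "\<bar>x \<bullet> e1\<bar> \<le> R" "\<bar>x \<bullet> e2\<bar> \<le> R"
  using assms Cauchy_Schwarz_ineq2[of x e1] Cauchy_Schwarz_ineq2[of x e2] by (auto simp: orthonormal)

lemma grid_index_bounds:
  assumes "\<bar>t\<bar> \<le> R"
  shows "grid_index t \<le> m" "\<bar>mesh * real (grid_index t) - R - t\<bar> \<le> mesh"
proof -
  define q where "q = (t + R) / mesh"
  have "0 \<le> q" unfolding q_def using assms mesh_pos by simp
  have "mesh * real m = 2 * R" using m_pos by (simp add: mesh_def)
  then have "q \<le> real m"
    unfolding q_def using assms mesh_pos by (simp add: pos_divide_le_eq mult.commute)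
  then show "grid_index t \<le> m" unfolding grid_index_def q_def by linarith
  have "\<bar>real (grid_index t) - q\<bar> \<le> 1" using \<open>0 \<le> q\<close> unfolding grid_index_def q_def[symmetric] by linarith
  then have "mesh * \<bar>real (grid_index t) - q\<bar> \<le> mesh * 1" using mesh_pos by (intro mult_left_mono) auto
  moreover have "mesh * \<bar>real (grid_index t) - q\<bar> = \<bar>mesh * real (grid_index t) - mesh * q\<bar>"
    using mesh_pos by (simp add: abs_mult flip: right_diff_distrib)
  moreover have "mesh * q = t + R" unfolding q_def using mesh_pos by simp
  ultimately show "\<bar>mesh * real (grid_index t) - R - t\<bar> \<le> mesh" by (simp add: algebra_simps)
qed

lemma grid_cell_in_torus: "norm x \<le> R \<Longrightarrow> grid_cell x \<in> torus (2 * m)"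
  using grid_index_bounds(1)[OF abs_inner_le(1), of x] grid_index_bounds(1)[OF abs_inner_le(2), of x] m_pos
  by (auto simp: grid_cell_def torus_def)

lemma dist_grid_point_cell_le:
  assumes "norm x \<le> R"
  shows "dist x (grid_point (grid_cell x)) \<le> 2 * mesh"
proof -
  have fold: "fold_index (2 * m) a = a" if "a \<le> m" for a using that by (simp add: fold_index_def)
  let ?v = "grid_point (grid_cell x) - x"
  have "norm ?v \<le> (\<Sum>b\<in>Basis. \<bar>?v \<bullet> b\<bar>)" by (rule norm_le_l1)
  also have "\<dots> = \<bar>?v \<bullet> e1\<bar> + \<bar>?v \<bullet> e2\<bar>" unfolding basis(1) using basis(2) by simp
  also have "\<dots> \<le> mesh + mesh"
    using grid_index_bounds[OF abs_inner_le(1)[OF assms]] grid_index_bounds[OF abs_inner_le(2)[OF assms]]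
    by (intro add_mono)
      (simp_all add: grid_point_def grid_cell_def fold inner_diff_left inner_add_left orthonormal)
  finally show ?thesis by (simp add: dist_norm norm_minus_commute)
qed

lemma dist_grid_point_shift_le:
  assumes "x \<in> torus (2 * m)"
  shows "dist (grid_point (torus_shift_fst (2 * m) x)) (grid_point x) \<le> mesh"
    and "dist (grid_point (torus_shift_snd (2 * m) x)) (grid_point x) \<le> mesh"
proof -
  let ?f = "fold_index (2 * m)" and ?S = "\<lambda>a. Suc a mod (2 * m)"
  have adjacent_le: "mesh * \<bar>real (?f (?S a)) - real (?f a)\<bar> \<le> mesh" if "a < 2 * m" for a
  proof -
    have "\<bar>real (?f (?S a)) - real (?f a)\<bar> \<le> 1"
      using that by (cases "Suc a = 2 * m") (auto simp: fold_index_def min_def)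
    then show ?thesis using mult_left_mono[of _ 1 mesh] mesh_pos by simp
  qed
  have "grid_point (torus_shift_fst (2 * m) x) - grid_point x =
      (mesh * (real (?f (?S (fst x))) - real (?f (fst x)))) *\<^sub>R e1"
    "grid_point (torus_shift_snd (2 * m) x) - grid_point x =
      (mesh * (real (?f (?S (snd x))) - real (?f (snd x)))) *\<^sub>R e2"
    by (simp_all add: grid_point_def torus_shift_fst_def torus_shift_snd_def algebra_simps)
  then show "dist (grid_point (torus_shift_fst (2 * m) x)) (grid_point x) \<le> mesh"
    "dist (grid_point (torus_shift_snd (2 * m) x)) (grid_point x) \<le> mesh"
    using assms adjacent_le mesh_pos by (auto simp: dist_norm orthonormal abs_mult torus_def)
qed

lemma matching_cost_le_dual_energy:
  assumes u: "\<And>i. i < n \<Longrightarrow> norm (u i) \<le> R" and v: "\<And>i. i < n \<Longrightarrow> norm (v i) \<le> R"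
  shows "matching_cost u v n \<le> 4 * real n * mesh + sqrt (2 * mesh\<^sup>2 *
    torus_dual_energy (2 * m) n (\<lambda>i. grid_cell (u i)) (\<lambda>i. grid_cell (v i)))"
proof -
  obtain f :: "'a \<Rightarrow> real"
    where f: "1-lipschitz_on UNIV f" "matching_cost u v n \<le> (\<Sum>i<n. f (u i) - f (v i))"
    by (rule matching_cost_dual)
  have abs_diff_le: "\<bar>f a - f b\<bar> \<le> dist a b" for a b
    using lipschitz_onD[OF f(1), of a b] by (simp add: dist_real_def)
  define g where "g x = f (grid_point x)" for x
  have "(\<Sum>i<n. g (grid_cell (u i)) - g (grid_cell (v i)))\<^sup>2 \<le>
      2 * mesh\<^sup>2 * torus_dual_energy (2 * m) n (\<lambda>i. grid_cell (u i)) (\<lambda>i. grid_cell (v i))"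
    unfolding g_def using m_pos
    by (intro torus_discrepancy_le order_trans[OF abs_diff_le] dist_grid_point_shift_le
        grid_cell_in_torus u v) auto
  then have "(\<Sum>i<n. g (grid_cell (u i)) - g (grid_cell (v i))) \<le>
      sqrt (2 * mesh\<^sup>2 * torus_dual_energy (2 * m) n (\<lambda>i. grid_cell (u i)) (\<lambda>i. grid_cell (v i)))"
    by (rule real_le_rsqrt)
  moreover have "(\<Sum>i<n. f (u i) - f (v i)) \<le> (\<Sum>i<n. (g (grid_cell (u i)) - g (grid_cell (v i))) + 4 * mesh)"
  proof (rule sum_mono)
    fix i assume "i \<in> {..<n}"
    then have i: "i < n" by simp
    show "f (u i) - f (v i) \<le> (g (grid_cell (u i)) - g (grid_cell (v i))) + 4 * mesh"
      using abs_diff_le[of "u i" "grid_point (grid_cell (u i))"]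
        abs_diff_le[of "v i" "grid_point (grid_cell (v i))"]
        dist_grid_point_cell_le[OF u[OF i]] dist_grid_point_cell_le[OF v[OF i]] unfolding g_def by linarith
  qed
  moreover have "(\<Sum>i<n. (g (grid_cell (u i)) - g (grid_cell (v i))) + 4 * mesh) =
      (\<Sum>i<n. g (grid_cell (u i)) - g (grid_cell (v i))) + 4 * real n * mesh"
    by (simp add: sum.distrib)
  ultimately show ?thesis using f(2) by linarith
qed

end

section \<open>Two independent samples\<close>

abbreviation matching_functional :: "nat \<Rightarrow> (nat + nat \<Rightarrow> 'a::metric_space) \<Rightarrow> real" where
  "matching_functional n z \<equiv> matching_cost (\<lambda>i. z (Inl i)) (\<lambda>i. z (Inr i)) n"

abbreviation crane_functional :: "nat \<Rightarrow> (nat + nat \<Rightarrow> 'a::metric_space) \<Rightarrow> real" where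
  "crane_functional n z \<equiv> stacker_crane_opt (\<lambda>i. z (Inl i)) (\<lambda>i. z (Inr i)) n"

lemma sum_Plus_lessThan:
  fixes g :: "nat + nat \<Rightarrow> 'b::comm_monoid_add"
  shows "(\<Sum>j\<in>{..<n} <+> {..<n}. g j) = (\<Sum>i<n. g (Inl i)) + (\<Sum>i<n. g (Inr i))"
  by (subst sum.Plus) (auto simp: comp_def)

lemma l1_lipschitz_matching_functional:
  "l1_lipschitz 1 ({..<n} <+> {..<n}) (matching_functional n)"
  unfolding l1_lipschitz_def sum_Plus_lessThan mult_1 by (intro allI matching_cost_le_add)

lemma l1_lipschitz_crane_functional:
  "l1_lipschitz 2 ({..<n} <+> {..<n}) (crane_functional n)"
  unfolding l1_lipschitz_def sum_Plus_lessThan by (intro allI stacker_crane_opt_le_add)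

lemma borel_measurable_matching_functional:
  fixes n :: nat
  assumes "{..<n} <+> {..<n} \<subseteq> J"
  shows "(matching_functional n :: (_ \<Rightarrow> 'a::euclidean_space) \<Rightarrow> _) \<in> borel_measurable (PiM J (\<lambda>_. borel))"
  using assms by (intro borel_measurable_matching_cost measurable_component_singleton) auto

lemma borel_measurable_crane_functional:
  fixes n :: nat
  assumes "{..<n} <+> {..<n} \<subseteq> J"
  shows "(crane_functional n :: (_ \<Rightarrow> 'a::euclidean_space) \<Rightarrow> _) \<in> borel_measurable (PiM J (\<lambda>_. borel))"
  using assms by (intro borel_measurable_stacker_crane_opt measurable_component_singleton) auto

definition two_sample_law :: "'a measure \<Rightarrow> 'a measure \<Rightarrow> (nat + nat \<Rightarrow> 'a) measure" where
  "two_sample_law \<mu> \<nu> = PiM UNIV (case_sum (\<lambda>_. \<mu>) (\<lambda>_. \<nu>))"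

definition expected_matching_cost :: "'a::euclidean_space measure \<Rightarrow> 'a measure \<Rightarrow> nat \<Rightarrow> real" where
  "expected_matching_cost \<mu> \<nu> n = (\<integral>z. matching_functional n z \<partial>two_sample_law \<mu> \<nu>)"

locale two_samples = prob_space M for M :: "'m measure" +
  fixes X Y :: "nat \<Rightarrow> 'm \<Rightarrow> 'a::euclidean_space" and \<Omega> :: "'a set" and \<mu> \<nu> :: "'a measure"
  assumes indep: "indep_vars (\<lambda>_. borel) (case_sum X Y) UNIV"
    and law_X: "\<And>i. distr M borel (X i) = \<mu>" and law_Y: "\<And>i. distr M borel (Y i) = \<nu>"
    and X_in: "\<And>i. AE \<omega> in M. X i \<omega> \<in> \<Omega>" and Y_in: "\<And>i. AE \<omega> in M. Y i \<omega> \<in> \<Omega>"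
    and compact: "compact \<Omega>"
begin

lemma rv [measurable]: "random_variable borel (case_sum X Y j)"
  using indep by (auto simp: indep_vars_def)

lemma rv_X [measurable]: "random_variable borel (X i)" and rv_Y [measurable]: "random_variable borel (Y i)"
  using rv[of "Inl i"] rv[of "Inr i"] by simp_all

lemma AE_in: "AE \<omega> in M. case_sum X Y j \<omega> \<in> \<Omega>"
  using X_in Y_in by (cases j) auto

definition D :: real where
  "D = diameter \<Omega> + 1"

lemma D_pos: "D > 0"
  using diameter_ge_0[OF compact_imp_bounded[OF compact]] by (simp add: D_def)

lemma dist_le_D: "a \<in> \<Omega> \<Longrightarrow> b \<in> \<Omega> \<Longrightarrow> dist a b \<le> D"
  using diameter_bounded_bound[OF compact_imp_bounded[OF compact], of a b] by (simp add: D_def)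

lemma expectation_eq_integral_law:
  assumes f: "f \<in> borel_measurable (PiM UNIV (\<lambda>_. borel))"
  shows "expectation (\<lambda>\<omega>. f (\<lambda>j. case_sum X Y j \<omega>)) = (\<integral>z. f z \<partial>two_sample_law \<mu> \<nu> :: real)"
proof -
  have "distr M borel (case_sum X Y j) = case_sum (\<lambda>_. \<mu>) (\<lambda>_. \<nu>) j" for j
    by (cases j) (simp_all add: law_X law_Y)
  then have law: "two_sample_law \<mu> \<nu> = distr M (PiM UNIV (\<lambda>_. borel)) (\<lambda>\<omega>. \<lambda>j\<in>UNIV. case_sum X Y j \<omega>)"
    using indep_vars_iff_distr_eq_PiM[of UNIV "case_sum X Y" "\<lambda>_. borel"] rv indep
    by (simp add: two_sample_law_def)
  have "(\<integral>z. f z \<partial>two_sample_law \<mu> \<nu>) = expectation (\<lambda>\<omega>. f (\<lambda>j\<in>UNIV. case_sum X Y j \<omega>))"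
    unfolding law using rv f by (intro integral_distr measurable_restrict) auto
  then show ?thesis by (simp add: restrict_UNIV)
qed

lemma expectation_matching_cost:
  "expectation (\<lambda>\<omega>. matching_cost (\<lambda>i. X i \<omega>) (\<lambda>i. Y i \<omega>) n) = expected_matching_cost \<mu> \<nu> n"
  using expectation_eq_integral_law[OF borel_measurable_matching_functional[of n]]
  by (simp add: expected_matching_cost_def)

lemma reindex:
  assumes inj: "inj (case_sum f g)"
    and law: "\<And>i. distr M borel (case_sum X Y (f i)) = \<mu>'" "\<And>i. distr M borel (case_sum X Y (g i)) = \<nu>'"
  shows "two_samples M (\<lambda>i. case_sum X Y (f i)) (\<lambda>i. case_sum X Y (g i)) \<Omega> \<mu>' \<nu>'"
proof
  have "indep_vars (\<lambda>_. borel) (\<lambda>j. case_sum X Y (case_sum f g j)) UNIV"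
    by (rule indep_vars_reindex[OF indep inj]) auto
  also have "(\<lambda>j. case_sum X Y (case_sum f g j)) = case_sum (\<lambda>i. case_sum X Y (f i)) (\<lambda>i. case_sum X Y (g i))"
    by (rule ext) (simp split: sum.split)
  finally show "indep_vars (\<lambda>_. borel) (case_sum (\<lambda>i. case_sum X Y (f i)) (\<lambda>i. case_sum X Y (g i))) UNIV" .
qed (use law AE_in compact in auto)

lemma swap: "two_samples M Y X \<Omega> \<nu> \<mu>"
proof -
  have "inj (case_sum Inr Inl :: nat + nat \<Rightarrow> nat + nat)"
    by (auto intro!: injI split: sum.splits)
  from reindex[OF this] show ?thesis by (simp add: law_X law_Y)
qed

lemma compose_inj:
  assumes "inj f" "inj g"
  shows "two_samples M (\<lambda>i. X (f i)) (\<lambda>i. Y (g i)) \<Omega> \<mu> \<nu>"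
proof -
  have "inj (case_sum (\<lambda>i. Inl (f i)) (\<lambda>i. Inr (g i)) :: nat + nat \<Rightarrow> nat + nat)"
    by (rule injI) (simp add: inj_eq[OF assms(1)] inj_eq[OF assms(2)] split: sum.splits)
  from reindex[OF this] show ?thesis by (simp add: law_X law_Y)
qed

lemma split_X: "two_samples M (\<lambda>i. X (2 * i)) (\<lambda>i. X (2 * i + 1)) \<Omega> \<mu> \<mu>"
proof -
  have "2 * i \<noteq> 2 * j + 1" "2 * j + 1 \<noteq> 2 * i" for i j :: nat by presburger+
  then have "inj (case_sum (\<lambda>i. Inl (2 * i)) (\<lambda>i. Inl (2 * i + 1)) :: nat + nat \<Rightarrow> nat + nat)"
    by (auto simp: inj_on_def split: sum.splits)
  from reindex[OF this] show ?thesis by (simp add: law_X)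
qed

lemma integrable_l1_lipschitz:
  assumes J: "finite J" and f: "f \<in> borel_measurable (PiM J (\<lambda>_. borel))" "l1_lipschitz C J f" "C \<ge> 0"
  shows "integrable M (\<lambda>\<omega>. f (\<lambda>j. case_sum X Y j \<omega>))"
proof -
  have "\<Omega> \<noteq> {}" using X_in[of 0] by fastforce
  then obtain x where x: "x \<in> \<Omega>" by blast
  have "AE \<omega> in M. \<forall>j. case_sum X Y j \<omega> \<in> \<Omega>" unfolding AE_all_countable by (intro allI AE_in)
  then have bound: "AE \<omega> in M. norm (f (\<lambda>j. case_sum X Y j \<omega>)) \<le> \<bar>f (\<lambda>_. x)\<bar> + C * (real (card J) * D)"
  proof eventually_elim
    case (elim \<omega>)
    have "(\<Sum>j\<in>J. dist (case_sum X Y j \<omega>) x) \<le> (\<Sum>j\<in>J. D)"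
      using elim x by (intro sum_mono dist_le_D) auto
    then have "C * (\<Sum>j\<in>J. dist (case_sum X Y j \<omega>) x) \<le> C * (real (card J) * D)"
      using f(3) by (intro mult_left_mono) auto
    then show ?case
      using l1_lipschitzD[OF f(2), of "\<lambda>j. case_sum X Y j \<omega>" "\<lambda>_. x"] by simp
  qed
  show ?thesis
    by (rule integrable_const_bound[OF bound borel_measurable_l1_lipschitz[OF f(2,1) rv]])
qed

lemma integrable_matching_cost: "integrable M (\<lambda>\<omega>. matching_cost (\<lambda>i. X i \<omega>) (\<lambda>i. Y i \<omega>) n)"
  using integrable_l1_lipschitz[OF _ borel_measurable_matching_functional[OF subset_refl]
      l1_lipschitz_matching_functional, of n] by simp

lemma integrable_stacker_crane_opt: "integrable M (\<lambda>\<omega>. stacker_crane_opt (\<lambda>i. X i \<omega>) (\<lambda>i. Y i \<omega>) n)"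
  using integrable_l1_lipschitz[OF _ borel_measurable_crane_functional[OF subset_refl]
      l1_lipschitz_crane_functional, of n] by simp

lemma integrable_dist: "integrable M (\<lambda>\<omega>. dist (X i \<omega>) (Y j \<omega>))"
  by (rule integrable_dist_compact[OF rv_X rv_Y X_in Y_in compact])

lemma deviation_bound:
  assumes f: "f \<in> borel_measurable (PiM ({..<n} <+> {..<n}) (\<lambda>_. borel))"
      "l1_lipschitz C ({..<n} <+> {..<n}) f" "C \<ge> 0" and t: "t > 0"
  shows "prob {\<omega> \<in> space M. \<bar>f (\<lambda>j. case_sum X Y j \<omega>) - expectation (\<lambda>\<omega>. f (\<lambda>j. case_sum X Y j \<omega>))\<bar> \<ge> t}
    \<le> 2 * exp (- t\<^sup>2 / ((C * D)\<^sup>2 * real n))"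
proof -
  have "- t\<^sup>2 / ((C * D)\<^sup>2 * real n) = - 2 * t\<^sup>2 / (real (card ({..<n} <+> {..<n})) * (C * D)\<^sup>2)"
    by (simp add: card_Plus divide_simps)
  then show ?thesis
    using McDiarmid_l1_lipschitz[OF indep_vars_subset[OF indep] _ borel_compact[OF compact]
        dist_le_D AE_in f t] by simp
qed

lemma AE_deviation_div_powr_tendsto_0:
  assumes f: "\<And>n. f n \<in> borel_measurable (PiM ({..<n} <+> {..<n}) (\<lambda>_. borel))"
      "\<And>n. l1_lipschitz C ({..<n} <+> {..<n}) (f n)" "C > 0" and q: "q > 1 / 2"
  shows "AE \<omega> in M. (\<lambda>n. (f n (\<lambda>j. case_sum X Y j \<omega>) - expectation (\<lambda>\<omega>. f n (\<lambda>j. case_sum X Y j \<omega>)))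
    / real n powr q) \<longlonglongrightarrow> 0"
proof (rule AE_subgaussian_div_powr_tendsto_0[OF _ _ q])
  show "random_variable borel
      (\<lambda>\<omega>. f n (\<lambda>j. case_sum X Y j \<omega>) - expectation (\<lambda>\<omega>. f n (\<lambda>j. case_sum X Y j \<omega>)))" for n
    using integrable_l1_lipschitz[OF _ f(1) f(2)] f(3) by simp
  show "(C * D)\<^sup>2 > 0" using f(3) D_pos by simp
qed (use f deviation_bound in auto)

end

section \<open>Random matchings in the plane\<close>

lemma harm_le_1_plus_ln: "n \<ge> 1 \<Longrightarrow> harm n \<le> 1 + ln (real n)"
  using euler_mascheroni_sequence_decreasing[of 1 n] by (simp add: harm_def)

lemma ln_real_nat_ge_half: "n \<ge> 2 \<Longrightarrow> 1 / 2 \<le> ln (real n)"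
  using ln2_ge_two_thirds ln_le_cancel_iff[of 2 "real n"] by linarith

lemma harm_le_sqrt:
  assumes n: "n \<ge> 2"
  shows "harm n \<le> 3 * sqrt (real n * ln (real n))"
proof -
  note ln_n = ln_real_nat_ge_half[OF n]
  have "harm n \<le> 3 * ln (real n)" using harm_le_1_plus_ln[of n] n ln_n by simp
  also have "ln (real n) \<le> sqrt (real n * ln (real n))"
  proof (rule real_le_rsqrt)
    have "ln (real n) \<le> real n" using n ln_le_minus_one[of "real n"] by simp
    then show "(ln (real n))\<^sup>2 \<le> real n * ln (real n)"
      unfolding power2_eq_square using ln_n by (intro mult_right_mono) auto
  qed
  finally show ?thesis by simp
qed

lemma (in two_samples) expectation_norm_sum_diff_square_le:
  fixes \<phi> :: "'a \<Rightarrow> complex"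
  assumes same: "\<mu> = \<nu>" and \<phi>: "\<phi> \<in> borel_measurable borel" "\<And>x. cmod (\<phi> x) \<le> 1"
  shows "expectation (\<lambda>\<omega>. (cmod (\<Sum>i<n. \<phi> (X i \<omega>) - \<phi> (Y i \<omega>)))\<^sup>2) \<le> 8 * real n"
proof -
  let ?J = "{..<n} <+> {..<n}"
  define a where "a = (\<integral>x. \<phi> x \<partial>\<mu>)"
  have rv_\<phi>: "random_variable borel (\<lambda>\<omega>. \<phi> (case_sum X Y j \<omega>))" for j
    by (rule measurable_compose[OF rv \<phi>(1)])
  have mean: "expectation (\<lambda>\<omega>. \<phi> (case_sum X Y j \<omega>)) = a" for j
  proof -
    have "distr M borel (case_sum X Y j) = \<mu>" by (cases j) (simp_all add: law_X law_Y same)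
    then show ?thesis unfolding a_def using integral_distr[OF rv \<phi>(1), of j] by simp
  qed
  have a: "cmod a \<le> 1" using norm_expectation_le[OF rv_\<phi>[of "Inl 0"], of 1] \<phi>(2) unfolding mean by simp
  have integrable_\<phi>: "integrable M (\<lambda>\<omega>. \<phi> (case_sum X Y j \<omega>))" for j
    using rv_\<phi> \<phi>(2) by (intro integrable_bounded[of _ 1])
  define s :: "nat + nat \<Rightarrow> complex" where "s = case_sum (\<lambda>_. 1) (\<lambda>_. -1)"
  define \<xi> where "\<xi> j \<omega> = s j * (\<phi> (case_sum X Y j \<omega>) - a)" for j \<omega>
  have "indep_vars (\<lambda>_. borel) \<xi> ?J"
    unfolding \<xi>_def using \<phi>(1)
    by (intro indep_vars_compose2[OF indep_vars_subset[OF indep], where Y = "\<lambda>j x. s j * (\<phi> x - a)"]) auto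
  then have "expectation (\<lambda>\<omega>. (cmod (\<Sum>j\<in>?J. \<xi> j \<omega>))\<^sup>2) \<le> real (card ?J) * 2\<^sup>2"
  proof (rule expectation_norm_sum_square_le)
    fix j :: "nat + nat" and \<omega>
    have "cmod (\<phi> (case_sum X Y j \<omega>) - a) \<le> 2"
      using norm_triangle_ineq4[of "\<phi> (case_sum X Y j \<omega>)" a] \<phi>(2)[of "case_sum X Y j \<omega>"] a by simp
    then show "cmod (\<xi> j \<omega>) \<le> 2" by (cases j) (simp_all add: \<xi>_def s_def norm_mult norm_minus_commute)
    show "expectation (\<xi> j) = 0" unfolding \<xi>_def using integrable_\<phi>[of j] by (simp add: mean prob_space)
  qed simp
  moreover have "(\<Sum>j\<in>?J. \<xi> j \<omega>) = (\<Sum>i<n. \<phi> (X i \<omega>) - \<phi> (Y i \<omega>))" for \<omega>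
    unfolding sum_Plus_lessThan sum.distrib[symmetric] by (intro sum.cong refl) (simp add: \<xi>_def s_def)
  ultimately show ?thesis by (simp add: card_Plus)
qed

context planar_grid
begin

lemma borel_measurable_torus_char_grid_cell [measurable]:
  "(\<lambda>u. torus_char N r (grid_cell u)) \<in> borel_measurable borel"
proof -
  have cell: "(\<lambda>u::'a. p * grid_index (u \<bullet> e)) \<in> measurable borel (count_space UNIV)" for e p
    unfolding grid_index_def by measurable
  have "(\<lambda>u::'a. unity N (p * grid_index (u \<bullet> e))) \<in> borel_measurable borel" for e p
    by (rule measurable_compose[OF cell]) simp
  then show ?thesis unfolding torus_char_def grid_cell_def by simp
qed

lemma expectation_torus_dual_energy_le:
  fixes X Y :: "nat \<Rightarrow> 'm \<Rightarrow> 'a"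
  assumes "two_samples M X Y \<Omega> \<mu> \<mu>"
  shows "integrable M (\<lambda>\<omega>. torus_dual_energy N n (\<lambda>i. grid_cell (X i \<omega>)) (\<lambda>i. grid_cell (Y i \<omega>)))"
    and "(\<integral>\<omega>. torus_dual_energy N n (\<lambda>i. grid_cell (X i \<omega>)) (\<lambda>i. grid_cell (Y i \<omega>)) \<partial>M)
      \<le> 24 * real n * (real N)\<^sup>2 * harm N"
proof -
  interpret two_samples M X Y \<Omega> \<mu> \<mu> by fact
  define T where "T r \<omega> = torus_discrepancy N n (\<lambda>i. grid_cell (X i \<omega>)) (\<lambda>i. grid_cell (Y i \<omega>)) r" for r \<omega>
  have [measurable]: "T r \<in> borel_measurable M" for r unfolding T_def torus_discrepancy_def by measurable
  have integrable_T: "integrable M (\<lambda>\<omega>. (cmod (T r \<omega>))\<^sup>2)" for r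
  proof (rule integrable_bounded)
    fix \<omega>
    have "cmod (torus_char N r x - torus_char N r y) \<le> 2" for x y
      by (rule order_trans[OF norm_triangle_ineq4]) simp
    then have "cmod (T r \<omega>) \<le> (\<Sum>i<n. 2)" unfolding T_def torus_discrepancy_def by (intro sum_norm_le)
    then show "norm ((cmod (T r \<omega>))\<^sup>2) \<le> (2 * real n)\<^sup>2"
      using power_mono[of "cmod (T r \<omega>)" "2 * real n" 2] by simp
  qed simp
  then show "integrable M (\<lambda>\<omega>. torus_dual_energy N n (\<lambda>i. grid_cell (X i \<omega>)) (\<lambda>i. grid_cell (Y i \<omega>)))"
    unfolding torus_dual_energy_def T_def by simp
  have "expectation (\<lambda>\<omega>. (cmod (T r \<omega>))\<^sup>2) \<le> 8 * real n" for r
    unfolding T_def torus_discrepancy_def by (rule expectation_norm_sum_diff_square_le) simp_all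
  then have "(\<Sum>r\<in>torus N - {(0, 0)}. expectation (\<lambda>\<omega>. (cmod (T r \<omega>))\<^sup>2) / torus_eigenvalue N r)
      \<le> (\<Sum>r\<in>torus N - {(0, 0)}. 8 * real n / torus_eigenvalue N r)"
    using torus_eigenvalue_pos by (intro sum_mono divide_right_mono) (auto intro: less_imp_le)
  also have "\<dots> = 8 * real n * (\<Sum>r\<in>torus N - {(0, 0)}. 1 / torus_eigenvalue N r)"
    by (simp add: sum_distrib_left)
  also have "\<dots> \<le> 8 * real n * (3 * (real N)\<^sup>2 * harm N)"
    by (intro mult_left_mono sum_inverse_torus_eigenvalue_le) simp
  finally show "expectation (\<lambda>\<omega>. torus_dual_energy N n (\<lambda>i. grid_cell (X i \<omega>)) (\<lambda>i. grid_cell (Y i \<omega>)))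
      \<le> 24 * real n * (real N)\<^sup>2 * harm N"
    unfolding torus_dual_energy_def using integrable_T by (simp add: T_def)
qed

lemma expectation_matching_cost_le:
  fixes X Y :: "nat \<Rightarrow> 'm \<Rightarrow> 'a"
  assumes "two_samples M X Y \<Omega> \<mu> \<mu>" and R: "\<And>x. x \<in> \<Omega> \<Longrightarrow> norm x \<le> R"
  shows "(\<integral>\<omega>. matching_cost (\<lambda>i. X i \<omega>) (\<lambda>i. Y i \<omega>) n \<partial>M) \<le>
    8 * R * real n / real m + R * sqrt (768 * real n * harm (2 * m))"
proof -
  interpret two_samples M X Y \<Omega> \<mu> \<mu> by fact
  define Q where "Q \<omega> = torus_dual_energy (2 * m) n (\<lambda>i. grid_cell (X i \<omega>)) (\<lambda>i. grid_cell (Y i \<omega>))" for \<omega>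
  have Q: "integrable M Q" "expectation Q \<le> 24 * real n * (real (2 * m))\<^sup>2 * harm (2 * m)"
    unfolding Q_def by (rule expectation_torus_dual_energy_le[OF assms(1)])+
  have "integrable M (\<lambda>\<omega>. 2 * mesh\<^sup>2 * Q \<omega>)" using Q(1) by simp
  moreover have "0 \<le> 2 * mesh\<^sup>2 * Q \<omega>" for \<omega> using torus_dual_energy_nonneg by (simp add: Q_def)
  ultimately have sqrt_Q: "integrable M (\<lambda>\<omega>. sqrt (2 * mesh\<^sup>2 * Q \<omega>))"
    "expectation (\<lambda>\<omega>. sqrt (2 * mesh\<^sup>2 * Q \<omega>)) \<le> sqrt (expectation (\<lambda>\<omega>. 2 * mesh\<^sup>2 * Q \<omega>))"
    by (rule expectation_sqrt_le)+
  have "AE \<omega> in M. (\<forall>i. X i \<omega> \<in> \<Omega>) \<and> (\<forall>i. Y i \<omega> \<in> \<Omega>)"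
    using X_in Y_in by (simp add: AE_all_countable)
  then have "AE \<omega> in M. matching_cost (\<lambda>i. X i \<omega>) (\<lambda>i. Y i \<omega>) n \<le> 4 * real n * mesh + sqrt (2 * mesh\<^sup>2 * Q \<omega>)"
    unfolding Q_def by eventually_elim (simp add: matching_cost_le_dual_energy R)
  then have "expectation (\<lambda>\<omega>. matching_cost (\<lambda>i. X i \<omega>) (\<lambda>i. Y i \<omega>) n)
      \<le> expectation (\<lambda>\<omega>. 4 * real n * mesh + sqrt (2 * mesh\<^sup>2 * Q \<omega>))"
    using sqrt_Q(1) by (intro integral_mono_AE integrable_matching_cost) simp_all
  also have "\<dots> = 4 * real n * mesh + expectation (\<lambda>\<omega>. sqrt (2 * mesh\<^sup>2 * Q \<omega>))"
    using sqrt_Q(1) by (simp add: prob_space)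
  also have "\<dots> \<le> 4 * real n * mesh + sqrt (2 * mesh\<^sup>2 * expectation Q)"
    using sqrt_Q(2) by simp
  also have "\<dots> \<le> 4 * real n * mesh + sqrt (2 * mesh\<^sup>2 * (24 * real n * (real (2 * m))\<^sup>2 * harm (2 * m)))"
    using Q(2) by (intro add_left_mono real_sqrt_le_mono mult_left_mono) auto
  also have "2 * mesh\<^sup>2 * (24 * real n * (real (2 * m))\<^sup>2 * harm (2 * m)) = R\<^sup>2 * (768 * real n * harm (2 * m))"
    using m_pos by (simp add: mesh_def power2_eq_square)
  also have "sqrt \<dots> = R * sqrt (768 * real n * harm (2 * m))"
    using R_pos by (simp add: real_sqrt_mult)
  finally show ?thesis by (simp add: mesh_def mult_ac)
qed

end

lemma harm_double_ceiling_sqrt_le: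
  assumes n: "n \<ge> 2"
  shows "harm (2 * nat \<lceil>sqrt (real n)\<rceil>) \<le> 4 * ln (real n)"
proof -
  define m where "m = nat \<lceil>sqrt (real n)\<rceil>"
  have sqrt_n: "1 \<le> sqrt (real n)" using n by simp
  then have "m > 0" by (simp add: m_def)
  have "sqrt (real n) \<le> real n" using sqrt_n mult_left_mono[OF sqrt_n, of "sqrt (real n)"] by simp
  then have "m \<le> n" unfolding m_def by (simp add: ceiling_le_iff nat_le_iff)
  then have "2 * m \<le> n * n" using n by (intro mult_mono) auto
  then have "real (2 * m) \<le> real n * real n" by (metis of_nat_le_iff of_nat_mult)
  then have "ln (real (2 * m)) \<le> ln (real n * real n)" using \<open>m > 0\<close> by (subst ln_le_cancel_iff) auto
  also have "\<dots> = 2 * ln (real n)" using n by (simp add: ln_mult)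
  finally show ?thesis
    using harm_le_1_plus_ln[of "2 * m"] \<open>m > 0\<close> ln_real_nat_ge_half[OF n] unfolding m_def by linarith
qed

text \<open>The mesh is of order \<open>n\<^sup>-\<^sup>1\<^sup>/\<^sup>2\<close>, which balances the discretisation error against the dual energy.\<close>
lemma (in two_samples) expected_matching_cost_plane_le:
  assumes dim: "DIM('a) = 2" and same: "\<mu> = \<nu>"
    and R: "R > 0" "\<And>x. x \<in> \<Omega> \<Longrightarrow> norm x \<le> R" and n: "n \<ge> 2"
  shows "expected_matching_cost \<mu> \<nu> n \<le> 72 * R * sqrt (real n * ln (real n))"
proof -
  obtain e1 e2 :: 'a where basis: "Basis = {e1, e2}" "e1 \<noteq> e2"
    using dim by (auto simp: card_2_iff)
  define m where "m = nat \<lceil>sqrt (real n)\<rceil>"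
  have m_ge: "sqrt (real n) \<le> real m" unfolding m_def by (rule real_nat_ceiling_ge)
  moreover have "1 \<le> sqrt (real n)" using n by simp
  ultimately have "m > 0" by linarith
  interpret planar_grid e1 e2 R m by unfold_locales fact+
  note ln_n = ln_real_nat_ge_half[OF n]
  have "768 * real n * harm (2 * m) \<le> 768 * real n * (4 * ln (real n))"
    unfolding m_def by (intro mult_left_mono harm_double_ceiling_sqrt_le n) simp
  also have "\<dots> = 3072 * (real n * ln (real n))" by simp
  also have "\<dots> \<le> 56\<^sup>2 * (real n * ln (real n))" using ln_n by (intro mult_right_mono) auto
  finally have "sqrt (768 * real n * harm (2 * m)) \<le> sqrt (56\<^sup>2 * (real n * ln (real n)))"
    by (rule real_sqrt_le_mono)
  then have energy: "sqrt (768 * real n * harm (2 * m)) \<le> 56 * sqrt (real n * ln (real n))"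
    by (simp only: real_sqrt_mult[of "56\<^sup>2"]) simp
  have "real n / real m \<le> real n / sqrt (real n)"
    using m_ge n \<open>m > 0\<close> by (intro divide_left_mono) auto
  also have "\<dots> = sqrt (real n)" by (simp add: real_div_sqrt)
  also have "\<dots> \<le> sqrt (4 * (real n * ln (real n)))"
    using ln_n n by (intro real_sqrt_le_mono) (simp add: field_simps)
  finally have discretisation: "real n / real m \<le> 2 * sqrt (real n * ln (real n))"
    by (simp add: real_sqrt_mult)
  have "expected_matching_cost \<mu> \<nu> n \<le> 8 * R * (real n / real m) + R * sqrt (768 * real n * harm (2 * m))"
    using expectation_matching_cost_le[of M X Y \<Omega> \<mu> n] R(2) two_samples_axioms
    by (simp add: expectation_matching_cost same)
  also have "\<dots> \<le> 8 * R * (2 * sqrt (real n * ln (real n))) + R * (56 * sqrt (real n * ln (real n)))"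
    using R(1) energy discretisation by (intro add_mono mult_left_mono) auto
  finally show ?thesis by (simp add: algebra_simps)
qed

section \<open>Couplings\<close>

lemma two_samples_PiM:
  fixes f g :: "'b \<Rightarrow> 'a::euclidean_space"
  assumes \<gamma>: "prob_space \<gamma>" and f: "f \<in> borel_measurable \<gamma>" "AE z in \<gamma>. f z \<in> \<Omega>"
    and g: "g \<in> borel_measurable \<gamma>" "AE z in \<gamma>. g z \<in> \<Omega>" and \<Omega>: "compact \<Omega>"
  shows "two_samples (PiM UNIV (\<lambda>_::nat + nat. \<gamma>)) (\<lambda>i z. f (z (Inl i))) (\<lambda>i z. g (z (Inr i)))
    \<Omega> (distr \<gamma> borel f) (distr \<gamma> borel g)"
proof -
  let ?P = "PiM UNIV (\<lambda>_::nat + nat. \<gamma>)"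
  define h :: "nat + nat \<Rightarrow> 'b \<Rightarrow> 'a" where "h = case_sum (\<lambda>_. f) (\<lambda>_. g)"
  have h: "h j \<in> borel_measurable \<gamma>" for j using f(1) g(1) by (cases j) (simp_all add: h_def)
  have AE_component: "AE z in ?P. h j (z j) \<in> \<Omega>" for j
  proof (rule AE_PiM_component)
    show "AE z in \<gamma>. h j z \<in> \<Omega>" using f(2) g(2) by (cases j) (simp_all add: h_def)
  qed (use \<gamma> in auto)
  interpret prob_space ?P by (rule prob_space_PiM[OF \<gamma>])
  show ?thesis
  proof
    have "case_sum (\<lambda>i z. f (z (Inl i))) (\<lambda>i z. g (z (Inr i))) = (\<lambda>j z. h j (z j))"
      by (auto simp: h_def fun_eq_iff split: sum.split)
    then show "indep_vars (\<lambda>_. borel) (case_sum (\<lambda>i z. f (z (Inl i))) (\<lambda>i z. g (z (Inr i)))) UNIV"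
      using indep_vars_PiM_compose(1)[OF \<gamma> h] by simp
    show "distr ?P borel (\<lambda>z. f (z (Inl i))) = distr \<gamma> borel f" for i
      using indep_vars_PiM_compose(2)[where g = h and j = "Inl i", OF \<gamma> h] by (simp add: h_def)
    show "distr ?P borel (\<lambda>z. g (z (Inr i))) = distr \<gamma> borel g" for i
      using indep_vars_PiM_compose(2)[where g = h and j = "Inr i", OF \<gamma> h] by (simp add: h_def)
    show "AE z in ?P. f (z (Inl i)) \<in> \<Omega>" for i using AE_component[of "Inl i"] by (simp add: h_def)
    show "AE z in ?P. g (z (Inr i)) \<in> \<Omega>" for i using AE_component[of "Inr i"] by (simp add: h_def)
  qed (rule \<Omega>)
qed

lemma expected_matching_cost_le_add:
  assumes "two_samples M X Y \<Omega> \<mu> \<nu>" "two_samples M X' Y' \<Omega> \<mu>' \<nu>'"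
    and dX: "\<And>i. integrable M (\<lambda>\<omega>. dist (X i \<omega>) (X' i \<omega>))"
    and dY: "\<And>i. integrable M (\<lambda>\<omega>. dist (Y i \<omega>) (Y' i \<omega>))"
  shows "expected_matching_cost \<mu> \<nu> n \<le> expected_matching_cost \<mu>' \<nu>' n
    + ((\<Sum>i<n. \<integral>\<omega>. dist (X i \<omega>) (X' i \<omega>) \<partial>M) + (\<Sum>i<n. \<integral>\<omega>. dist (Y i \<omega>) (Y' i \<omega>) \<partial>M))"
proof -
  interpret S: two_samples M X Y \<Omega> \<mu> \<nu> by fact
  interpret S': two_samples M X' Y' \<Omega> \<mu>' \<nu>' by fact
  have "S.expectation (\<lambda>\<omega>. matching_cost (\<lambda>i. X i \<omega>) (\<lambda>i. Y i \<omega>) n) \<le>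
      S.expectation (\<lambda>\<omega>. matching_cost (\<lambda>i. X' i \<omega>) (\<lambda>i. Y' i \<omega>) n
        + ((\<Sum>i<n. dist (X i \<omega>) (X' i \<omega>)) + (\<Sum>i<n. dist (Y i \<omega>) (Y' i \<omega>))))"
    using S'.integrable_matching_cost dX dY
    by (intro integral_mono S.integrable_matching_cost matching_cost_le_add) simp
  also have "\<dots> = S.expectation (\<lambda>\<omega>. matching_cost (\<lambda>i. X' i \<omega>) (\<lambda>i. Y' i \<omega>) n)
      + ((\<Sum>i<n. S.expectation (\<lambda>\<omega>. dist (X i \<omega>) (X' i \<omega>)))
        + (\<Sum>i<n. S.expectation (\<lambda>\<omega>. dist (Y i \<omega>) (Y' i \<omega>))))"
    using S'.integrable_matching_cost dX dY by simp
  finally show ?thesis by (simp only: S.expectation_matching_cost S'.expectation_matching_cost)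
qed

text \<open>Draw i.i.d. pairs from \<open>\<gamma>\<close> and take one component of each pair. Changing the component taken
  for one of the two samples turns it into a sample of the other law, at distance the coupling cost.\<close>
lemma expected_matching_cost_coupling_le:
  fixes \<gamma> :: "('a::euclidean_space \<times> 'a) measure"
  assumes \<gamma>: "prob_space \<gamma>" "sets \<gamma> = sets borel" "AE z in \<gamma>. fst z \<in> \<Omega>" "AE z in \<gamma>. snd z \<in> \<Omega>"
    and \<Omega>: "compact \<Omega>" and \<rho>: "\<rho> = distr \<gamma> borel fst \<or> \<rho> = distr \<gamma> borel snd"
  shows "expected_matching_cost (distr \<gamma> borel fst) (distr \<gamma> borel snd) n \<le>
    expected_matching_cost \<rho> \<rho> n + real n * (\<integral>z. dist (fst z) (snd z) \<partial>\<gamma>)"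
proof -
  have proj: "fst \<in> borel_measurable \<gamma>" "snd \<in> borel_measurable \<gamma>"
    by (simp_all add: measurable_cong_sets[OF \<gamma>(2) refl] borel_prod[symmetric])
  note samples = two_samples_PiM[OF \<gamma>(1) _ _ _ _ \<Omega>]
  note mixed = samples[OF proj(1) \<gamma>(3) proj(2) \<gamma>(4)]
  note same_fst = samples[OF proj(1) \<gamma>(3) proj(1) \<gamma>(3)]
    and same_snd = samples[OF proj(2) \<gamma>(4) proj(2) \<gamma>(4)]
  have "integrable \<gamma> (\<lambda>z. dist (fst z) (snd z))"
    using prob_space.finite_measure[OF \<gamma>(1)]
    by (rule finite_measure.integrable_dist_compact[OF _ proj \<gamma>(3,4) \<Omega>])
  note cost = integral_PiM_component[of UNIV "\<lambda>_::nat + nat. \<gamma>", OF \<gamma>(1) UNIV_I this]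
  show ?thesis
    using \<rho>
  proof
    assume "\<rho> = distr \<gamma> borel fst"
    then show ?thesis
      using expected_matching_cost_le_add[OF mixed same_fst, of n] cost by (simp add: dist_commute)
  next
    assume "\<rho> = distr \<gamma> borel snd"
    then show ?thesis
      using expected_matching_cost_le_add[OF mixed same_snd, of n] cost by simp
  qed
qed

lemma couplings_cost:
  fixes \<phi>1 \<phi>2 :: "'a::euclidean_space \<Rightarrow> real"
  assumes \<gamma>: "\<gamma> \<in> couplings \<Omega> \<phi>1 \<phi>2" and \<Omega>: "compact \<Omega>"
    and prob: "prob_space (density lborel (\<lambda>x. ennreal (\<phi>1 x)))"
  shows "prob_space \<gamma>" "AE z in \<gamma>. fst z \<in> \<Omega>" "AE z in \<gamma>. snd z \<in> \<Omega>"
    and "(\<integral>\<^sup>+ z. ennreal (norm (snd z - fst z)) \<partial>\<gamma>) = ennreal (\<integral>z. dist (fst z) (snd z) \<partial>\<gamma>)"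
proof -
  have sets: "sets \<gamma> = sets borel" and null: "emeasure \<gamma> (space \<gamma> - \<Omega> \<times> \<Omega>) = 0"
    and fst: "distr \<gamma> borel fst = density lborel (\<lambda>x. ennreal (\<phi>1 x))"
    using \<gamma> by (auto simp: couplings_def)
  have proj: "fst \<in> borel_measurable \<gamma>" "snd \<in> borel_measurable \<gamma>"
    by (simp_all add: measurable_cong_sets[OF sets refl] borel_prod[symmetric])
  show "prob_space \<gamma>" by (rule prob_space_distrD[OF proj(1)]) (simp add: fst prob)
  then interpret prob_space \<gamma> .
  have "\<Omega> \<times> \<Omega> \<in> sets \<gamma>" unfolding sets using \<Omega> by (intro borel_compact compact_Times)
  then have "AE z in \<gamma>. z \<in> \<Omega> \<times> \<Omega>"
    using null by (intro AE_I[of _ _ "space \<gamma> - \<Omega> \<times> \<Omega>"]) auto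
  then show AE: "AE z in \<gamma>. fst z \<in> \<Omega>" "AE z in \<gamma>. snd z \<in> \<Omega>" by (auto elim: AE_mp)
  have "integrable \<gamma> (\<lambda>z. dist (fst z) (snd z))"
    by (rule integrable_dist_compact[OF proj AE \<Omega>])
  then show "(\<integral>\<^sup>+ z. ennreal (norm (snd z - fst z)) \<partial>\<gamma>) = ennreal (\<integral>z. dist (fst z) (snd z) \<partial>\<gamma>)"
    by (simp add: dist_norm norm_minus_commute nn_integral_eq_integral)
qed

lemma le_wassersteinI:
  fixes \<phi>1 \<phi>2 :: "'a::euclidean_space \<Rightarrow> real"
  assumes \<Omega>: "compact \<Omega>" and prob: "prob_space (density lborel (\<lambda>x. ennreal (\<phi>1 x)))"
    and nonempty: "couplings \<Omega> \<phi>1 \<phi>2 \<noteq> {}"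
    and lower: "\<And>\<gamma>. \<gamma> \<in> couplings \<Omega> \<phi>1 \<phi>2 \<Longrightarrow> a \<le> (\<integral>z. dist (fst z) (snd z) \<partial>\<gamma>)"
  shows "a \<le> wasserstein \<Omega> \<phi>1 \<phi>2"
proof -
  let ?I = "INF \<gamma>\<in>couplings \<Omega> \<phi>1 \<phi>2. \<integral>\<^sup>+ z. ennreal (norm (snd z - fst z)) \<partial>\<gamma>"
  note cost = couplings_cost(4)[OF _ \<Omega> prob]
  obtain \<gamma> where \<gamma>: "\<gamma> \<in> couplings \<Omega> \<phi>1 \<phi>2" using nonempty by blast
  have "?I \<le> ennreal (\<integral>z. dist (fst z) (snd z) \<partial>\<gamma>)"
    unfolding cost[OF \<gamma>, symmetric] by (rule INF_lower[OF \<gamma>])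
  then have "?I < \<top>" by (rule le_less_trans) simp
  moreover have "ennreal a \<le> ?I" by (intro INF_greatest) (simp add: cost lower ennreal_leI)
  ultimately have "enn2real (ennreal a) \<le> enn2real ?I" by (rule enn2real_mono[rotated])
  then show ?thesis
    unfolding wasserstein_def using enn2real_nonneg[of ?I] by (cases "0 \<le> a") (simp, linarith)
qed

lemma (in two_samples) joint_law_in_couplings:
  assumes "\<mu> = density lborel (\<lambda>x. ennreal (\<phi>1 x))" "\<nu> = density lborel (\<lambda>x. ennreal (\<phi>2 x))"
  shows "distr M borel (\<lambda>\<omega>. (X 0 \<omega>, Y 0 \<omega>)) \<in> couplings \<Omega> \<phi>1 \<phi>2"
proof -
  let ?XY = "\<lambda>\<omega>. (X 0 \<omega>, Y 0 \<omega>)"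
  have measurable_XY: "?XY \<in> borel_measurable M" by measurable
  have "\<Omega> \<times> \<Omega> \<in> sets borel" using compact by (intro borel_compact compact_Times)
  then have "emeasure (distr M borel ?XY) (- (\<Omega> \<times> \<Omega>)) = emeasure M {\<omega> \<in> space M. ?XY \<omega> \<in> - (\<Omega> \<times> \<Omega>)}"
    using measurable_XY by (subst emeasure_distr) (auto intro!: arg_cong[where f = "emeasure M"])
  also have "AE \<omega> in M. \<not> ?XY \<omega> \<in> - (\<Omega> \<times> \<Omega>)" using X_in[of 0] Y_in[of 0] by eventually_elim simp
  then have "emeasure M {\<omega> \<in> space M. ?XY \<omega> \<in> - (\<Omega> \<times> \<Omega>)} = 0" by (rule emeasure_eq_0_AE)
  finally have "emeasure (distr M borel ?XY) (space (distr M borel ?XY) - \<Omega> \<times> \<Omega>) = 0"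
    by (simp add: Compl_eq_Diff_UNIV)
  moreover have "distr (distr M borel ?XY) borel fst = \<mu>" "distr (distr M borel ?XY) borel snd = \<nu>"
    using measurable_XY law_X[of 0] law_Y[of 0]
    by (subst distr_distr; auto simp: comp_def borel_prod[symmetric])+
  ultimately show ?thesis by (simp add: couplings_def assms)
qed

lemma (in two_samples) expected_matching_cost_le_wasserstein:
  assumes \<mu>: "\<mu> = density lborel (\<lambda>x. ennreal (\<phi>1 x))" and \<nu>: "\<nu> = density lborel (\<lambda>x. ennreal (\<phi>2 x))"
    and \<rho>: "\<rho> = \<mu> \<or> \<rho> = \<nu>"
  shows "expected_matching_cost \<mu> \<nu> n \<le> real n * wasserstein \<Omega> \<phi>1 \<phi>2 + expected_matching_cost \<rho> \<rho> n"
proof (cases "n = 0")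
  case True
  have "matching_cost u v 0 = 0" for u v :: "nat \<Rightarrow> 'a" by (simp add: matching_cost_def)
  then show ?thesis using True by (simp add: expected_matching_cost_def)
next
  case False
  have prob: "prob_space (density lborel (\<lambda>x. ennreal (\<phi>1 x)))"
    unfolding \<mu>[symmetric] law_X[of 0, symmetric] by (rule prob_space_distr) simp
  note cost = couplings_cost[OF _ compact prob]
  have "(expected_matching_cost \<mu> \<nu> n - expected_matching_cost \<rho> \<rho> n) / real n \<le> wasserstein \<Omega> \<phi>1 \<phi>2"
  proof (rule le_wassersteinI[OF compact prob])
    show "couplings \<Omega> \<phi>1 \<phi>2 \<noteq> {}" using joint_law_in_couplings[OF \<mu> \<nu>] by blast
    fix \<gamma> assume \<gamma>: "\<gamma> \<in> couplings \<Omega> \<phi>1 \<phi>2"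
    then have "sets \<gamma> = sets borel" "distr \<gamma> borel fst = \<mu>" "distr \<gamma> borel snd = \<nu>"
      by (auto simp: couplings_def \<mu> \<nu>)
    with expected_matching_cost_coupling_le[OF cost(1)[OF \<gamma>] _ cost(2,3)[OF \<gamma>] compact, of \<rho> n] \<rho>
    have "expected_matching_cost \<mu> \<nu> n \<le>
        expected_matching_cost \<rho> \<rho> n + real n * (\<integral>z. dist (fst z) (snd z) \<partial>\<gamma>)"
      by simp
    then show "(expected_matching_cost \<mu> \<nu> n - expected_matching_cost \<rho> \<rho> n) / real n
        \<le> (\<integral>z. dist (fst z) (snd z) \<partial>\<gamma>)"
      using False by (simp add: pos_divide_le_eq mult.commute)
  qed
  then show ?thesis using False by (simp add: pos_divide_le_eq mult.commute)
qed

section \<open>Expected length of the optimal tour\<close>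

context two_samples
begin

lemma expectation_dist_eq:
  "expectation (\<lambda>\<omega>. dist (X i \<omega>) (Y i \<omega>)) = expectation (\<lambda>\<omega>. dist (X 0 \<omega>) (Y 0 \<omega>))"
proof -
  interpret shifted: two_samples M "\<lambda>k. X (k + i)" "\<lambda>k. Y (k + i)" \<Omega> \<mu> \<nu> by (rule compose_inj) simp_all
  have "(\<lambda>z. dist (z (Inl 0)) (z (Inr 0))) \<in> borel_measurable (PiM UNIV (\<lambda>_::nat + nat. borel :: 'a measure))"
    by (intro borel_measurable_dist measurable_component_singleton) auto
  note eq_law = shifted.expectation_eq_integral_law[OF this] expectation_eq_integral_law[OF this]
  show ?thesis using eq_law by simp
qed

lemma integrable_empty_travel: "integrable M (\<lambda>\<omega>. empty_travel (\<lambda>i. X i \<omega>) (\<lambda>i. Y i \<omega>) n)"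
  unfolding empty_travel_def using integrable_stacker_crane_opt integrable_dist by simp

lemma expectation_empty_travel:
  "expectation (\<lambda>\<omega>. empty_travel (\<lambda>i. X i \<omega>) (\<lambda>i. Y i \<omega>) n) =
    expectation (\<lambda>\<omega>. stacker_crane_opt (\<lambda>i. X i \<omega>) (\<lambda>i. Y i \<omega>) n)
    - real n * expectation (\<lambda>\<omega>. dist (X 0 \<omega>) (Y 0 \<omega>))"
proof -
  have "(\<Sum>i<n. expectation (\<lambda>\<omega>. dist (X i \<omega>) (Y i \<omega>))) = (\<Sum>i<n. expectation (\<lambda>\<omega>. dist (X 0 \<omega>) (Y 0 \<omega>)))"
    by (rule sum.cong[OF refl expectation_dist_eq])
  then show ?thesis
    unfolding empty_travel_def using integrable_stacker_crane_opt integrable_dist by simp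
qed

lemma expectation_empty_travel_permuted:
  assumes \<tau>: "inj \<tau>"
  shows "expectation (\<lambda>\<omega>. empty_travel (\<lambda>i. X i \<omega>) (\<lambda>i. Y (\<tau> i) \<omega>) n) =
    expectation (\<lambda>\<omega>. empty_travel (\<lambda>i. X i \<omega>) (\<lambda>i. Y i \<omega>) n)"
proof -
  interpret permuted: two_samples M X "\<lambda>i. Y (\<tau> i)" \<Omega> \<mu> \<nu>
    using compose_inj[of "\<lambda>i. i" \<tau>] \<tau> by simp
  have "(\<lambda>z. empty_travel (\<lambda>i. z (Inl i)) (\<lambda>i. z (Inr i)) n) \<in>
      borel_measurable (PiM UNIV (\<lambda>_::nat + nat. borel :: 'a measure))"
    unfolding empty_travel_def
    by (intro borel_measurable_diff borel_measurable_crane_functional borel_measurable_sum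
        borel_measurable_dist measurable_component_singleton) auto
  note eq_law = permuted.expectation_eq_integral_law[OF this] expectation_eq_integral_law[OF this]
  show ?thesis using eq_law by simp
qed

text \<open>Since the deliveries are exchangeable, the expectation may be averaged over all their relabellings.\<close>
lemma expectation_stacker_crane_opt_le:
  assumes n: "n \<ge> 1"
  shows "expectation (\<lambda>\<omega>. stacker_crane_opt (\<lambda>i. X i \<omega>) (\<lambda>i. Y i \<omega>) n) \<le>
    real n * expectation (\<lambda>\<omega>. dist (X 0 \<omega>) (Y 0 \<omega>)) + expected_matching_cost \<nu> \<mu> n + 2 * D * harm n"
proof -
  interpret swapped: two_samples M Y X \<Omega> \<nu> \<mu> by (rule swap)
  let ?T = "\<lambda>\<tau> \<omega>. empty_travel (\<lambda>i. X i \<omega>) (\<lambda>i. Y (\<tau> i) \<omega>) n"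
  let ?E = "expectation (\<lambda>\<omega>. empty_travel (\<lambda>i. X i \<omega>) (\<lambda>i. Y i \<omega>) n)"
  have integrable_T: "integrable M (?T \<tau>)" if "\<tau> permutes {..<n}" for \<tau>
    using two_samples.integrable_empty_travel[OF compose_inj[of "\<lambda>i. i" \<tau>]] permutes_inj[OF that] by simp
  have "fact n * ?E = (\<Sum>\<tau> | \<tau> permutes {..<n}. ?E)" by (simp add: card_permutations)
  also have "\<dots> = (\<Sum>\<tau> | \<tau> permutes {..<n}. expectation (?T \<tau>))"
    by (intro sum.cong refl expectation_empty_travel_permuted[symmetric]) (auto intro: permutes_inj)
  also have "\<dots> = expectation (\<lambda>\<omega>. \<Sum>\<tau> | \<tau> permutes {..<n}. ?T \<tau> \<omega>)"
    using integrable_T by (intro Bochner_Integration.integral_sum[symmetric]) simp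
  also have "\<dots> \<le> expectation (\<lambda>\<omega>. fact n * (matching_cost (\<lambda>i. Y i \<omega>) (\<lambda>i. X i \<omega>) n + 2 * D * harm n))"
  proof (rule integral_mono_AE)
    have "AE \<omega> in M. (\<forall>i. X i \<omega> \<in> \<Omega>) \<and> (\<forall>i. Y i \<omega> \<in> \<Omega>)"
      using X_in Y_in by (simp add: AE_all_countable)
    then show "AE \<omega> in M. (\<Sum>\<tau> | \<tau> permutes {..<n}. ?T \<tau> \<omega>) \<le>
        fact n * (matching_cost (\<lambda>i. Y i \<omega>) (\<lambda>i. X i \<omega>) n + 2 * D * harm n)"
      by eventually_elim (rule sum_empty_travel_permuted_le[OF _ n], simp add: dist_le_D)
  qed (use integrable_T swapped.integrable_matching_cost in auto)
  also have "\<dots> = fact n * (expected_matching_cost \<nu> \<mu> n + 2 * D * harm n)"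
    using swapped.integrable_matching_cost by (simp add: prob_space swapped.expectation_matching_cost)
  finally have "?E \<le> expected_matching_cost \<nu> \<mu> n + 2 * D * harm n" by simp
  then show ?thesis unfolding expectation_empty_travel by linarith
qed

lemma expectation_stacker_crane_opt_le_wasserstein:
  assumes "\<mu> = density lborel (\<lambda>x. ennreal (\<phi>P x))" "\<nu> = density lborel (\<lambda>x. ennreal (\<phi>D x))"
    and "\<rho> = \<mu> \<or> \<rho> = \<nu>" and "n \<ge> 1"
  shows "expectation (\<lambda>\<omega>. stacker_crane_opt (\<lambda>i. X i \<omega>) (\<lambda>i. Y i \<omega>) n) \<le>
    real n * (expectation (\<lambda>\<omega>. dist (X 0 \<omega>) (Y 0 \<omega>)) + wasserstein \<Omega> \<phi>D \<phi>P)
    + expected_matching_cost \<rho> \<rho> n + 2 * D * harm n"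
  using expectation_stacker_crane_opt_le[OF assms(4)] assms(3)
    two_samples.expected_matching_cost_le_wasserstein[OF swap assms(2,1), of \<rho> n]
  by (auto simp: distrib_left)

section \<open>The asymptotic bounds\<close>

lemma expected_matching_cost_div_powr_tendsto:
  fixes \<phi> :: "'a \<Rightarrow> real"
  assumes X: "\<And>i. distributed M lborel (X i) (\<lambda>x. ennreal (\<phi> x))"
    and Y: "\<And>i. distributed M lborel (Y i) (\<lambda>x. ennreal (\<phi> x))" and \<phi>: "\<And>x. 0 \<le> \<phi> x"
    and dim: "DIM('a) \<ge> 3" and \<beta>: "beta_M_property TYPE('m) TYPE('a) \<beta>"
  shows "(\<lambda>n. expected_matching_cost \<mu> \<nu> n / real n powr (1 - 1 / real DIM('a)))
    \<longlonglongrightarrow> \<beta> * (\<integral>x\<in>\<Omega>. \<phi> x powr (1 - 1 / real DIM('a)) \<partial>lborel)"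
proof -
  define q where "q = 1 - 1 / real DIM('a)"
  define I where "I = \<beta> * (\<integral>x\<in>\<Omega>. \<phi> x powr q \<partial>lborel)"
  have q: "q > 1 / 2" unfolding q_def using dim by (simp add: field_simps)
  let ?L = "\<lambda>n \<omega>. matching_cost (\<lambda>i. X i \<omega>) (\<lambda>i. Y i \<omega>) n"
  have "AE \<omega> in M. X i \<omega> \<in> \<Omega> \<and> Y i \<omega> \<in> \<Omega>" for i using X_in[of i] Y_in[of i] by eventually_elim simp
  then have "AE \<omega> in M. (\<lambda>n. ?L n \<omega> / real n powr q) \<longlonglongrightarrow> I"
    using \<beta>[unfolded beta_M_property_def, rule_format, of M \<Omega> \<phi> X Y] prob_space_axioms compact \<phi> X Y indep
    unfolding I_def q_def by simp
  moreover have "AE \<omega> in M. (\<lambda>n. (?L n \<omega> - expected_matching_cost \<mu> \<nu> n) / real n powr q) \<longlonglongrightarrow> 0"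
    using AE_deviation_div_powr_tendsto_0[OF borel_measurable_matching_functional[OF subset_refl]
        l1_lipschitz_matching_functional zero_less_one q] by (simp add: expectation_matching_cost)
  ultimately have "AE \<omega> in M. (\<lambda>n. expected_matching_cost \<mu> \<nu> n / real n powr q) \<longlonglongrightarrow> I"
  proof eventually_elim
    case (elim \<omega>)
    from tendsto_diff[OF elim] show ?case by (simp add: diff_divide_distrib)
  qed
  then show ?thesis unfolding I_def q_def by simp
qed

lemma AE_limsup_stacker_crane_opt_le:
  assumes q: "q > 1 / 2" and lim: "(\<lambda>n. m n / real n powr q) \<longlonglongrightarrow> I"
    and expectation_le: "\<And>n. n \<ge> 1 \<Longrightarrow> expectation (\<lambda>\<omega>. stacker_crane_opt (\<lambda>i. X i \<omega>) (\<lambda>i. Y i \<omega>) n) \<le>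
      real n * c + m n + C * harm n" and C: "C \<ge> 0"
  shows "AE \<omega> in M. limsup (\<lambda>n. ereal
      ((stacker_crane_opt (\<lambda>i. X i \<omega>) (\<lambda>i. Y i \<omega>) n - real n * c) / real n powr q)) \<le> ereal I"
proof -
  let ?L = "\<lambda>n \<omega>. stacker_crane_opt (\<lambda>i. X i \<omega>) (\<lambda>i. Y i \<omega>) n"
  let ?E = "\<lambda>n. expectation (?L n)"
  have "AE \<omega> in M. (\<lambda>n. (?L n \<omega> - ?E n) / real n powr q) \<longlonglongrightarrow> 0"
    using AE_deviation_div_powr_tendsto_0[OF borel_measurable_crane_functional[OF subset_refl]
        l1_lipschitz_crane_functional zero_less_numeral q] by simp
  then show ?thesis
  proof eventually_elim
    case (elim \<omega>)
    let ?b = "\<lambda>n. (?L n \<omega> - ?E n) / real n powr q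
      + (m n / real n powr q + C * ((1 + ln (real n)) / real n powr q))"
    have "(\<lambda>n. (1 + ln (real n)) / real n powr q) \<longlonglongrightarrow> 0" using q by real_asymp
    from tendsto_add[OF elim tendsto_add[OF lim tendsto_mult_left[OF this, of C]]]
    have "(\<lambda>n. ereal (?b n)) \<longlonglongrightarrow> ereal I" by simp
    then have "limsup (\<lambda>n. ereal (?b n)) = ereal I" by (intro lim_imp_Limsup) simp_all
    moreover have "(?L n \<omega> - real n * c) / real n powr q \<le> ?b n" if n: "n \<ge> 1" for n
    proof -
      have "?L n \<omega> - real n * c \<le> (?L n \<omega> - ?E n) + (m n + C * (1 + ln (real n)))"
        using expectation_le[OF n] mult_left_mono[OF harm_le_1_plus_ln[OF n] C] by linarith
      then have "(?L n \<omega> - real n * c) / real n powr q \<le>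
          ((?L n \<omega> - ?E n) + (m n + C * (1 + ln (real n)))) / real n powr q"
        by (rule divide_right_mono) simp
      then show ?thesis
        by (simp only: add_divide_distrib[of "?L n \<omega> - ?E n"] add_divide_distrib[of "m n"]
            times_divide_eq_right)
    qed
    then have "limsup (\<lambda>n. ereal ((?L n \<omega> - real n * c) / real n powr q)) \<le> limsup (\<lambda>n. ereal (?b n))"
      by (intro Limsup_mono eventually_sequentiallyI[of 1]) simp
    ultimately show ?case by simp
  qed
qed

lemma prob_stacker_crane_opt_le_ge:
  assumes s: "s > 0" and expectation_le: "expectation (\<lambda>\<omega>. stacker_crane_opt (\<lambda>i. X i \<omega>) (\<lambda>i. Y i \<omega>) n) \<le> b"
  shows "prob {\<omega> \<in> space M. stacker_crane_opt (\<lambda>i. X i \<omega>) (\<lambda>i. Y i \<omega>) n \<le> b + s}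
    \<ge> 1 - 2 * exp (- s\<^sup>2 / ((2 * D)\<^sup>2 * real n))"
proof -
  let ?L = "\<lambda>\<omega>. stacker_crane_opt (\<lambda>i. X i \<omega>) (\<lambda>i. Y i \<omega>) n"
  define B where "B = {\<omega> \<in> space M. \<bar>?L \<omega> - expectation ?L\<bar> \<ge> s}"
  have B: "B \<in> events" unfolding B_def by measurable
  have "prob B \<le> 2 * exp (- s\<^sup>2 / ((2 * D)\<^sup>2 * real n))"
    using deviation_bound[OF borel_measurable_crane_functional[OF subset_refl]
        l1_lipschitz_crane_functional _ s] by (simp add: B_def)
  then have "1 - 2 * exp (- s\<^sup>2 / ((2 * D)\<^sup>2 * real n)) \<le> prob (space M - B)" using prob_compl[OF B] by simp
  also have "\<dots> \<le> prob {\<omega> \<in> space M. ?L \<omega> \<le> b + s}"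
    using expectation_le by (intro finite_measure_mono) (auto simp: B_def)
  finally show ?thesis .
qed

lemma prob_stacker_crane_opt_le_tendsto_1:
  assumes expectation_le: "\<And>n. n \<ge> 2 \<Longrightarrow> expectation (\<lambda>\<omega>. stacker_crane_opt (\<lambda>i. X i \<omega>) (\<lambda>i. Y i \<omega>) n) \<le>
      real n * c + C * sqrt (real n * ln (real n))"
  shows "(\<lambda>n. prob {\<omega> \<in> space M. (stacker_crane_opt (\<lambda>i. X i \<omega>) (\<lambda>i. Y i \<omega>) n - real n * c)
    / sqrt (real n * ln (real n)) \<le> C + 1}) \<longlonglongrightarrow> 1"
proof (rule tendsto_sandwich)
  let ?s = "\<lambda>n. sqrt (real n * ln (real n))"
  let ?p = "\<lambda>n. prob {\<omega> \<in> space M. (stacker_crane_opt (\<lambda>i. X i \<omega>) (\<lambda>i. Y i \<omega>) n - real n * c) / ?s n \<le> C + 1}"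
  define a where "a = 1 / (2 * D)\<^sup>2"
  have "a > 0" using D_pos by (simp add: a_def)
  then show "(\<lambda>n. 1 - 2 * exp (- a * ln (real n))) \<longlonglongrightarrow> 1" by real_asymp
  show "\<forall>\<^sub>F n in sequentially. ?p n \<le> 1" by simp
  have "1 - 2 * exp (- a * ln (real n)) \<le> ?p n" if n: "n \<ge> 2" for n
  proof -
    have s: "?s n > 0" using n by simp
    have "(?s n)\<^sup>2 = real n * ln (real n)" using n by simp
    then have "- a * ln (real n) = - (?s n)\<^sup>2 / ((2 * D)\<^sup>2 * real n)" using n by (simp add: a_def)
    moreover have "L \<le> real n * c + C * ?s n + ?s n \<longleftrightarrow> (L - real n * c) / ?s n \<le> C + 1" for L
      unfolding pos_divide_le_eq[OF s] by (simp add: distrib_right) linarith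
    ultimately show ?thesis using prob_stacker_crane_opt_le_ge[OF s expectation_le[OF n]] by simp
  qed
  then show "\<forall>\<^sub>F n in sequentially. 1 - 2 * exp (- a * ln (real n)) \<le> ?p n"
    by (rule eventually_sequentiallyI)
qed simp

end

lemma two_samples_of_densities:
  fixes X Y :: "nat \<Rightarrow> 'm \<Rightarrow> 'a::euclidean_space"
  assumes "prob_space M" "compact \<Omega>"
    and X: "\<And>i. distributed M lborel (X i) f" and Y: "\<And>i. distributed M lborel (Y i) g"
    and "\<And>i. AE \<omega> in M. X i \<omega> \<in> \<Omega> \<and> Y i \<omega> \<in> \<Omega>"
    and "prob_space.indep_vars M (\<lambda>_. borel) (case_sum X Y) UNIV"
  shows "two_samples M X Y \<Omega> (density lborel f) (density lborel g)"
proof -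
  interpret prob_space M by fact
  have law: "distr M borel Z = density lborel h" if "distributed M lborel Z h" for Z :: "'m \<Rightarrow> 'a" and h
    using distributed_distr_eq_density[OF that] by (subst distr_cong[of M M borel lborel]) auto
  show ?thesis
  proof
    show "AE \<omega> in M. X i \<omega> \<in> \<Omega>" "AE \<omega> in M. Y i \<omega> \<in> \<Omega>" for i
      using assms(5)[of i] by auto
  qed (use assms law in auto)
qed

context two_samples
begin

lemma AE_limsup_stacker_crane_opt_le_matching:
  fixes \<phi>P \<phi>D \<phi> :: "'a \<Rightarrow> real"
  defines "c \<equiv> expectation (\<lambda>\<omega>. dist (X 0 \<omega>) (Y 0 \<omega>)) + wasserstein \<Omega> \<phi>D \<phi>P"
  assumes \<mu>: "\<mu> = density lborel (\<lambda>x. ennreal (\<phi>P x))" and \<nu>: "\<nu> = density lborel (\<lambda>x. ennreal (\<phi>D x))"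
    and UV: "two_samples M U V \<Omega> \<rho> \<rho>" "\<rho> = \<mu> \<or> \<rho> = \<nu>"
    and U: "\<And>i. distributed M lborel (U i) (\<lambda>x. ennreal (\<phi> x))"
    and V: "\<And>i. distributed M lborel (V i) (\<lambda>x. ennreal (\<phi> x))" and \<phi>: "\<And>x. 0 \<le> \<phi> x"
    and dim: "DIM('a) \<ge> 3" and \<beta>: "beta_M_property TYPE('m) TYPE('a) \<beta>"
  shows "AE \<omega> in M. limsup (\<lambda>n. ereal ((stacker_crane_opt (\<lambda>i. X i \<omega>) (\<lambda>i. Y i \<omega>) n - real n * c)
      / real n powr (1 - 1 / real DIM('a))))
    \<le> ereal (\<beta> * (\<integral>x\<in>\<Omega>. \<phi> x powr (1 - 1 / real DIM('a)) \<partial>lborel))"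
proof (rule AE_limsup_stacker_crane_opt_le)
  show "(\<lambda>n. expected_matching_cost \<rho> \<rho> n / real n powr (1 - 1 / real DIM('a)))
      \<longlonglongrightarrow> \<beta> * (\<integral>x\<in>\<Omega>. \<phi> x powr (1 - 1 / real DIM('a)) \<partial>lborel)"
    by (rule two_samples.expected_matching_cost_div_powr_tendsto[OF UV(1) U V \<phi> dim \<beta>])
  show "1 / 2 < 1 - 1 / real DIM('a)" using dim by (simp add: field_simps)
qed (use expectation_stacker_crane_opt_le_wasserstein[OF \<mu> \<nu> UV(2)] D_pos in \<open>auto simp: c_def\<close>)

lemma prob_stacker_crane_opt_plane_tendsto_1:
  fixes \<phi>P \<phi>D :: "'a \<Rightarrow> real"
  defines "c \<equiv> expectation (\<lambda>\<omega>. dist (X 0 \<omega>) (Y 0 \<omega>)) + wasserstein \<Omega> \<phi>D \<phi>P"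
  assumes dim: "DIM('a) = 2"
    and \<mu>: "\<mu> = density lborel (\<lambda>x. ennreal (\<phi>P x))" and \<nu>: "\<nu> = density lborel (\<lambda>x. ennreal (\<phi>D x))"
  shows "\<exists>\<gamma>>0. (\<lambda>n. prob {\<omega> \<in> space M. (stacker_crane_opt (\<lambda>i. X i \<omega>) (\<lambda>i. Y i \<omega>) n - real n * c)
    / sqrt (real n * ln (real n)) \<le> \<gamma>}) \<longlonglongrightarrow> 1"
proof -
  obtain R where R: "R > 0" "\<And>x. x \<in> \<Omega> \<Longrightarrow> norm x \<le> R"
    using compact_imp_bounded[OF compact] bounded_pos by blast
  let ?s = "\<lambda>n. sqrt (real n * ln (real n))"
  have "expectation (\<lambda>\<omega>. stacker_crane_opt (\<lambda>i. X i \<omega>) (\<lambda>i. Y i \<omega>) n) \<le> real n * c + (72 * R + 6 * D) * ?s n"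
    if n: "n \<ge> 2" for n
  proof -
    have "expected_matching_cost \<mu> \<mu> n \<le> 72 * R * ?s n"
      by (rule two_samples.expected_matching_cost_plane_le[OF split_X dim refl R n])
    moreover have "2 * D * harm n \<le> 2 * D * (3 * ?s n)"
      using D_pos by (intro mult_left_mono harm_le_sqrt n) simp
    moreover have "expectation (\<lambda>\<omega>. stacker_crane_opt (\<lambda>i. X i \<omega>) (\<lambda>i. Y i \<omega>) n)
        \<le> real n * c + expected_matching_cost \<mu> \<mu> n + 2 * D * harm n"
      unfolding c_def using n by (intro expectation_stacker_crane_opt_le_wasserstein[OF \<mu> \<nu>]) auto
    ultimately show ?thesis unfolding distrib_right by linarith
  qed
  then have "(\<lambda>n. prob {\<omega> \<in> space M. (stacker_crane_opt (\<lambda>i. X i \<omega>) (\<lambda>i. Y i \<omega>) n - real n * c)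
      / ?s n \<le> 72 * R + 6 * D + 1}) \<longlonglongrightarrow> 1"
    by (rule prob_stacker_crane_opt_le_tendsto_1)
  moreover have "72 * R + 6 * D + 1 > 0" using R(1) D_pos by simp
  ultimately show ?thesis by blast
qed

end

theorem theorem3:
  fixes M :: "'m measure" and \<Omega> :: "'a::euclidean_space set"
    and \<phi>P \<phi>D :: "'a \<Rightarrow> real" and X Y :: "nat \<Rightarrow> 'm \<Rightarrow> 'a"
  assumes "prob_space M"
    and "compact \<Omega>"
    and "DIM('a) \<ge> 2"
    and "\<forall>x. 0 \<le> \<phi>P x" and "\<forall>x. 0 \<le> \<phi>D x"
    and "\<forall>i. distributed M lborel (X i) (\<lambda>x. ennreal (\<phi>P x))"
    and "\<forall>i. distributed M lborel (Y i) (\<lambda>x. ennreal (\<phi>D x))"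
    and "\<forall>i. AE \<omega> in M. X i \<omega> \<in> \<Omega> \<and> Y i \<omega> \<in> \<Omega>"
    and "prob_space.indep_vars M (\<lambda>_. borel) (case_sum X Y) UNIV"
  defines "L \<equiv> \<lambda>n \<omega>. stacker_crane_opt (\<lambda>i. X i \<omega>) (\<lambda>i. Y i \<omega>) n"
    and "c \<equiv> (\<integral>\<omega>. dist (X 0 \<omega>) (Y 0 \<omega>) \<partial>M) + wasserstein \<Omega> \<phi>D \<phi>P"
    and "d \<equiv> real DIM('a)"
  shows "(DIM('a) \<ge> 3 \<longrightarrow> (\<forall>\<beta>. beta_M_property TYPE('m) TYPE('a) \<beta> \<longrightarrow>
            (AE \<omega> in M.
               limsup (\<lambda>n. ereal ((L n \<omega> - real n * c) / real n powr (1 - 1 / d)))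
               \<le> ereal (min (\<beta> * (\<integral>x\<in>\<Omega>. \<phi>P x powr (1 - 1 / d) \<partial>lborel))
                             (\<beta> * (\<integral>x\<in>\<Omega>. \<phi>D x powr (1 - 1 / d) \<partial>lborel))))))
       \<and> (DIM('a) = 2 \<longrightarrow> (\<exists>\<gamma>>0.
            (\<lambda>n. measure M {\<omega> \<in> space M.
                    (L n \<omega> - real n * c) / sqrt (real n * ln (real n)) \<le> \<gamma>})
            \<longlonglongrightarrow> 1))"
proof -
  let ?\<mu> = "density lborel (\<lambda>x. ennreal (\<phi>P x))" and ?\<nu> = "density lborel (\<lambda>x. ennreal (\<phi>D x))"
  interpret S: two_samples M X Y \<Omega> ?\<mu> ?\<nu>
    using assms(1-9) by (intro two_samples_of_densities) auto
  interpret swapped: two_samples M Y X \<Omega> ?\<nu> ?\<mu> by (rule S.swap)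
  show ?thesis
    unfolding L_def c_def d_def
  proof (intro conjI impI allI)
    fix \<beta> assume dim: "DIM('a) \<ge> 3" and \<beta>: "beta_M_property TYPE('m) TYPE('a) \<beta>"
    note bound = S.AE_limsup_stacker_crane_opt_le_matching[OF refl refl _ _ _ _ _ dim \<beta>]
    from bound[OF S.split_X, of \<phi>P] bound[OF swapped.split_X, of \<phi>D] assms(4-7)
    show "AE \<omega> in M. limsup (\<lambda>n. ereal ((stacker_crane_opt (\<lambda>i. X i \<omega>) (\<lambda>i. Y i \<omega>) n - real n *
        ((\<integral>\<omega>. dist (X 0 \<omega>) (Y 0 \<omega>) \<partial>M) + wasserstein \<Omega> \<phi>D \<phi>P)) / real n powr (1 - 1 / real DIM('a))))
      \<le> ereal (min (\<beta> * (\<integral>x\<in>\<Omega>. \<phi>P x powr (1 - 1 / real DIM('a)) \<partial>lborel))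
          (\<beta> * (\<integral>x\<in>\<Omega>. \<phi>D x powr (1 - 1 / real DIM('a)) \<partial>lborel)))"
      by (simp add: min_def)
  next
    assume "DIM('a) = 2"
    then show "\<exists>\<gamma>>0. (\<lambda>n. measure M {\<omega> \<in> space M. (stacker_crane_opt (\<lambda>i. X i \<omega>) (\<lambda>i. Y i \<omega>) n - real n *
        ((\<integral>\<omega>. dist (X 0 \<omega>) (Y 0 \<omega>) \<partial>M) + wasserstein \<Omega> \<phi>D \<phi>P)) / sqrt (real n * ln (real n)) \<le> \<gamma>})
      \<longlonglongrightarrow> 1"
      by (rule S.prob_stacker_crane_opt_plane_tendsto_1[OF _ refl refl])
  qed
qed

end
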